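(* Let $1<p<\infty$ and let $\mathscr{U}\subset\mathbb{C}^n$ be a monomial polyhedron. Then the operator $$(\bm{P}^{\mathscr{U}}_{p,1})^+f(z)=\int_{\mathscr{U}}\big|K^{\mathscr{U}}_{p,1}(z,w)\big|\,f(w)\,dV(w)$$ is bounded from $L^p(\mathscr{U})$ to itself.
   Context: $dV$ is Lebesgue measure. For $\alpha\in\mathbb{Z}^n$, $e_\alpha(z)=z_1^{\alpha_1}\cdots z_n^{\alpha_n}$ denotes the Laurent monomial. A monomial polyhedron is a bounded domain of the form $\mathscr{U}=\{z\in\mathbb{C}^n: e_{\alpha^j}(z)\text{ is defined and }|e_{\alpha^j}(z)|<1,\ 1\le j\le n\}$ for $n$ multi-indices $\alpha^1,\dots,\alpha^n\in\mathbb{Z}^n$ such that the integer matrix with rows $\alpha^1,\dots,\alpha^n$ has nonzero determinant (here $e_{\alpha^j}(z)$ is defined if $z_k\neq0$ whenever $\alpha^j_k<0$). For a domain $\Omega$, $A^p(\Omega)$ is the space of holomorphic functions $f$ on $\Omega$ with $\|f\|_p^p=\int_\Omega|f|^p\,dV<\infty$, and $\mathcal{S}_p(\Omega)=\{\alpha\in\mathbb{Z}^n: e_\alpha\in A^p(\Omega)\}$. The Monomial Basis Kernel of $A^p(\Omega)$ is $$K^{\Omega}_{p,1}(z,w)=\sum_{\alpha\in\mathcal{S}_p(\Omega)}\frac{e_\alpha(z)\,\overline{e_\alpha(w)}\,|e_\alpha(w)|^{p-2}}{\|e_\alpha\|_p^p},\qquad z,w\in\Omega.$$ *)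

theory Defs
  imports "HOL-Analysis.Analysis"
begin

definition mono :: "int ^ 'n \<Rightarrow> complex ^ 'n \<Rightarrow> complex" where
  "mono \<alpha> z = (\<Prod>k\<in>UNIV. (z $ k) powi (\<alpha> $ k))"

definition mono_defined :: "int ^ 'n \<Rightarrow> complex ^ 'n \<Rightarrow> bool" where
  "mono_defined \<alpha> z \<longleftrightarrow> (\<forall>k. \<alpha> $ k < 0 \<longrightarrow> z $ k \<noteq> 0)"

definition monomial_polyhedron :: "(complex ^ 'n) set \<Rightarrow> bool" where
  "monomial_polyhedron U \<longleftrightarrow> open U \<and> connected U \<and> bounded U \<and>
     (\<exists>A :: int ^ 'n ^ 'n. det A \<noteq> 0 \<and>
        U = {z. \<forall>j. mono_defined (A $ j) z \<and> norm (mono (A $ j) z) < 1})"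

definition holo_on :: "(complex ^ 'n) set \<Rightarrow> (complex ^ 'n \<Rightarrow> complex) \<Rightarrow> bool" where
  "holo_on U f \<longleftrightarrow> (\<forall>z\<in>U. \<exists>L. (f has_derivative L) (at z) \<and>
                         (\<forall>c x. L (c *s x) = c * L x))"

definition Lp_normp :: "real \<Rightarrow> (complex ^ 'n) set \<Rightarrow> (complex ^ 'n \<Rightarrow> complex) \<Rightarrow> ennreal" where
  "Lp_normp p U f = (\<integral>\<^sup>+ z. ennreal (norm (f z) powr p) \<partial>lebesgue_on U)"

definition in_Lp :: "real \<Rightarrow> (complex ^ 'n) set \<Rightarrow> (complex ^ 'n \<Rightarrow> complex) \<Rightarrow> bool" where
  "in_Lp p U f \<longleftrightarrow> f \<in> borel_measurable (lebesgue_on U) \<and> Lp_normp p U f < \<infinity>"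

definition bergman :: "real \<Rightarrow> (complex ^ 'n) set \<Rightarrow> (complex ^ 'n \<Rightarrow> complex) set" where
  "bergman p U = {f. holo_on U f \<and> in_Lp p U f}"

definition Sp :: "real \<Rightarrow> (complex ^ 'n) set \<Rightarrow> (int ^ 'n) set" where
  "Sp p U = {\<alpha>. (\<forall>z\<in>U. mono_defined \<alpha> z) \<and> mono \<alpha> \<in> bergman p U}"

definition mbk :: "real \<Rightarrow> (complex ^ 'n) set \<Rightarrow> complex ^ 'n \<Rightarrow> complex ^ 'n \<Rightarrow> complex" where
  "mbk p U z w = (\<Sum>\<^sub>\<infinity>\<alpha>\<in>Sp p U.
      mono \<alpha> z * cnj (mono \<alpha> w) * of_real (norm (mono \<alpha> w) powr (p - 2))
        / of_real (enn2real (Lp_normp p U (mono \<alpha>))))"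

definition pos_op :: "real \<Rightarrow> (complex ^ 'n) set \<Rightarrow> (complex ^ 'n \<Rightarrow> complex) \<Rightarrow> complex ^ 'n \<Rightarrow> complex" where
  "pos_op p U f z = (\<integral> w. of_real (norm (mbk p U z w)) * f w \<partial>lebesgue_on U)"

end

theory Submission
  imports Defs "HOL-Complex_Analysis.Cauchy_Integral_Formula"
begin

text \<open>
  Off a null set, \<open>z \<mapsto> (ln |mono (A $ j) z|)\<^sub>j\<close> maps \<open>U\<close> onto the negative orthant and pushes the Haar
  measure \<open>dV / \<Prod>|z\<^sub>k|\<^sup>2\<close> forward to a translation invariant measure, i.e. to a multiple of Lebesgue
  measure. Hence \<open>\<parallel>mono \<alpha>\<parallel>\<^sup>p\<close> equals a constant divided by a product of affine functions of \<open>\<alpha>\<close>.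
  Modulo the lattice spanned by the rows of \<open>A\<close>, the exponents in \<open>Sp\<close> have finitely many minimal
  representatives \<open>a\<close>, each contributing \<open>a + A\<^sup>T \<nat>\<^sup>n\<close>, so the kernel is a finite sum of products of
  one-variable series \<open>\<Sum>(\<beta> + p m) X\<^sup>m = (\<beta> + (p - \<beta>) X) / (1 - X)\<^sup>2\<close>, where \<open>X\<close> is built from the \<open>j\<close>-th
  row monomial at \<open>z\<close> and \<open>w\<close>. Each summand is bounded on \<open>L\<^sup>p\<close> by Schur's test with
  \<open>u = |mono a| \<Prod>\<^sub>j (1 - |mono (A $ j)|) powr (- 1 / p)\<close>: averaging over rotations turns \<open>1 / |1 - X|\<^sup>2\<close>
  into \<open>1 / (1 - |X|\<^sup>2)\<close>, and the integrals split into one-dimensional radial ones.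
\<close>

subsection \<open>Translation invariant measures\<close>

text \<open>Averaging before estimating is essential: the pointwise bound
  \<open>1 / (1 - |X|)^2\<close> for the kernel is too large by a full power of
  \<open>1 - |X|\<close>, whereas \<open>1 / (1 - |X|^2)\<close>, integrated against a weight
  \<open>(1 - |x|) powr (- \<sigma>)\<close>, reproduces such a weight for 0 < \<sigma> < 1. For p
  \<noteq> 2 the kernel is not symmetric: |X| is linear in the modulus of the row monomial at z and
  of order p - 1 at w. Rows and columns are therefore estimated separately, with \<sigma> = 1/p and
  \<sigma> = (p - 1)/p, both in (0, 1) because 1 < p < \<infinity>. The numerators of the summed
  series are bounded and enter only the constants. The row monomials may form a map of the torus
  that is not injective; logarithms of moduli together with real phases avoid its branches, so the
  real inverse of A is enough. Boundedness of U gives finite measure and also forces the inverse of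
  A to be nonnegative. The latter controls the exponents in those coordinates whose zero set meets
  U, where an integrable monomial may be undefined.\<close>

lemma translation_invariant_eq_lborel:
  fixes \<nu> :: "'a::euclidean_space measure"
  assumes sets[measurable_cong]: "sets \<nu> = sets borel"
    and inv: "\<And>a. distr \<nu> borel (\<lambda>x. a + x) = \<nu>"
    and fin: "\<And>r. emeasure \<nu> (cball 0 r) < \<infinity>"
  obtains C :: real where "0 \<le> C"
    "\<And>B. B \<in> sets borel \<Longrightarrow> emeasure \<nu> B = ennreal C * emeasure lborel B"
proof -
  have space: "space \<nu> = UNIV" using sets_eq_imp_space_eq[OF sets] by simp
  have "sigma_finite_measure \<nu>"
  proof
    show "\<exists>A. countable A \<and> A \<subseteq> sets \<nu> \<and> \<Union> A = space \<nu> \<and> (\<forall>a\<in>A. emeasure \<nu> a \<noteq> \<infinity>)"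
    proof (intro exI conjI ballI)
      let ?A = "range (\<lambda>n::nat. cball (0::'a) (real n))"
      show "countable ?A" by simp
      show "?A \<subseteq> sets \<nu>" by (auto simp: sets)
      have "\<exists>n::nat. norm x \<le> real n" for x :: 'a by (rule real_arch_simple)
      then show "\<Union> ?A = space \<nu>" by (auto simp: space)
      show "emeasure \<nu> a \<noteq> \<infinity>" if "a \<in> ?A" for a
        using that fin by (auto simp: less_top)
    qed
  qed
  then interpret N: sigma_finite_measure \<nu> .
  interpret P: pair_sigma_finite "lborel :: 'a measure" \<nu> ..
  define Q where "Q = box 0 (One::'a)"
  define c where "c = emeasure \<nu> (uminus -` Q)"
  have Q[measurable]: "Q \<in> sets borel" by (simp add: Q_def)
  have Qm: "uminus -` Q \<in> sets borel"
  proof -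
    have "(uminus :: 'a \<Rightarrow> 'a) \<in> borel \<rightarrow>\<^sub>M borel" by measurable
    from measurable_sets_borel[OF this Q] show ?thesis .
  qed
  have Q1: "emeasure lborel Q = 1"
    by (simp add: Q_def emeasure_lborel_box_eq)
  have shift: "(\<integral>\<^sup>+y. f (a + y) \<partial>\<nu>) = (\<integral>\<^sup>+y. f y \<partial>\<nu>)"
    if [measurable]: "f \<in> borel_measurable borel" for f :: "'a \<Rightarrow> ennreal" and a
  proof -
    have "(\<integral>\<^sup>+y. f y \<partial>distr \<nu> borel (\<lambda>x. a + x)) = (\<integral>\<^sup>+y. f (a + y) \<partial>\<nu>)"
      by (rule nn_integral_distr) simp_all
    then show ?thesis by (simp add: inv)
  qed
  have lshift: "(\<integral>\<^sup>+y. f (y + a) \<partial>lborel) = (\<integral>\<^sup>+y. f y \<partial>lborel)"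
    if [measurable]: "f \<in> borel_measurable borel" for f :: "'a \<Rightarrow> ennreal" and a
    by (subst (2) lborel_distr_plus[of a, symmetric]) (simp add: nn_integral_distr add.commute)
  \<comment> \<open>Uniqueness of Haar measure: integrate
    \<open>indicator Q x * indicator B (x + y)\<close> over \<open>lborel\<close> and
    \<open>\<nu>\<close>. Invariance of \<open>\<nu>\<close> gives \<open>\<nu> B\<close>, since
    \<open>Q\<close> has volume 1; substituting \<open>x - y\<close> for \<open>x\<close> in the
    Lebesgue integral gives instead \<open>c\<close>, the mass of the reflected box, times the
    volume of \<open>B\<close>.\<close>
  have main: "emeasure \<nu> B = c * emeasure lborel B" if [measurable]: "B \<in> sets borel" for B
  proof -
    have [measurable]: "B \<in> sets \<nu>" by (simp add: sets)
    have "emeasure \<nu> B = (\<integral>\<^sup>+x. indicator Q x * (\<integral>\<^sup>+y. indicator B y \<partial>\<nu>) \<partial>lborel)"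
      using Q1 by (simp add: nn_integral_multc)
    also have "\<dots> = (\<integral>\<^sup>+x. indicator Q x * (\<integral>\<^sup>+y. indicator B (x + y) \<partial>\<nu>) \<partial>lborel)"
      by (subst shift) simp_all
    also have "\<dots> = (\<integral>\<^sup>+x. (\<integral>\<^sup>+y. indicator Q x * indicator B (x + y) \<partial>\<nu>) \<partial>lborel)"
      by (subst nn_integral_cmult) simp_all
    also have "\<dots> = (\<integral>\<^sup>+y. (\<integral>\<^sup>+x. indicator Q x * indicator B (x + y) \<partial>lborel) \<partial>\<nu>)"
      by (rule P.Fubini'[symmetric]) measurable
    also have "\<dots> = (\<integral>\<^sup>+y. (\<integral>\<^sup>+x. indicator Q (x - y) * indicator B x \<partial>lborel) \<partial>\<nu>)"
      using lshift[of "\<lambda>x. indicator Q (x - a) * indicator B x" a for a] by simp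
    also have "\<dots> = (\<integral>\<^sup>+x. (\<integral>\<^sup>+y. indicator Q (x - y) * indicator B x \<partial>\<nu>) \<partial>lborel)"
      by (rule P.Fubini') measurable
    also have "\<dots> = (\<integral>\<^sup>+x. c * indicator B x \<partial>lborel)"
    proof (rule nn_integral_cong)
      fix x :: 'a
      have "(\<integral>\<^sup>+y. indicator Q (x - y) \<partial>\<nu>) = (\<integral>\<^sup>+y. indicator Q (- y) \<partial>\<nu>)"
        using shift[of "\<lambda>y. indicator Q (x - y)" x] by simp
      also have "\<dots> = (\<integral>\<^sup>+y. indicator (uminus -` Q) y \<partial>\<nu>)"
        by (intro nn_integral_cong) (simp add: indicator_def)
      also have "\<dots> = c"
        unfolding c_def by (rule nn_integral_indicator) (simp add: sets Qm)
      finally show "(\<integral>\<^sup>+y. indicator Q (x - y) * indicator B x \<partial>\<nu>) = c * indicator B x"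
        by (simp add: nn_integral_multc)
    qed
    also have "\<dots> = c * emeasure lborel B" by (simp add: nn_integral_cmult)
    finally show ?thesis .
  qed
  have "bounded Q" by (simp add: Q_def)
  then obtain r where r: "Q \<subseteq> cball 0 r"
    by (meson bounded_subset_ballD ball_subset_cball order_trans)
  have "c \<le> emeasure \<nu> (cball 0 r)"
    unfolding c_def by (rule emeasure_mono) (use r in \<open>auto simp: sets\<close>)
  then have "c < \<infinity>" using fin[of r] by (rule order_le_less_trans)
  then obtain C where "0 \<le> C" "c = ennreal C" by (cases c) auto
  with main that show ?thesis by blast
qed

text \<open>The image of Lebesgue measure under \<open>R\<close> is translation invariant because
  \<open>R\<close> is onto, hence a multiple of Lebesgue measure; the unit ball, which
  \<open>R\<close> preserves, shows that the factor is 1. Coordinatewise rotations are the intended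
  case.\<close>

lemma nn_integral_lborel_linear_isometry:
  fixes R :: "'a::euclidean_space \<Rightarrow> 'a"
  assumes lin: "linear R" and iso: "\<And>x. norm (R x) = norm x"
    and f[measurable]: "f \<in> borel_measurable borel"
  shows "(\<integral>\<^sup>+x. f (R x) \<partial>lborel) = (\<integral>\<^sup>+x. f x \<partial>lborel)"
proof -
  interpret linear R by fact
  have [measurable]: "R \<in> borel_measurable borel"
    by (intro borel_measurable_continuous_onI linear_continuous_on linear_conv_bounded_linear[THEN iffD1] lin)
  define \<nu> where "\<nu> = distr (lborel::'a measure) borel R"
  have sets: "sets \<nu> = sets borel" by (simp add: \<nu>_def)
  have "inj R"
    using iso by (auto simp: inj_iff_eq_0 intro!: inj_onI) (metis iso norm_eq_zero)
  then have surj: "surj R" using lin by (simp add: linear_injective_imp_surjective)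
  have pre: "R -` cball 0 r = cball 0 r" for r using iso by auto
  have ball: "emeasure \<nu> (cball 0 r) = emeasure lborel (cball (0::'a) r)" for r
    unfolding \<nu>_def by (subst emeasure_distr) (simp_all add: pre)
  have inv: "distr \<nu> borel (\<lambda>x. a + x) = \<nu>" for a
  proof -
    obtain b where b: "a = R b" using surj by (metis surjD)
    have "distr \<nu> borel (\<lambda>x. a + x) = distr lborel borel (R \<circ> (\<lambda>x. b + x))"
      unfolding \<nu>_def by (subst distr_distr) (simp_all add: b add comp_def)
    also have "\<dots> = distr (distr lborel borel (\<lambda>x. b + x)) borel R"
      by (subst distr_distr) simp_all
    finally show ?thesis by (simp add: lborel_distr_plus \<nu>_def)
  qed
  have fin: "emeasure \<nu> (cball 0 r) < \<infinity>" for r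
    using ball emeasure_lborel_cball_finite[of 0 r] by simp
  obtain C where C: "0 \<le> C"
    "\<And>B. B \<in> sets borel \<Longrightarrow> emeasure \<nu> B = ennreal C * emeasure lborel B"
    using translation_invariant_eq_lborel[OF sets inv fin] by blast
  have pos: "emeasure lborel (cball (0::'a) 1) \<noteq> 0"
    using less_imp_neq[OF unit_ball_vol_pos[of "real DIM('a)"]] by (simp add: emeasure_cball)
  have "ennreal C * emeasure lborel (cball (0::'a) 1) = 1 * emeasure lborel (cball (0::'a) 1)"
    using C(2)[of "cball 0 1"] ball[of 1] by simp
  then have "ennreal C = 1"
    using pos emeasure_lborel_cball_finite[of "0::'a" 1]
    by (metis ennreal_mult_cancel_left mult.commute less_irrefl infinity_ennreal_def)
  then have "\<nu> = lborel"
    by (intro measure_eqI) (simp_all add: sets C(2))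
  then have "(\<integral>\<^sup>+x. f x \<partial>lborel) = (\<integral>\<^sup>+x. f x \<partial>\<nu>)" by simp
  also have "\<dots> = (\<integral>\<^sup>+x. f (R x) \<partial>lborel)"
    unfolding \<nu>_def by (rule nn_integral_distr) simp_all
  finally show ?thesis by simp
qed

subsection \<open>One-dimensional integrals\<close>

text \<open>On the unit circle \<open>1 / |1 - c u|^2 = u / ((1 - c u) (u - cnj c))\<close>, so this
  Poisson integral is Cauchy's formula for \<open>1 / (1 - c u)\<close> at the interior point
  \<open>cnj c\<close>.\<close>

lemma nn_integral_inverse_norm_sq_circle:
  fixes c :: complex
  assumes c: "norm c < 1"
  shows "(\<integral>\<^sup>+\<psi>. ennreal (1 / (norm (1 - c * cis \<psi>))\<^sup>2) * indicator {0..2*pi} \<psi> \<partial>lborel)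
    = ennreal (2 * pi / (1 - (norm c)\<^sup>2))"
proof -
  have nz: "1 - c * u \<noteq> 0" if "norm u \<le> 1" for u
  proof
    assume "1 - c * u = 0"
    then have "norm c * norm u = 1" by (metis eq_iff_diff_eq_0 norm_mult norm_one)
    moreover have "norm c * norm u \<le> norm c" using that by (simp add: mult_left_le)
    ultimately show False using c by simp
  qed
  have hol: "(\<lambda>u. 1 / (1 - c * u)) holomorphic_on cball 0 1"
    by (intro holomorphic_intros) (use nz in auto)
  have "((\<lambda>u. 1 / (1 - c * u) / (u - cnj c)) has_contour_integral
      (2 * of_real pi * \<i> * (1 / (1 - c * cnj c)))) (circlepath 0 1)"
    by (rule Cauchy_integral_circlepath_simple[OF hol]) (use c in simp)
  then have "((\<lambda>t. 1 / (1 - c * cis t) / (cis t - cnj c) * \<i> * cis t) has_integral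
      (2 * of_real pi * \<i> * (1 / (1 - c * cnj c)))) {0..2*pi}"
    unfolding circlepath_def by (subst (asm) has_contour_integral_part_circlepath_iff) simp_all
  then have "((\<lambda>t. 1 / (1 - c * cis t) / (cis t - cnj c) * \<i> * cis t / \<i>) has_integral
      (2 * of_real pi * \<i> * (1 / (1 - c * cnj c)) / \<i>)) {0..2*pi}"
    by (rule has_integral_divide)
  moreover have "1 / (1 - c * cis t) / (cis t - cnj c) * \<i> * cis t / \<i>
      = of_real (1 / (norm (1 - c * cis t))\<^sup>2)" for t
  proof -
    have *: "cis t - cnj c = cis t * cnj (1 - c * cis t)"
      by (simp add: algebra_simps cis_mult cis_cnj)
    have "of_real ((norm (1 - c * cis t))\<^sup>2) = (1 - c * cis t) * cnj (1 - c * cis t)"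
      by (rule complex_norm_square)
    then have "complex_of_real (1 / (norm (1 - c * cis t))\<^sup>2) = 1 / ((1 - c * cis t) * cnj (1 - c * cis t))"
      by (metis of_real_1 of_real_divide)
    moreover have "cis t \<noteq> 0" by simp
    ultimately show ?thesis
      unfolding * by (simp only: times_divide_eq_left times_divide_eq_right divide_divide_eq_left) simp
  qed
  moreover have "2 * of_real pi * \<i> * (1 / (1 - c * cnj c)) / \<i> = of_real (2 * pi / (1 - (norm c)\<^sup>2))"
    by (simp add: complex_norm_square[symmetric] del: divide_i)
  ultimately have "((\<lambda>t. complex_of_real (1 / (norm (1 - c * cis t))\<^sup>2)) has_integral
      of_real (2 * pi / (1 - (norm c)\<^sup>2))) {0..2*pi}" by simp
  from has_integral_Re[OF this]
  have "((\<lambda>t. 1 / (norm (1 - c * cis t))\<^sup>2) has_integral (2 * pi / (1 - (norm c)\<^sup>2))) {0..2*pi}"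
    by simp
  then have "(\<integral>\<^sup>+\<psi>. ennreal (indicator {0..2*pi} \<psi> * (1 / (norm (1 - c * cis \<psi>))\<^sup>2)) \<partial>lborel)
      = ennreal (2 * pi / (1 - (norm c)\<^sup>2))"
    by (intro nn_integral_has_integral_lebesgue) auto
  also have "(\<lambda>\<psi>. ennreal (indicator {0..2*pi} \<psi> * (1 / (norm (1 - c * cis \<psi>))\<^sup>2)))
      = (\<lambda>\<psi>. ennreal (1 / (norm (1 - c * cis \<psi>))\<^sup>2) * indicator {0..2*pi} \<psi>)"
    by (auto simp: indicator_def)
  finally show ?thesis .
qed

text \<open>Half of the decay, \<open>exp (- b * s / 2)\<close>, beats each linear factor. In the
  radial integral these factors are what lower bounds such as \<open>s / (1 + s)\<close> for
  \<open>1 - exp (- s)\<close> cost.\<close>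

lemma exp_times_quadratic_bounded:
  fixes b k l :: real
  assumes "0 < b" "0 \<le> k" "0 \<le> l"
  obtains M where "0 < M" "\<And>s. 0 \<le> s \<Longrightarrow> exp (- b * s) * ((1 + k * s) * (1 + l * s)) \<le> M"
proof -
  define K where "K = max k l + b"
  have K: "0 < K" "k \<le> K" "l \<le> K" using assms by (auto simp: K_def)
  define M where "M = (1 + 2 * K / b)\<^sup>2"
  have "exp (- b * s) * ((1 + k * s) * (1 + l * s)) \<le> M" if s: "0 \<le> s" for s
  proof -
    have e: "1 + b * s / 2 \<le> exp (b * s / 2)" by (rule exp_ge_add_one_self)
    have "1 + K * s \<le> (1 + 2 * K / b) * (1 + b * s / 2)"
      using assms K s by (simp add: field_simps)
    also have "\<dots> \<le> (1 + 2 * K / b) * exp (b * s / 2)"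
      using e K assms by (intro mult_left_mono) auto
    finally have a: "1 + K * s \<le> (1 + 2 * K / b) * exp (b * s / 2)" .
    have "(1 + k * s) * (1 + l * s) \<le> (1 + K * s) * (1 + K * s)"
      using K s assms by (intro mult_mono add_left_mono mult_right_mono) auto
    also have "\<dots> \<le> ((1 + 2 * K / b) * exp (b * s / 2)) * ((1 + 2 * K / b) * exp (b * s / 2))"
      using a K s assms by (intro mult_mono) auto
    also have "\<dots> = M * exp (b * s)"
      by (simp add: M_def power2_eq_square algebra_simps flip: exp_add)
    finally show ?thesis by (simp add: exp_minus field_simps)
  qed
  moreover have "0 < M" unfolding M_def using K assms by (intro zero_less_power add_pos_pos) auto
  ultimately show ?thesis using that by blast
qed

lemma one_minus_exp_neg_ge:
  fixes s :: real
  assumes "0 \<le> s"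
  shows "s / (1 + s) \<le> 1 - exp (- s)"
proof -
  have "1 + s \<le> exp s" by (rule exp_ge_add_one_self)
  then have "exp (- s) \<le> 1 / (1 + s)"
    using assms by (simp add: exp_minus field_simps)
  then show ?thesis using assms by (simp add: field_simps)
qed

text \<open>With s = -t and \<delta> = 1 - r, the denominator is at least \<delta> and at least
  \<open>\<tau> * s / (1 + \<tau> * s)\<close>. The first bound is used for s \<le> \<delta>, the
  second beyond. What remains are integrals of \<open>s powr (- \<sigma>)\<close> over [0, \<delta>]
  and of \<open>s powr (- \<sigma> - 1)\<close> over [\<delta>, \<infinity>), finite because
  \<sigma> < 1 and \<sigma> > 0 respectively, and both multiples of
  \<open>\<delta> powr (- \<sigma>)\<close>.\<close>

lemma radial_integral_bound:
  fixes \<beta> \<sigma> \<tau> :: real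
  assumes \<beta>: "0 < \<beta>" and \<sigma>: "0 < \<sigma>" "\<sigma> < 1" and \<tau>: "0 < \<tau>"
  obtains C :: real where "0 < C" "\<And>r. 0 \<le> r \<Longrightarrow> r < 1 \<Longrightarrow>
    (\<integral>\<^sup>+t. ennreal (exp (\<beta> * t) * (1 - exp t) powr (- \<sigma>) / (1 - (r * exp (\<tau> * t))\<^sup>2))
        * indicator {..<0} t \<partial>lborel) \<le> ennreal (C * (1 - r) powr (- \<sigma>))"
proof -
  obtain M where M: "0 < M"
    "\<And>s. 0 \<le> s \<Longrightarrow> exp (- \<beta> * s) * ((1 + 1 * s) * (1 + \<tau> * s)) \<le> M"
    using exp_times_quadratic_bounded[of \<beta> 1 \<tau>] \<beta> \<tau> by auto
  define C where "C = M / (1 - \<sigma>) + M / (\<tau> * \<sigma>)"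
  have "0 < C" using M \<sigma> \<tau> by (simp add: C_def add_pos_pos)
  moreover have "(\<integral>\<^sup>+t. ennreal (exp (\<beta> * t) * (1 - exp t) powr (- \<sigma>) / (1 - (r * exp (\<tau> * t))\<^sup>2))
        * indicator {..<0} t \<partial>lborel) \<le> ennreal (C * (1 - r) powr (- \<sigma>))"
    (is "?lhs \<le> _") if r: "0 \<le> r" "r < 1" for r
  proof -
    define \<delta> where "\<delta> = 1 - r"
    have \<delta>: "0 < \<delta>" "\<delta> \<le> 1" using r by (auto simp: \<delta>_def)
    have "?lhs = (\<integral>\<^sup>+s. ennreal (exp (- \<beta> * s) * (1 - exp (- s)) powr (- \<sigma>) / (1 - (r * exp (- \<tau> * s))\<^sup>2))
        * indicator {..<0} (- s) \<partial>lborel)"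
      by (subst nn_integral_real_affine[where c = "-1" and t = 0]) auto
    also have "\<dots> \<le> (\<integral>\<^sup>+s. ennreal (M / \<delta>) * ennreal (indicator {0..\<delta>} s * s powr (- \<sigma>))
        + ennreal (M / \<tau>) * ennreal (indicator {\<delta>..} s * s powr (- \<sigma> - 1)) \<partial>lborel)"
    proof (rule nn_integral_mono)
      fix s :: real
      show "ennreal (exp (- \<beta> * s) * (1 - exp (- s)) powr (- \<sigma>) / (1 - (r * exp (- \<tau> * s))\<^sup>2))
        * indicator {..<0} (- s) \<le> ennreal (M / \<delta>) * ennreal (indicator {0..\<delta>} s * s powr (- \<sigma>))
        + ennreal (M / \<tau>) * ennreal (indicator {\<delta>..} s * s powr (- \<sigma> - 1))"
      proof (cases "s > 0")
        case s: True
        define E where "E = exp (- \<beta> * s) * ((1 + s) * (1 + \<tau> * s))"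
        have E: "0 \<le> E" "E \<le> M" using M(2)[of s] s \<tau> by (auto simp: E_def)
        define D where "D = 1 - (r * exp (- \<tau> * s))\<^sup>2"
        have ex: "exp (- \<tau> * s) < 1" using \<tau> s by simp
        have re: "0 \<le> r * exp (- \<tau> * s)" "r * exp (- \<tau> * s) \<le> r" "r * exp (- \<tau> * s) \<le> exp (- \<tau> * s)"
          using r ex by (auto simp: mult_left_le mult_left_le_one_le)
        \<comment> \<open>A number in [0, 1] dominates its square, so \<open>D\<close> is at least
          \<open>1 - r * exp (- \<tau> * s)\<close>, which exceeds both required lower
          bounds.\<close>
        have "(r * exp (- \<tau> * s))\<^sup>2 \<le> r * exp (- \<tau> * s)"
          unfolding power2_eq_square using re r by (intro mult_left_le) auto
        then have D1: "\<delta> \<le> D" and D2: "1 - exp (- \<tau> * s) \<le> D"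
          using re by (simp_all only: D_def \<delta>_def)
        have D3: "\<tau> * s / (1 + \<tau> * s) \<le> D"
          using one_minus_exp_neg_ge[of "\<tau> * s"] D2 \<tau> s by simp
        have "(1 - exp (- s)) powr (- \<sigma>) \<le> (s / (1 + s)) powr (- \<sigma>)"
          using one_minus_exp_neg_ge[of s] s \<sigma> by (intro powr_mono2') auto
        also have "\<dots> = s powr (- \<sigma>) * (1 + s) powr \<sigma>"
          using s by (simp add: powr_divide powr_minus field_simps)
        also have "\<dots> \<le> s powr (- \<sigma>) * (1 + s) powr 1"
          using s \<sigma> by (intro mult_left_mono powr_mono) auto
        finally have q: "(1 - exp (- s)) powr (- \<sigma>) \<le> s powr (- \<sigma>) * (1 + s)"
          using s by simp
        have num: "exp (- \<beta> * s) * (1 - exp (- s)) powr (- \<sigma>) \<le> exp (- \<beta> * s) * (1 + s) * s powr (- \<sigma>)"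
          using mult_left_mono[OF q, of "exp (- \<beta> * s)"] by (simp add: mult_ac)
        show ?thesis
        proof (cases "s \<le> \<delta>")
          case True
          have "exp (- \<beta> * s) * (1 + s) \<le> E"
            using s \<tau> by (simp add: E_def mult_le_cancel_left1)
          then have n: "exp (- \<beta> * s) * (1 - exp (- s)) powr (- \<sigma>) \<le> M * s powr (- \<sigma>)"
            by (intro order_trans[OF num] mult_right_mono) (use E in auto)
          have "exp (- \<beta> * s) * (1 - exp (- s)) powr (- \<sigma>) / D \<le> M * s powr (- \<sigma>) / \<delta>"
            by (rule frac_le) (use n D1 \<delta> M in auto)
          then have "ennreal (exp (- \<beta> * s) * (1 - exp (- s)) powr (- \<sigma>) / D)
             \<le> ennreal (M / \<delta>) * ennreal (indicator {0..\<delta>} s * s powr (- \<sigma>))"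
            using True s M \<delta> by (simp flip: ennreal_mult')
          then show ?thesis using s by (auto simp: D_def intro: add_increasing2)
        next
          case False
          have pos: "0 < \<tau> * s / (1 + \<tau> * s)" using s \<tau> by (simp add: add_pos_pos)
          have "exp (- \<beta> * s) * (1 - exp (- s)) powr (- \<sigma>) / D
              \<le> exp (- \<beta> * s) * (1 + s) * s powr (- \<sigma>) / (\<tau> * s / (1 + \<tau> * s))"
            by (rule frac_le) (use num D3 pos s in auto)
          also have "\<dots> = E / \<tau> * s powr (- \<sigma> - 1)"
            using s \<tau> by (simp add: E_def powr_diff field_simps)
          also have "\<dots> \<le> M / \<tau> * s powr (- \<sigma> - 1)"
            using E \<tau> by (intro mult_right_mono divide_right_mono) auto
          finally have "ennreal (exp (- \<beta> * s) * (1 - exp (- s)) powr (- \<sigma>) / D)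
             \<le> ennreal (M / \<tau>) * ennreal (indicator {\<delta>..} s * s powr (- \<sigma> - 1))"
            using False s M \<tau> by (simp flip: ennreal_mult')
          then show ?thesis using s by (auto simp: D_def intro: add_increasing)
        qed
      qed simp
    qed
    also have "\<dots> = ennreal (M / \<delta>) * (\<integral>\<^sup>+s. ennreal (indicator {0..\<delta>} s * s powr (- \<sigma>)) \<partial>lborel)
        + ennreal (M / \<tau>) * (\<integral>\<^sup>+s. ennreal (indicator {\<delta>..} s * s powr (- \<sigma> - 1)) \<partial>lborel)"
      by (subst nn_integral_add) (simp_all add: nn_integral_cmult)
    also have "(\<integral>\<^sup>+s. ennreal (indicator {0..\<delta>} s * s powr (- \<sigma>)) \<partial>lborel)
        = ennreal (\<delta> powr (- \<sigma> + 1) / (- \<sigma> + 1))"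
      by (rule nn_integral_has_integral_lebesgue)
        (use \<sigma> \<delta> has_integral_powr_from_0[of "- \<sigma>" \<delta>] in auto)
    also have "(\<integral>\<^sup>+s. ennreal (indicator {\<delta>..} s * s powr (- \<sigma> - 1)) \<partial>lborel)
        = ennreal (- (\<delta> powr (- \<sigma> - 1 + 1)) / (- \<sigma> - 1 + 1))"
      by (rule nn_integral_has_integral_lebesgue)
        (use \<sigma> \<delta> has_integral_powr_to_inf[of "- \<sigma> - 1" \<delta>] in auto)
    also have "ennreal (M / \<delta>) * ennreal (\<delta> powr (- \<sigma> + 1) / (- \<sigma> + 1))
        = ennreal (M / (1 - \<sigma>) * \<delta> powr (- \<sigma>))"
    proof -
      have "\<delta> powr (- \<sigma> + 1) = \<delta> powr (- \<sigma>) * \<delta>" using \<delta> by (simp only: powr_add) simp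
      then have "M / \<delta> * (\<delta> powr (- \<sigma> + 1) / (- \<sigma> + 1)) = M / (1 - \<sigma>) * \<delta> powr (- \<sigma>)"
        using \<delta> by simp
      moreover have "0 \<le> M / \<delta>" using M \<delta> by simp
      ultimately show ?thesis by (metis ennreal_mult')
    qed
    also have "ennreal (M / \<tau>) * ennreal (- (\<delta> powr (- \<sigma> - 1 + 1)) / (- \<sigma> - 1 + 1))
        = ennreal (M / (\<tau> * \<sigma>) * \<delta> powr (- \<sigma>))"
    proof -
      have "M / \<tau> * (- (\<delta> powr (- \<sigma> - 1 + 1)) / (- \<sigma> - 1 + 1)) = M / (\<tau> * \<sigma>) * \<delta> powr (- \<sigma>)"
        by simp
      moreover have "0 \<le> M / \<tau>" using M \<tau> by simp
      ultimately show ?thesis by (metis ennreal_mult')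
    qed
    also have "ennreal (M / (1 - \<sigma>) * \<delta> powr (- \<sigma>)) + ennreal (M / (\<tau> * \<sigma>) * \<delta> powr (- \<sigma>))
        = ennreal (C * \<delta> powr (- \<sigma>))"
      using M \<sigma> \<tau> by (subst ennreal_plus[symmetric]) (auto simp: C_def algebra_simps)
    finally show ?thesis by (simp add: \<delta>_def)
  qed
  ultimately show ?thesis by (rule that)
qed

subsection \<open>Schur's test and a power series\<close>

text \<open>Pointwise Young's inequality and the row bound give the Hoelder estimate
  \<open>I z \<le> J z powr (1 / p) * (C * u z) powr (1 / q)\<close>; Fubini and the column bound
  control the integral of \<open>u powr (p - 1) * J\<close>. As \<open>enn2real\<close> sends
  \<infinity> to 0, the norm bound is meaningful only together with finiteness almost everywhere,
  which is therefore a separate conclusion.\<close>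

lemma schur_test:
  fixes k :: "'a \<Rightarrow> 'a \<Rightarrow> real" and u f :: "'a \<Rightarrow> real" and p C :: real
  assumes sf: "sigma_finite_measure M" and p: "1 < p" and C: "0 < C"
    and k[measurable]: "(\<lambda>(z, w). k z w) \<in> borel_measurable (M \<Otimes>\<^sub>M M)"
    and k0: "\<And>z w. 0 \<le> k z w"
    and u[measurable]: "u \<in> borel_measurable M" and upos: "AE z in M. 0 < u z"
    and row: "AE z in M. (\<integral>\<^sup>+w. ennreal (k z w * u w) \<partial>M) \<le> ennreal (C * u z)"
    and col: "AE w in M. (\<integral>\<^sup>+z. ennreal (k z w * u z powr (p - 1)) \<partial>M) \<le> ennreal (C * u w powr (p - 1))"
    and f[measurable]: "f \<in> borel_measurable M" and f0: "\<And>w. 0 \<le> f w"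
    and fin: "(\<integral>\<^sup>+w. ennreal (f w powr p) \<partial>M) < \<infinity>"
  shows "AE z in M. (\<integral>\<^sup>+w. ennreal (k z w * f w) \<partial>M) < \<infinity>"
    and "(\<integral>\<^sup>+z. ennreal (enn2real (\<integral>\<^sup>+w. ennreal (k z w * f w) \<partial>M) powr p) \<partial>M)
       \<le> ennreal (C powr p) * (\<integral>\<^sup>+w. ennreal (f w powr p) \<partial>M)"
proof -
  interpret sigma_finite_measure M by fact
  interpret P: pair_sigma_finite M M ..
  define q where "q = p / (p - 1)"
  have q: "1 < q" "1 / p + 1 / q = 1" "p / q = p - 1" "0 < p" "0 < q"
    using p by (auto simp: q_def field_simps)
  define I where "I z = (\<integral>\<^sup>+w. ennreal (k z w * f w) \<partial>M)" for z
  define J where "J z = (\<integral>\<^sup>+w. ennreal (k z w * (f w powr p * u w powr (- (p - 1)))) \<partial>M)" for z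
  have [measurable]: "I \<in> borel_measurable M" "J \<in> borel_measurable M"
    unfolding I_def J_def by measurable
  have "(\<integral>\<^sup>+z. ennreal (u z powr (p - 1)) * J z \<partial>M)
      = (\<integral>\<^sup>+z. (\<integral>\<^sup>+w. ennreal (u z powr (p - 1)) * ennreal (k z w * (f w powr p * u w powr (- (p - 1)))) \<partial>M) \<partial>M)"
    unfolding J_def by (intro nn_integral_cong nn_integral_cmult[symmetric]) measurable
  also have "\<dots> = (\<integral>\<^sup>+w. (\<integral>\<^sup>+z. ennreal (u z powr (p - 1)) * ennreal (k z w * (f w powr p * u w powr (- (p - 1)))) \<partial>M) \<partial>M)"
    by (rule P.Fubini'[symmetric]) measurable
  also have "\<dots> = (\<integral>\<^sup>+w. ennreal (f w powr p * u w powr (- (p - 1))) * (\<integral>\<^sup>+z. ennreal (k z w * u z powr (p - 1)) \<partial>M) \<partial>M)"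
  proof (rule nn_integral_cong)
    fix w assume [measurable]: "w \<in> space M"
    have "(\<integral>\<^sup>+z. ennreal (u z powr (p - 1)) * ennreal (k z w * (f w powr p * u w powr (- (p - 1)))) \<partial>M)
        = (\<integral>\<^sup>+z. ennreal (f w powr p * u w powr (- (p - 1))) * ennreal (k z w * u z powr (p - 1)) \<partial>M)"
      by (intro nn_integral_cong) (simp add: k0 mult_ac flip: ennreal_mult)
    also have "\<dots> = ennreal (f w powr p * u w powr (- (p - 1))) * (\<integral>\<^sup>+z. ennreal (k z w * u z powr (p - 1)) \<partial>M)"
      by (rule nn_integral_cmult) measurable
    finally show "(\<integral>\<^sup>+z. ennreal (u z powr (p - 1)) * ennreal (k z w * (f w powr p * u w powr (- (p - 1)))) \<partial>M)
        = ennreal (f w powr p * u w powr (- (p - 1))) * (\<integral>\<^sup>+z. ennreal (k z w * u z powr (p - 1)) \<partial>M)" .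
  qed
  also have "\<dots> \<le> (\<integral>\<^sup>+w. ennreal C * ennreal (f w powr p) \<partial>M)"
  proof (rule nn_integral_mono_AE, use col upos in eventually_elim)
    fix w assume c: "(\<integral>\<^sup>+z. ennreal (k z w * u z powr (p - 1)) \<partial>M) \<le> ennreal (C * u w powr (p - 1))"
      and w: "0 < u w"
    have "ennreal (f w powr p * u w powr (- (p - 1))) * (\<integral>\<^sup>+z. ennreal (k z w * u z powr (p - 1)) \<partial>M)
        \<le> ennreal (f w powr p * u w powr (- (p - 1))) * ennreal (C * u w powr (p - 1))"
      by (rule mult_left_mono[OF c]) simp
    also have "\<dots> = ennreal (f w powr p * u w powr (- (p - 1)) * (C * u w powr (p - 1)))"
      by (simp add: ennreal_mult')
    also have "f w powr p * u w powr (- (p - 1)) * (C * u w powr (p - 1)) = C * f w powr p"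
      using w by (simp add: mult_ac flip: powr_add)
    finally show "ennreal (f w powr p * u w powr (- (p - 1))) * (\<integral>\<^sup>+z. ennreal (k z w * u z powr (p - 1)) \<partial>M)
        \<le> ennreal C * ennreal (f w powr p)" using C by (simp add: ennreal_mult')
  qed
  also have "\<dots> = ennreal C * (\<integral>\<^sup>+w. ennreal (f w powr p) \<partial>M)"
    by (simp add: nn_integral_cmult)
  finally have Jint: "(\<integral>\<^sup>+z. ennreal (u z powr (p - 1)) * J z \<partial>M) \<le> ennreal C * (\<integral>\<^sup>+w. ennreal (f w powr p) \<partial>M)" .
  also have "\<dots> < \<infinity>" using fin by (simp add: ennreal_mult_less_top)
  finally have "AE z in M. ennreal (u z powr (p - 1)) * J z \<noteq> \<infinity>"
    by (intro nn_integral_PInf_AE) auto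
  then have Jfin: "AE z in M. J z < \<infinity>"
    using upos by eventually_elim (auto simp: ennreal_mult_eq_top_iff less_top)
  have bound: "AE z in M. I z < \<infinity> \<and> ennreal (enn2real (I z) powr p)
      \<le> ennreal (C powr (p - 1)) * (ennreal (u z powr (p - 1)) * J z)"
    using Jfin row upos AE_space
  proof (eventually_elim, goal_cases)
    case (1 z)
    define X where "X = C * u z"
    have X: "0 < X" using 1 C by (simp add: X_def)
    have row: "(\<integral>\<^sup>+w. ennreal (k z w * u w) \<partial>M) \<le> ennreal X" using 1 by (simp add: X_def)
    obtain j where j: "J z = ennreal j" "0 \<le> j" using 1 by (cases "J z") auto
    have [measurable]: "z \<in> space M" using 1 by simp
    \<comment> \<open>The scale \<open>s\<close> below requires j > 0. If j = 0, the integrand of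
      \<open>J z\<close> vanishes almost everywhere, and with it \<open>k z w * f w\<close>, because
      \<open>u\<close> is positive.\<close>
    show ?case
    proof (cases "j = 0")
      case True
      have "(\<lambda>w. ennreal (k z w * (f w powr p * u w powr (- (p - 1))))) \<in> borel_measurable M"
        by measurable
      then have "AE w in M. ennreal (k z w * (f w powr p * u w powr (- (p - 1)))) = 0"
        using True j unfolding J_def by (simp add: nn_integral_0_iff_AE)
      with upos have "AE w in M. ennreal (k z w * f w) = 0"
      proof eventually_elim
        fix w assume w: "0 < u w" "ennreal (k z w * (f w powr p * u w powr (- (p - 1)))) = 0"
        have "0 \<le> k z w * (f w powr p * u w powr (- (p - 1)))" by (simp add: k0)
        with w have "k z w * (f w powr p * u w powr (- (p - 1))) = 0"
          by (simp only: ennreal_eq_zero_iff)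
        then have "k z w = 0 \<or> f w = 0" using w by simp
        then show "ennreal (k z w * f w) = 0" by auto
      qed
      then have "I z = 0" unfolding I_def by (simp add: nn_integral_0_iff_AE cong: nn_integral_cong_AE)
      then show ?thesis by simp
    next
      case False
      with j have j0: "0 < j" by simp
      \<comment> \<open>This scale balances the two terms of Young's inequality: p q = p + q gives
        \<open>s powr (p + q) = j / X\<close>, hence
        \<open>s powr (- p) * j = s powr q * X\<close>.\<close>
      define s where "s = (j / X) powr (1 / (p * q))"
      have s: "0 < s" using j0 X by (simp add: s_def)
      have sp: "s powr (- p) * j = j powr (1 / p) * X powr (1 / q)"
      proof -
        have "s powr (- p) * j = (j / X) powr (- (1 / q)) * j powr (1 / p + 1 / q)"
          using j0 q by (simp add: s_def powr_powr)
        also have "\<dots> = j powr (1 / p) * X powr (1 / q)"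
          using j0 X by (simp add: powr_divide powr_add powr_minus field_simps)
        finally show ?thesis .
      qed
      have sq: "s powr q * X = j powr (1 / p) * X powr (1 / q)"
      proof -
        have "s powr q * X = (j / X) powr (1 / p) * X powr (1 / p + 1 / q)"
          using X q by (simp add: s_def powr_powr)
        also have "\<dots> = j powr (1 / p) * X powr (1 / q)"
          using j0 X by (simp add: powr_divide powr_add field_simps)
        finally show ?thesis .
      qed
      have young: "f w \<le> s powr (- p) / p * (f w powr p * u w powr (- (p - 1))) + s powr q / q * u w"
        if w: "0 < u w" for w
      proof -
        \<comment> \<open>The inserted power \<open>u powr (1 / q)\<close> is chosen to produce the
          two weights at hand: \<open>u powr (- (p - 1))\<close> after the p-th power, since p / q =
          p - 1, and \<open>u\<close> after the q-th.\<close>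
        have "f w = (f w * u w powr (- (1 / q)) / s) * (s * u w powr (1 / q))"
          using w s by (simp add: mult_ac flip: powr_add)
        also have "\<dots> \<le> (f w * u w powr (- (1 / q)) / s) powr p / p + (s * u w powr (1 / q)) powr q / q"
          by (rule Youngs_inequality) (use p q f0 s in auto)
        also have "(f w * u w powr (- (1 / q)) / s) powr p = s powr (- p) * (f w powr p * u w powr (- (p - 1)))"
        proof -
          have e: "- (1 / q) * p = - (p - 1)" using q(3) by simp
          have "(f w * u w powr (- (1 / q)) / s) powr p = f w powr p * (u w powr (- (1 / q))) powr p / s powr p"
            using f0 s by (simp add: powr_mult powr_divide)
          then show ?thesis unfolding powr_powr e by (simp add: powr_minus divide_inverse mult_ac)
        qed
        also have "(s * u w powr (1 / q)) powr q = s powr q * u w"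
          using s w q by (simp add: powr_mult powr_powr)
        finally show ?thesis by simp
      qed
      have "I z \<le> (\<integral>\<^sup>+w. ennreal (s powr (- p) / p) * ennreal (k z w * (f w powr p * u w powr (- (p - 1))))
           + ennreal (s powr q / q) * ennreal (k z w * u w) \<partial>M)"
        unfolding I_def
      proof (rule nn_integral_mono_AE, use upos in eventually_elim)
        fix w assume w: "0 < u w"
        have "k z w * f w \<le> k z w * (s powr (- p) / p * (f w powr p * u w powr (- (p - 1))) + s powr q / q * u w)"
          by (rule mult_left_mono[OF young[OF w] k0])
        also have "\<dots> = s powr (- p) / p * (k z w * (f w powr p * u w powr (- (p - 1)))) + s powr q / q * (k z w * u w)"
          by (simp add: algebra_simps)
        finally show "ennreal (k z w * f w) \<le> ennreal (s powr (- p) / p) * ennreal (k z w * (f w powr p * u w powr (- (p - 1))))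
           + ennreal (s powr q / q) * ennreal (k z w * u w)"
          using q w k0[of z w] by (simp add: ennreal_leI flip: ennreal_mult' ennreal_plus)
      qed
      also have "\<dots> = ennreal (s powr (- p) / p) * J z + ennreal (s powr q / q) * (\<integral>\<^sup>+w. ennreal (k z w * u w) \<partial>M)"
        unfolding J_def by (subst nn_integral_add) (simp_all add: nn_integral_cmult)
      also have "\<dots> \<le> ennreal (s powr (- p) / p) * ennreal j + ennreal (s powr q / q) * ennreal X"
        unfolding j(1) by (intro add_left_mono mult_left_mono row) simp
      also have "\<dots> = ennreal (s powr (- p) * j / p + s powr q * X / q)"
        using X j0 q by (simp flip: ennreal_mult' ennreal_plus)
      also have "s powr (- p) * j / p + s powr q * X / q = j powr (1 / p) * X powr (1 / q) * (1 / p + 1 / q)"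
        unfolding sp sq by (simp add: algebra_simps)
      finally have I: "I z \<le> ennreal (j powr (1 / p) * X powr (1 / q))" using q by simp
      then have "enn2real (I z) \<le> j powr (1 / p) * X powr (1 / q)"
        by (rule enn2real_leI[rotated]) simp
      then have "enn2real (I z) powr p \<le> (j powr (1 / p) * X powr (1 / q)) powr p"
        using q by (intro powr_mono2) auto
      also have "\<dots> = C powr (p - 1) * (u z powr (p - 1) * j)"
        using j0 X C 1 q by (simp add: powr_mult powr_powr X_def)
      finally have "ennreal (enn2real (I z) powr p) \<le> ennreal (C powr (p - 1) * (u z powr (p - 1) * j))"
        by (rule ennreal_leI)
      also have "\<dots> = ennreal (C powr (p - 1)) * (ennreal (u z powr (p - 1)) * J z)"
        by (simp add: ennreal_mult' j)
      finally show ?thesis using le_less_trans[OF I] by simp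
    qed
  qed
  then show "AE z in M. (\<integral>\<^sup>+w. ennreal (k z w * f w) \<partial>M) < \<infinity>"
    unfolding I_def by eventually_elim simp
  have "(\<integral>\<^sup>+z. ennreal (enn2real (I z) powr p) \<partial>M)
      \<le> (\<integral>\<^sup>+z. ennreal (C powr (p - 1)) * (ennreal (u z powr (p - 1)) * J z) \<partial>M)"
    by (rule nn_integral_mono_AE) (use bound in \<open>eventually_elim, simp\<close>)
  also have "\<dots> = ennreal (C powr (p - 1)) * (\<integral>\<^sup>+z. ennreal (u z powr (p - 1)) * J z \<partial>M)"
    by (rule nn_integral_cmult) measurable
  also have "\<dots> \<le> ennreal (C powr (p - 1)) * (ennreal C * (\<integral>\<^sup>+w. ennreal (f w powr p) \<partial>M))"
    by (rule mult_left_mono[OF Jint]) simp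
  also have "\<dots> = ennreal (C powr (p - 1) * C powr 1) * (\<integral>\<^sup>+w. ennreal (f w powr p) \<partial>M)"
    using C by (simp add: ennreal_mult' mult.assoc)
  also have "C powr (p - 1) * C powr 1 = C powr p" unfolding powr_add[symmetric] by simp
  finally show "(\<integral>\<^sup>+z. ennreal (enn2real (\<integral>\<^sup>+w. ennreal (k z w * f w) \<partial>M) powr p) \<partial>M)
       \<le> ennreal (C powr p) * (\<integral>\<^sup>+w. ennreal (f w powr p) \<partial>M)"
    unfolding I_def .
qed

text \<open>The weights \<open>\<beta> + p * m\<close> will come from the reciprocal norms of the
  monomials along one row direction. Writing them as \<open>p * (m + 1) + (\<beta> - p)\<close>
  reduces the sum to the geometric series and its derivative.\<close>

lemma affine_geometric_series:
  fixes x :: complex and \<beta> p :: real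
  assumes "norm x < 1"
  shows "(\<lambda>m. norm (of_real (\<beta> + p * real m) * x ^ m)) summable_on UNIV"
    and "(\<Sum>\<^sub>\<infinity>m. of_real (\<beta> + p * real m) * x ^ m) = (of_real \<beta> + of_real (p - \<beta>) * x) / (1 - x)\<^sup>2"
proof -
  have s1: "summable (\<lambda>m. norm x ^ m)" using assms by (simp add: summable_geometric)
  have s2: "summable (\<lambda>m. real (Suc m) * norm x ^ m)"
    using geometric_deriv_sums[of "norm x"] assms by (simp add: sums_iff)
  have "summable (\<lambda>m. \<bar>p\<bar> * (real (Suc m) * norm x ^ m) + (\<bar>p\<bar> + \<bar>\<beta>\<bar>) * norm x ^ m)"
    by (intro summable_add summable_mult s1 s2)
  then have n: "summable (\<lambda>m. norm (of_real (\<beta> + p * real m) * x ^ m))"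
  proof (rule summable_comparison_test')
    fix m :: nat
    have "\<bar>\<beta> + p * real m\<bar> \<le> \<bar>\<beta>\<bar> + \<bar>p\<bar> * real m" by (simp add: abs_triangle_ineq[THEN order_trans] abs_mult)
    also have "\<dots> \<le> \<bar>p\<bar> * real (Suc m) + (\<bar>p\<bar> + \<bar>\<beta>\<bar>)" by (simp add: algebra_simps)
    finally have "\<bar>\<beta> + p * real m\<bar> * norm x ^ m \<le> (\<bar>p\<bar> * real (Suc m) + (\<bar>p\<bar> + \<bar>\<beta>\<bar>)) * norm x ^ m"
      by (rule mult_right_mono) simp
    then show "norm (norm (of_real (\<beta> + p * real m) * x ^ m)) \<le> \<bar>p\<bar> * (real (Suc m) * norm x ^ m) + (\<bar>p\<bar> + \<bar>\<beta>\<bar>) * norm x ^ m"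
      by (simp add: norm_mult norm_power algebra_simps del: of_real_add)
  qed
  then show "(\<lambda>m. norm (of_real (\<beta> + p * real m) * x ^ m)) summable_on UNIV"
    by (simp add: norm_summable_imp_summable_on)
  have "(\<lambda>m. of_real p * (of_nat (Suc m) * x ^ m) + of_real (\<beta> - p) * x ^ m) sums
      (of_real p * (1 / (1 - x)\<^sup>2) + of_real (\<beta> - p) * (1 / (1 - x)))"
    by (intro sums_add sums_mult geometric_deriv_sums geometric_sums assms)
  moreover have "of_real p * (of_nat (Suc m) * x ^ m) + of_real (\<beta> - p) * x ^ m = of_real (\<beta> + p * real m) * x ^ m" for m
    by (simp add: algebra_simps)
  moreover have "of_real p * (1 / (1 - x)\<^sup>2) + of_real (\<beta> - p) * (1 / (1 - x)) = (of_real \<beta> + of_real (p - \<beta>) * x) / (1 - x)\<^sup>2"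
  proof -
    have "1 - x \<noteq> 0" using assms by auto
    then have "of_real p * (1 / (1 - x)\<^sup>2) + of_real (\<beta> - p) * (1 / (1 - x))
        = (of_real p + of_real (\<beta> - p) * (1 - x)) / (1 - x)\<^sup>2"
      by (simp add: add_divide_distrib power2_eq_square)
    also have "of_real p + of_real (\<beta> - p) * (1 - x) = of_real \<beta> + of_real (p - \<beta>) * x"
      by (simp add: algebra_simps)
    finally show ?thesis .
  qed
  ultimately have "(\<lambda>m. of_real (\<beta> + p * real m) * x ^ m) sums ((of_real \<beta> + of_real (p - \<beta>) * x) / (1 - x)\<^sup>2)"
    by simp
  with n have "((\<lambda>m. of_real (\<beta> + p * real m) * x ^ m) has_sum ((of_real \<beta> + of_real (p - \<beta>) * x) / (1 - x)\<^sup>2)) UNIV"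
    by (rule norm_summable_imp_has_sum)
  then show "(\<Sum>\<^sub>\<infinity>m. of_real (\<beta> + p * real m) * x ^ m) = (of_real \<beta> + of_real (p - \<beta>) * x) / (1 - x)\<^sup>2"
    by (rule infsumI)
qed

subsection \<open>Lebesgue measure on \<open>\<complex>\<^sup>n\<close>\<close>

lemma borel_measurable_cart_nth [measurable (raw)]:
  fixes f :: "'a \<Rightarrow> 'b::euclidean_space ^ 'n"
  assumes "f \<in> borel_measurable M"
  shows "(\<lambda>x. f x $ i) \<in> borel_measurable M"
  by (rule measurable_compose[OF assms])
    (intro borel_measurable_continuous_onI continuous_intros)

lemma borel_measurable_cart_lambda [measurable (raw)]:
  fixes f :: "'n::finite \<Rightarrow> 'a \<Rightarrow> 'b::euclidean_space"
  assumes "\<And>i. f i \<in> borel_measurable M"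
  shows "(\<lambda>x. \<chi> i. f i x) \<in> borel_measurable M"
proof (rule borel_measurable_euclidean_space[THEN iffD2], rule)
  fix b :: "'b ^ 'n" assume "b \<in> Basis"
  then obtain i e where b: "b = axis i e" by (auto simp: Basis_vec_def)
  show "(\<lambda>x. (\<chi> i. f i x) \<bullet> b) \<in> borel_measurable M"
    unfolding b inner_axis using assms by simp
qed

lemma borel_measurable_power_int [measurable (raw)]:
  fixes f :: "'a \<Rightarrow> complex"
  assumes [measurable]: "f \<in> borel_measurable M"
  shows "(\<lambda>x. f x powi m) \<in> borel_measurable M"
  unfolding power_int_def by (cases "m \<ge> 0") simp_all

lemma borel_measurable_mono [measurable (raw)]:
  assumes [measurable]: "f \<in> borel_measurable M"
  shows "(\<lambda>x. mono \<alpha> (f x)) \<in> borel_measurable M"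
  unfolding Defs.mono_def by measurable

lemma Basis_cart_complex:
  "(Basis :: (complex ^ 'n) set) = (\<lambda>(k, b). axis k b) ` (UNIV \<times> {1, \<i>})"
  by (auto simp: Basis_vec_def Basis_complex_def)

lemma prod_Basis_cart_complex:
  "(\<Prod>j\<in>(Basis :: (complex ^ 'n) set). c j) = (\<Prod>k\<in>UNIV. c (axis k 1) * c (axis k \<i>))"
proof -
  have "inj_on (\<lambda>(k, b). axis k b :: complex ^ 'n) (UNIV \<times> {1, \<i>})"
    by (auto simp: inj_on_def axis_eq_axis)
  then have "(\<Prod>j\<in>(Basis :: (complex ^ 'n) set). c j) = (\<Prod>(k, b)\<in>UNIV \<times> {1, \<i>}. c (axis k b))"
    unfolding Basis_cart_complex by (subst prod.reindex) (simp_all add: comp_def case_prod_beta)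
  also have "\<dots> = (\<Prod>k\<in>UNIV. \<Prod>b\<in>{1, \<i>}. c (axis k b))"
    by (rule prod.cartesian_product[symmetric])
  finally show ?thesis by (simp add: complex_eq_iff)
qed

lemma prod_Basis_cart_real:
  "(\<Prod>j\<in>(Basis :: (real ^ 'n) set). c j) = (\<Prod>k\<in>UNIV. c (axis k 1))"
proof -
  have B: "(Basis :: (real ^ 'n) set) = (\<lambda>k. axis k 1) ` UNIV" by (auto simp: Basis_vec_def)
  have "inj (\<lambda>k. axis k 1 :: real ^ 'n)" by (simp add: inj_on_def axis_eq_axis)
  then show ?thesis unfolding B by (subst prod.reindex) simp_all
qed

lemma nn_integral_lborel_cart_prod:
  fixes g :: "'n::finite \<Rightarrow> real \<Rightarrow> ennreal"
  assumes "\<And>i. g i \<in> borel_measurable borel"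
  shows "(\<integral>\<^sup>+t. (\<Prod>i\<in>UNIV. g i (t $ i)) \<partial>(lborel :: (real ^ 'n) measure)) = (\<Prod>i\<in>UNIV. \<integral>\<^sup>+x. g i x \<partial>lborel)"
proof -
  define f :: "real ^ 'n \<Rightarrow> real \<Rightarrow> ennreal" where "f b = g (axis_index b)" for b
  have f: "f (axis i 1) = g i" for i by (simp add: f_def)
  have "(\<integral>\<^sup>+t. (\<Prod>b\<in>Basis. f b (t \<bullet> b)) \<partial>(lborel :: (real ^ 'n) measure)) = (\<Prod>b\<in>Basis. \<integral>\<^sup>+x. f b x \<partial>lborel)"
    by (rule nn_integral_lborel_prod) (simp_all add: f_def assms)
  then show ?thesis by (simp add: prod_Basis_cart_real f inner_axis)
qed

text \<open>Dilations are parametrized by exponents so that \<open>log_norm\<close> turns them into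
  translations.\<close>

definition scale_cart :: "real ^ 'n \<Rightarrow> complex ^ 'n \<Rightarrow> complex ^ 'n" where
  "scale_cart s z = (\<chi> k. of_real (exp (s $ k)) * z $ k)"

lemma borel_measurable_scale_cart [measurable]: "scale_cart s \<in> borel_measurable borel"
  unfolding scale_cart_def by measurable

lemma nn_integral_scale_cart:
  fixes s :: "real ^ 'n"
  assumes [measurable]: "f \<in> borel_measurable borel"
  shows "(\<integral>\<^sup>+z. f z \<partial>lborel) = ennreal (\<Prod>k\<in>UNIV. exp (s $ k) ^ 2) * (\<integral>\<^sup>+z. f (scale_cart s z) \<partial>lborel)"
proof -
  \<comment> \<open>The affine change of variables takes one factor per real basis vector;
    \<open>SOME\<close> recovers the coordinate from \<open>axis k b\<close>. The vectors for b = 1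
    and b = \<i> share a factor, whence the squares in the determinant.\<close>
  define c :: "complex ^ 'n \<Rightarrow> real" where "c j = exp (s $ (SOME i. j $ i \<noteq> 0))" for j
  have c: "c (axis k b) = exp (s $ k)" if "b \<noteq> 0" for k b
  proof -
    have "(SOME i. axis k b $ i \<noteq> 0) = k"
      by (rule some_equality) (use that in \<open>auto simp: axis_def split: if_splits\<close>)
    then show ?thesis by (simp add: c_def)
  qed
  have T: "(\<Sum>j\<in>Basis. (c j * (z \<bullet> j)) *\<^sub>R j) = scale_cart s z" for z
  proof (rule euclidean_eqI)
    fix i :: "complex ^ 'n" assume i: "i \<in> Basis"
    then obtain k b where b: "i = axis k b" "b \<in> Basis" by (auto simp: Basis_vec_def)
    then have "b \<noteq> 0" by auto
    have "(\<Sum>j\<in>Basis. (c j * (z \<bullet> j)) *\<^sub>R j) \<bullet> i = c i * (z \<bullet> i)"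
      using i by (simp add: inner_sum_left inner_Basis if_distrib sum.delta cong: if_cong)
    also have "\<dots> = scale_cart s z \<bullet> i"
      using b \<open>b \<noteq> 0\<close> by (simp add: c scale_cart_def inner_axis inner_complex_def algebra_simps)
    finally show "(\<Sum>j\<in>Basis. (c j * (z \<bullet> j)) *\<^sub>R j) \<bullet> i = scale_cart s z \<bullet> i" .
  qed
  have P: "(\<Prod>j\<in>(Basis :: (complex ^ 'n) set). \<bar>c j\<bar>) = (\<Prod>k\<in>UNIV. exp (s $ k) ^ 2)"
    by (simp add: prod_Basis_cart_complex c power2_eq_square)
  have "lborel = density (distr lborel borel (\<lambda>x. 0 + (\<Sum>j\<in>Basis. (c j * (x \<bullet> j)) *\<^sub>R j))) (\<lambda>_. (\<Prod>j\<in>(Basis :: (complex ^ 'n) set). \<bar>c j\<bar>))"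
    by (rule lborel_affine_euclidean) (simp add: c_def)
  then have eq: "(lborel :: (complex ^ 'n) measure) = density (distr lborel borel (scale_cart s)) (\<lambda>_. (\<Prod>k\<in>UNIV. exp (s $ k) ^ 2))"
    unfolding T P by simp
  show ?thesis
    by (subst eq) (simp add: nn_integral_density nn_integral_cmult nn_integral_distr)
qed

lemma nn_integral_rotate_cart:
  fixes \<phi> :: "real ^ 'n"
  assumes "f \<in> borel_measurable borel"
  shows "(\<integral>\<^sup>+z. f (\<chi> k. cis (\<phi> $ k) * z $ k) \<partial>lborel) = (\<integral>\<^sup>+z. f z \<partial>lborel)"
proof (rule nn_integral_lborel_linear_isometry[OF _ _ assms])
  show "linear (\<lambda>z. \<chi> k. cis (\<phi> $ k) * z $ k)"
    by (rule linearI) (simp_all add: vec_eq_iff algebra_simps)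
  show "norm (\<chi> k. cis (\<phi> $ k) * z $ k) = norm z" for z
    by (simp add: norm_vec_def norm_mult)
qed

text \<open>The complex hyperplane \<open>z $ k = 0\<close> lies in the real hyperplane
  \<open>Re (z $ k) = 0\<close>, which is negligible.\<close>

lemma AE_cart_nonzero: "AE z in (lborel :: (complex ^ 'n) measure). \<forall>k. z $ k \<noteq> 0"
proof -
  have "AE z in (lborel :: (complex ^ 'n) measure). z $ k \<noteq> 0" for k
  proof -
    have ne: "(axis k 1 :: complex ^ 'n) \<noteq> 0" by simp
    have "negligible {z :: complex ^ 'n. axis k 1 \<bullet> z = 0}"
      by (rule negligible_hyperplane) (use ne in blast)
    then have "negligible {z :: complex ^ 'n. z $ k = 0}"
      by (rule negligible_subset) (auto simp: inner_axis')
    then have "{z :: complex ^ 'n. z $ k = 0} \<in> null_sets lebesgue" by (simp add: negligible_iff_null_sets)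
    moreover have "{z :: complex ^ 'n. z $ k = 0} \<in> sets borel" by measurable
    ultimately have "{z :: complex ^ 'n. z $ k = 0} \<in> null_sets lborel"
      by (simp add: null_sets_completion_iff)
    then show ?thesis by (rule AE_I') auto
  qed
  then show ?thesis by (simp add: AE_all_countable)
qed

subsection \<open>Monomials in logarithmic coordinates\<close>

definition real_vec :: "int ^ 'n \<Rightarrow> real ^ 'n" where
  "real_vec \<alpha> = (\<chi> k. real_of_int (\<alpha> $ k))"

definition log_norm :: "complex ^ 'n \<Rightarrow> real ^ 'n" where
  "log_norm z = (\<chi> k. ln (norm (z $ k)))"

definition torus_part :: "(complex ^ 'n) set" where
  "torus_part = {z. \<forall>k. z $ k \<noteq> 0}"

lemma borel_measurable_log_norm [measurable]: "log_norm \<in> borel_measurable borel"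
  unfolding log_norm_def by measurable

lemma sets_torus_part [measurable]: "torus_part \<in> sets borel"
  unfolding torus_part_def by measurable

lemma norm_mono_eq_exp:
  assumes "z \<in> torus_part"
  shows "norm (mono \<alpha> z) = exp (real_vec \<alpha> \<bullet> log_norm z)"
proof -
  have "norm (z $ k) powi m = exp (real_of_int m * ln (norm (z $ k)))" for k m
  proof -
    have "norm (z $ k) > 0" using assms by (simp add: torus_part_def)
    then show ?thesis by (simp flip: powr_real_of_int' add: powr_def)
  qed
  then show ?thesis
    by (simp add: Defs.mono_def prod_norm[symmetric] norm_power_int inner_vec_def real_vec_def log_norm_def exp_sum)
qed

lemma mono_nonzero: "z \<in> torus_part \<Longrightarrow> mono \<alpha> z \<noteq> 0"
  by (simp add: Defs.mono_def torus_part_def power_int_eq_0_iff)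

lemma mono_rotate: "mono \<alpha> (\<chi> k. cis (\<phi> $ k) * z $ k) = cis (real_vec \<alpha> \<bullet> \<phi>) * mono \<alpha> z"
proof -
  have "cis x powi m = cis (real_of_int m * x)" for x m
    by (rule cis_power_int)
  moreover have "(\<Prod>k\<in>UNIV. cis (f k)) = cis (\<Sum>k\<in>UNIV. f k)" for f :: "'a \<Rightarrow> real"
    by (simp add: cis_conv_exp exp_sum sum_distrib_left)
  ultimately show ?thesis
    by (simp add: Defs.mono_def power_int_mult_distrib prod.distrib inner_vec_def real_vec_def)
qed

section \<open>Logarithmic coordinates attached to an exponent matrix\<close>

locale monomial_map =
  fixes A :: "int ^ 'n ^ 'n"
  assumes det_nonzero: "det A \<noteq> 0"
begin

definition Ar :: "real ^ 'n ^ 'n" where "Ar = (\<chi> i j. real_of_int (A $ i $ j))"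

definition Ai :: "real ^ 'n ^ 'n" where "Ai = matrix_inv Ar"

definition L :: "complex ^ 'n \<Rightarrow> real ^ 'n" where "L z = Ar *v log_norm z"

text \<open>On the torus, the modulus of the monomial with exponent \<open>v\<close> is the product of the moduli
  of the row monomials raised to the (rational) powers \<open>row_exp v $ j\<close>.\<close>
definition row_exp :: "real ^ 'n \<Rightarrow> real ^ 'n" where "row_exp v = v v* Ai"

text \<open>Exponents of \<open>\<Prod>k. |z $ k|\<close>, hence \<open>2 jac_exp\<close> is the exponent of the Lebesgue density
  with respect to the Haar measure of the torus.\<close>
definition jac_exp :: "real ^ 'n" where "jac_exp = row_exp (\<chi> k. 1)"

lemma Ar_inverse: "Ar ** Ai = mat 1" "Ai ** Ar = mat 1"
proof -
  have "det Ar = real_of_int (det A)"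
    by (simp add: det_def Ar_def of_int_sum of_int_prod)
  then have "invertible Ar" using det_nonzero by (simp add: invertible_det_nz)
  then have "Ar ** Ai = mat 1 \<and> Ai ** Ar = mat 1"
    unfolding Ai_def matrix_inv_def invertible_def by (rule someI_ex)
  then show "Ar ** Ai = mat 1" "Ai ** Ar = mat 1" by simp_all
qed

lemma Ai_L: "Ai *v L z = log_norm z"
  by (simp add: L_def matrix_vector_mul_assoc Ar_inverse)

lemma row_exp_inner_L: "row_exp v \<bullet> L z = v \<bullet> log_norm z"
  by (simp add: row_exp_def dot_lmul_matrix Ai_L)

lemma borel_measurable_L [measurable]: "L \<in> borel_measurable borel"
  unfolding L_def matrix_vector_mult_def by measurable

lemma norm_mono_row_exp: "z \<in> torus_part \<Longrightarrow> norm (mono \<alpha> z) = exp (row_exp (real_vec \<alpha>) \<bullet> L z)"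
  by (simp add: norm_mono_eq_exp row_exp_inner_L)

lemma L_nth: "L z $ j = real_vec (A $ j) \<bullet> log_norm z"
  by (simp add: L_def matrix_vector_mult_def Ar_def real_vec_def inner_vec_def)

lemma exp_L: "z \<in> torus_part \<Longrightarrow> exp (L z $ j) = norm (mono (A $ j) z)"
  by (simp add: norm_mono_eq_exp L_nth)

lemma L_scale_cart:
  assumes "z \<in> torus_part"
  shows "L (scale_cart s z) = Ar *v s + L z"
proof -
  have "log_norm (scale_cart s z) = s + log_norm z"
    using assms by (simp add: vec_eq_iff log_norm_def scale_cart_def norm_mult ln_mult torus_part_def)
  then show ?thesis by (simp add: L_def matrix_vector_right_distrib)
qed

lemma prod_norm_sq_eq:
  assumes "z \<in> torus_part"
  shows "(\<Prod>k\<in>UNIV. (norm (z $ k))\<^sup>2) = exp (2 * (jac_exp \<bullet> L z))"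
proof -
  have "2 * (jac_exp \<bullet> L z) = (\<Sum>k\<in>UNIV. 2 * ln (norm (z $ k)))"
    unfolding jac_exp_def row_exp_inner_L by (simp add: inner_vec_def log_norm_def sum_distrib_left)
  also have "exp \<dots> = (\<Prod>k\<in>UNIV. exp (2 * ln (norm (z $ k))))" by (simp add: exp_sum)
  also have "\<dots> = (\<Prod>k\<in>UNIV. (norm (z $ k))\<^sup>2)"
  proof (rule prod.cong)
    fix k
    have "norm (z $ k) > 0" using assms by (simp add: torus_part_def)
    then show "exp (2 * ln (norm (z $ k))) = (norm (z $ k))\<^sup>2"
      by (metis exp_double exp_ln)
  qed simp
  finally show ?thesis by simp
qed

text \<open>The Haar measure \<open>dV / \<Prod>|z\<^sub>k|\<^sup>2\<close> of the torus is pushed forward by \<open>L\<close> to a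
  translation invariant measure.\<close>
lemma radial_formula_exists:
  obtains C0 :: real where "0 < C0" "\<And>F. F \<in> borel_measurable borel \<Longrightarrow>
    (\<integral>\<^sup>+z. F (L z) * indicator torus_part z \<partial>lborel)
      = ennreal C0 * (\<integral>\<^sup>+t. F t * ennreal (exp (2 * (jac_exp \<bullet> t))) \<partial>lborel)"
proof -
  define h :: "complex ^ 'n \<Rightarrow> ennreal" where
    "h z = ennreal (\<Prod>k\<in>UNIV. inverse ((norm (z $ k))\<^sup>2)) * indicator torus_part z" for z
  define \<mu> where "\<mu> = density lborel h"
  define \<nu> where "\<nu> = distr \<mu> borel L"
  have [measurable]: "h \<in> borel_measurable borel" unfolding h_def by measurable
  have sets\<mu>[measurable_cong]: "sets \<mu> = sets borel" by (simp add: \<mu>_def)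
  have sets[measurable_cong]: "sets \<nu> = sets borel" by (simp add: \<nu>_def)
  have torus_scale: "scale_cart s z \<in> torus_part \<longleftrightarrow> z \<in> torus_part" for s z
    by (simp add: torus_part_def scale_cart_def)
  \<comment> \<open>Dilation invariance of the Haar density: the Jacobian factors cancel against the
    inverse squared moduli.\<close>
  have h_scale: "ennreal (\<Prod>k\<in>UNIV. exp (s $ k) ^ 2) * h (scale_cart s z) = h z" for s z
  proof -
    have "(\<Prod>k\<in>UNIV. exp (s $ k) ^ 2) * (\<Prod>k\<in>UNIV. inverse ((norm (scale_cart s z $ k))\<^sup>2))
       = (\<Prod>k\<in>UNIV. inverse ((norm (z $ k))\<^sup>2))"
      unfolding prod.distrib[symmetric]
      by (intro prod.cong refl) (simp add: scale_cart_def norm_mult power_mult_distrib)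
    then show ?thesis unfolding h_def mult.assoc[symmetric]
      by (simp add: torus_scale indicator_def ennreal_mult'[symmetric] prod_nonneg)
  qed
  have \<nu>_int: "(\<integral>\<^sup>+t. F t \<partial>\<nu>) = (\<integral>\<^sup>+z. h z * F (L z) \<partial>lborel)"
    if [measurable]: "F \<in> borel_measurable borel" for F
    unfolding \<nu>_def \<mu>_def by (simp add: nn_integral_distr nn_integral_density)
  have inv: "distr \<nu> borel (\<lambda>x. a + x) = \<nu>" for a
  proof (rule measure_eqI)
    fix B assume "B \<in> sets (distr \<nu> borel (\<lambda>x. a + x))"
    then have [measurable]: "B \<in> sets borel" by simp
    have [measurable]: "B \<in> sets \<nu>" by (simp add: sets)
    \<comment> \<open>The dilation with these exponents translates \<open>L\<close> by exactly
      \<open>a\<close>.\<close>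
    define s where "s = Ai *v a"
    have s: "Ar *v s = a" by (simp add: s_def matrix_vector_mul_assoc Ar_inverse)
    have "emeasure \<nu> B = (\<integral>\<^sup>+t. indicator B t \<partial>\<nu>)" by simp
    also have "\<dots> = (\<integral>\<^sup>+z. h z * indicator B (L z) \<partial>lborel)" by (rule \<nu>_int) simp
    also have "\<dots> = ennreal (\<Prod>k\<in>UNIV. exp (s $ k) ^ 2) * (\<integral>\<^sup>+z. h (scale_cart s z) * indicator B (L (scale_cart s z)) \<partial>lborel)"
      by (rule nn_integral_scale_cart) measurable
    also have "\<dots> = (\<integral>\<^sup>+z. h z * indicator B (L (scale_cart s z)) \<partial>lborel)"
      by (subst nn_integral_cmult[symmetric]) (simp_all add: mult.assoc[symmetric] h_scale)
    also have "\<dots> = (\<integral>\<^sup>+z. h z * indicator B (a + L z) \<partial>lborel)"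
      by (intro nn_integral_cong) (auto simp: h_def indicator_def L_scale_cart s)
    also have "\<dots> = (\<integral>\<^sup>+t. indicator B (a + t) \<partial>\<nu>)" by (rule \<nu>_int[symmetric]) simp
    also have "\<dots> = (\<integral>\<^sup>+t. indicator B t \<partial>distr \<nu> borel (\<lambda>x. a + x))"
      by (rule nn_integral_distr[symmetric]) measurable
    also have "\<dots> = emeasure (distr \<nu> borel (\<lambda>x. a + x)) B" by simp
    finally show "emeasure (distr \<nu> borel (\<lambda>x. a + x)) B = emeasure \<nu> B" by simp
  qed (simp add: sets)
  have fin: "emeasure \<nu> (cball 0 r) < \<infinity>" for r
  proof -
    obtain K where K: "\<And>x. norm (Ai *v x) \<le> norm x * K" "0 < K"
      using bounded_linear.pos_bounded[OF matrix_vector_mul_bounded_linear[of Ai]] by blast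
    define m where "m = \<bar>r\<bar> * K"
    define R where "R = real CARD('n) * exp m"
    \<comment> \<open>If \<open>L z\<close> lies in the ball, then
      \<open>log_norm z = Ai *v L z\<close> is bounded by \<open>m\<close>, so every coordinate has
      modulus between \<open>exp (- m)\<close> and \<open>exp m\<close>: the density is bounded and
      \<open>z\<close> stays in a fixed ball.\<close>
    have bd: "h z * indicator (cball 0 r) (L z) \<le> ennreal ((exp (2 * m)) ^ CARD('n)) * indicator (cball 0 R) z" for z
    proof (cases "z \<in> torus_part \<and> L z \<in> cball 0 r")
      case True
      then have "norm (L z) \<le> \<bar>r\<bar>" by auto
      then have "norm (L z) * K \<le> m" unfolding m_def using K(2) by (intro mult_right_mono) auto
      then have "norm (log_norm z) \<le> m" using K(1)[of "L z"] by (simp add: Ai_L)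
      then have lz: "\<bar>ln (norm (z $ k))\<bar> \<le> m" for k
        using component_le_norm_cart[of "log_norm z" k] by (simp add: log_norm_def)
      have zk: "0 < norm (z $ k)" for k using True by (simp add: torus_part_def)
      have up: "norm (z $ k) \<le> exp m" for k
        using lz[of k] zk[of k] by (metis abs_le_D1 exp_le_cancel_iff exp_ln)
      have low: "inverse (norm (z $ k)) \<le> exp m" for k
        using lz[of k] zk[of k] by (metis abs_le_D2 exp_le_cancel_iff exp_ln exp_minus)
      have "norm z \<le> (\<Sum>k\<in>UNIV. norm (z $ k))" by (simp add: norm_vec_def L2_set_le_sum)
      also have "\<dots> \<le> (\<Sum>k\<in>(UNIV::'n set). exp m)" by (intro sum_mono up)
      finally have "z \<in> cball 0 R" by (simp add: R_def)
      moreover have "(\<Prod>k\<in>UNIV. inverse ((norm (z $ k))\<^sup>2)) \<le> (\<Prod>k\<in>(UNIV::'n set). exp (2 * m))"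
      proof (rule prod_mono, safe)
        fix k
        show "0 \<le> inverse ((norm (z $ k))\<^sup>2)" by simp
        have "(inverse (norm (z $ k)))\<^sup>2 \<le> (exp m)\<^sup>2" by (intro power_mono low) simp
        then show "inverse ((norm (z $ k))\<^sup>2) \<le> exp (2 * m)" by (simp add: power_inverse exp_double)
      qed
      ultimately show ?thesis using True by (simp add: h_def ennreal_leI)
    qed (auto simp: h_def)
    have "emeasure \<nu> (cball 0 r) = (\<integral>\<^sup>+t. indicator (cball 0 r) t \<partial>\<nu>)" by (simp add: sets)
    also have "\<dots> = (\<integral>\<^sup>+z. h z * indicator (cball 0 r) (L z) \<partial>lborel)"
      by (rule \<nu>_int) (intro borel_measurable_indicator borel_closed closed_cball)
    also have "\<dots> \<le> (\<integral>\<^sup>+z. ennreal ((exp (2 * m)) ^ CARD('n)) * indicator (cball (0 :: complex ^ 'n) R) z \<partial>lborel)"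
      by (intro nn_integral_mono bd)
    also have "\<dots> = ennreal ((exp (2 * m)) ^ CARD('n)) * emeasure lborel (cball (0 :: complex ^ 'n) R)"
      by (rule nn_integral_cmult_indicator) (simp add: borel_closed)
    also have "\<dots> < \<infinity>" using emeasure_lborel_cball_finite[of "0 :: complex ^ 'n" R]
      by (simp add: ennreal_mult_less_top)
    finally show ?thesis .
  qed
  obtain C where C: "0 \<le> C" "\<And>B. B \<in> sets borel \<Longrightarrow> emeasure \<nu> B = ennreal C * emeasure lborel B"
    using translation_invariant_eq_lborel[OF sets inv fin] by blast
  have \<nu>_eq: "\<nu> = density lborel (\<lambda>_. ennreal C)"
    by (rule measure_eqI) (simp_all add: sets C(2) emeasure_density_const)
  have main: "(\<integral>\<^sup>+z. F (L z) * indicator torus_part z \<partial>lborel)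
      = ennreal C * (\<integral>\<^sup>+t. F t * ennreal (exp (2 * (jac_exp \<bullet> t))) \<partial>lborel)"
    if [measurable]: "F \<in> borel_measurable borel" for F
  proof -
    have "(\<integral>\<^sup>+z. F (L z) * indicator torus_part z \<partial>lborel)
       = (\<integral>\<^sup>+z. h z * (F (L z) * ennreal (exp (2 * (jac_exp \<bullet> L z)))) \<partial>lborel)"
    proof (rule nn_integral_cong)
      fix z
      show "F (L z) * indicator torus_part z = h z * (F (L z) * ennreal (exp (2 * (jac_exp \<bullet> L z))))"
      proof (cases "z \<in> torus_part")
        case True
        have "(\<Prod>k\<in>UNIV. inverse ((norm (z $ k))\<^sup>2)) * exp (2 * (jac_exp \<bullet> L z)) = 1"
          unfolding prod_norm_sq_eq[OF True, symmetric] prod.distrib[symmetric]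
          using True by (simp add: torus_part_def)
        then have "h z * ennreal (exp (2 * (jac_exp \<bullet> L z))) = 1"
          using True by (simp add: h_def prod_nonneg flip: ennreal_mult)
        then show ?thesis using True by (metis indicator_simps(1) mult.assoc mult.commute)
      qed (simp add: h_def)
    qed
    also have "\<dots> = (\<integral>\<^sup>+t. F t * ennreal (exp (2 * (jac_exp \<bullet> t))) \<partial>\<nu>)" by (rule \<nu>_int[symmetric]) simp
    also have "\<dots> = ennreal C * (\<integral>\<^sup>+t. F t * ennreal (exp (2 * (jac_exp \<bullet> t))) \<partial>lborel)"
      unfolding \<nu>_eq by (simp add: nn_integral_density nn_integral_cmult)
    finally show ?thesis .
  qed
  \<comment> \<open>For F = 1 the value C = 0 would make the torus a null set, although its
    complement is one.\<close>
  have "C \<noteq> 0"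
  proof
    assume "C = 0"
    then have "(\<integral>\<^sup>+z. indicator torus_part z \<partial>(lborel :: (complex ^ 'n) measure)) = 0"
      using main[of "\<lambda>_. 1"] by simp
    then have "AE z in (lborel :: (complex ^ 'n) measure). z \<notin> torus_part"
      by (subst (asm) nn_integral_0_iff_AE) (auto simp: indicator_def)
    with AE_cart_nonzero[where 'n='n] have "AE z in (lborel :: (complex ^ 'n) measure). False"
      by eventually_elim (auto simp: torus_part_def)
    then show False
      using AE_iff_measurable[of UNIV "lborel :: (complex ^ 'n) measure" "\<lambda>_. False"]
      by (simp add: emeasure_lborel_UNIV)
  qed
  with C(1) have "0 < C" by simp
  then show ?thesis using main by (rule that)
qed

text \<open>Fixes one witness of \<open>radial_formula_exists\<close>. Its value stays unspecified;
  what matters is that it is positive and the same for all exponents.\<close>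

definition C0 :: real where
  "C0 = (SOME C. 0 < C \<and> (\<forall>F \<in> borel_measurable borel.
    (\<integral>\<^sup>+z. F (L z) * indicator torus_part z \<partial>lborel)
      = ennreal C * (\<integral>\<^sup>+t. F t * ennreal (exp (2 * (jac_exp \<bullet> t))) \<partial>lborel)))"

lemma C0_pos: "0 < C0"
  and radial_formula: "F \<in> borel_measurable borel \<Longrightarrow>
    (\<integral>\<^sup>+z. F (L z) * indicator torus_part z \<partial>lborel)
      = ennreal C0 * (\<integral>\<^sup>+t. F t * ennreal (exp (2 * (jac_exp \<bullet> t))) \<partial>lborel)"
proof -
  let ?P = "\<lambda>C. 0 < C \<and> (\<forall>F \<in> borel_measurable borel.
    (\<integral>\<^sup>+z. F (L z) * indicator torus_part z \<partial>lborel)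
      = ennreal C * (\<integral>\<^sup>+t. F t * ennreal (exp (2 * (jac_exp \<bullet> t))) \<partial>lborel))"
  have "\<exists>C. ?P C"
  proof (rule radial_formula_exists)
    fix C :: real
    assume "0 < C" and "\<And>F. F \<in> borel_measurable borel \<Longrightarrow>
      (\<integral>\<^sup>+z. F (L z) * indicator torus_part z \<partial>lborel)
        = ennreal C * (\<integral>\<^sup>+t. F t * ennreal (exp (2 * (jac_exp \<bullet> t))) \<partial>lborel)"
    then show ?thesis by (intro exI conjI ballI)
  qed
  then obtain C where "?P C" ..
  then have "?P C0" unfolding C0_def by (rule someI)
  then show "0 < C0" "F \<in> borel_measurable borel \<Longrightarrow>
    (\<integral>\<^sup>+z. F (L z) * indicator torus_part z \<partial>lborel)
      = ennreal C0 * (\<integral>\<^sup>+t. F t * ennreal (exp (2 * (jac_exp \<bullet> t))) \<partial>lborel)" by blast+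
qed

text \<open>The density in the coordinates \<open>L\<close> is the exponential of a linear form,
  hence itself a product over the coordinates, and the integral splits.\<close>

lemma radial_product:
  fixes g :: "'n \<Rightarrow> real \<Rightarrow> ennreal"
  assumes [measurable]: "\<And>j. g j \<in> borel_measurable borel"
  shows "(\<integral>\<^sup>+z. (\<Prod>j\<in>UNIV. g j (L z $ j)) * indicator torus_part z \<partial>lborel)
    = ennreal C0 * (\<Prod>j\<in>UNIV. \<integral>\<^sup>+x. g j x * ennreal (exp (2 * jac_exp $ j * x)) \<partial>lborel)"
proof -
  have "(\<Prod>j\<in>UNIV. g j (t $ j)) * ennreal (exp (2 * (jac_exp \<bullet> t)))
      = (\<Prod>j\<in>UNIV. g j (t $ j) * ennreal (exp (2 * jac_exp $ j * t $ j)))" for t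
  proof -
    have "exp (2 * (jac_exp \<bullet> t)) = (\<Prod>j\<in>UNIV. exp (2 * jac_exp $ j * t $ j))"
      by (simp add: inner_vec_def sum_distrib_left exp_sum mult.assoc)
    then show ?thesis by (simp add: prod.distrib prod_ennreal)
  qed
  then have "(\<integral>\<^sup>+z. (\<Prod>j\<in>UNIV. g j (L z $ j)) * indicator torus_part z \<partial>lborel)
      = ennreal C0 * (\<integral>\<^sup>+t. (\<Prod>j\<in>UNIV. g j (t $ j) * ennreal (exp (2 * jac_exp $ j * t $ j))) \<partial>lborel)"
    by (subst radial_formula) simp_all
  also have "(\<integral>\<^sup>+t. (\<Prod>j\<in>UNIV. g j (t $ j) * ennreal (exp (2 * jac_exp $ j * t $ j))) \<partial>lborel)
      = (\<Prod>j\<in>UNIV. \<integral>\<^sup>+x. g j x * ennreal (exp (2 * jac_exp $ j * x)) \<partial>lborel)"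
    by (rule nn_integral_lborel_cart_prod) measurable
  finally show ?thesis .
qed

end

text \<open>The infinite value for b \<le> 0 matters as much as the finite one: it shows that an
  integrable monomial has positive exponents in every direction.\<close>

lemma nn_integral_exp_negative_axis:
  fixes b :: real
  shows "(\<integral>\<^sup>+t. ennreal (exp (b * t)) * indicator {..<0} t \<partial>lborel) = (if 0 < b then ennreal (1 / b) else \<infinity>)"
proof (cases "0 < b")
  case True
  have "(\<integral>\<^sup>+t. ennreal (exp (b * t)) * indicator {..<0} t \<partial>lborel)
      = (\<integral>\<^sup>+s. ennreal (exp (- b * s)) * indicator {..<0} (- s) \<partial>lborel)"
    by (subst nn_integral_real_affine[where c = "-1" and t = 0]) auto
  also have "\<dots> = (\<integral>\<^sup>+s. ennreal (indicator {0..} s * exp (- b * s)) \<partial>lborel)"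
  proof (rule nn_integral_cong_AE)
    show "AE s in lborel. ennreal (exp (- b * s)) * indicator {..<0} (- s) = ennreal (indicator {0..} s * exp (- b * s))"
      using AE_lborel_singleton[of "0::real"] by eventually_elim (auto simp: indicator_def)
  qed
  also have "\<dots> = ennreal (exp (- b * 0) / b)"
    by (rule nn_integral_has_integral_lebesgue) (use True has_integral_exp_minus_to_infinity[of b 0] in auto)
  finally show ?thesis using True by simp
next
  case False
  have "(\<infinity> :: ennreal) = emeasure lborel {..<(0::real)}"
  proof (rule ccontr)
    assume "\<infinity> \<noteq> emeasure lborel {..<(0::real)}"
    then obtain c where c: "emeasure lborel {..<(0::real)} = ennreal c" "0 \<le> c"
      by (cases "emeasure lborel {..<(0::real)}") auto
    have "emeasure lborel {- (c + 1)<..<(0::real)} \<le> emeasure lborel {..<(0::real)}"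
      by (rule emeasure_mono) auto
    then show False using c by simp
  qed
  also have "\<dots> = (\<integral>\<^sup>+t. indicator {..<(0::real)} t \<partial>lborel)" by (subst nn_integral_indicator) simp_all
  also have "\<dots> \<le> (\<integral>\<^sup>+t. ennreal (exp (b * t)) * indicator {..<0} t \<partial>lborel)"
  proof (rule nn_integral_mono)
    fix t :: real
    have "1 \<le> ennreal (exp (b * t))" if "t < 0"
      using that False by (simp add: mult_nonpos_nonpos)
    then show "indicator {..<0} t \<le> ennreal (exp (b * t)) * indicator {..<0} t"
      by (auto simp: indicator_def)
  qed
  finally show ?thesis using False by (simp add: top_unique)
qed

lemma borel_measurable_cis [measurable (raw)]:
  assumes "f \<in> borel_measurable M"
  shows "(\<lambda>x. cis (f x)) \<in> borel_measurable M"
  by (rule measurable_compose[OF assms])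
    (intro borel_measurable_continuous_onI continuous_intros)

section \<open>Integrals over the polyhedron off the coordinate hyperplanes\<close>

context monomial_map
begin

text \<open>Stands for the polyhedron without the coordinate hyperplanes, hence for the polyhedron
  up to a null set; on it all Laurent monomials are defined and nonzero.\<close>

definition V :: "(complex ^ 'n) set" where "V = {z \<in> torus_part. \<forall>j. L z $ j < 0}"

text \<open>Exponent of the j-th one-dimensional integral: the first term comes from
  \<open>|mono \<alpha>| powr p\<close>, the second from the density of Lebesgue measure in the
  coordinates \<open>L\<close>.\<close>

definition beta :: "real \<Rightarrow> int ^ 'n \<Rightarrow> 'n \<Rightarrow> real" where
  "beta p \<alpha> j = p * row_exp (real_vec \<alpha>) $ j + 2 * jac_exp $ j"

lemma sets_V [measurable]: "V \<in> sets borel"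
  unfolding V_def by measurable

lemma V_alt: "V = {z \<in> torus_part. \<forall>j. norm (mono (A $ j) z) < 1}"
proof -
  have "L z $ j < 0 \<longleftrightarrow> norm (mono (A $ j) z) < 1" if "z \<in> torus_part" for z j
    using exp_L[OF that, of j] by (metis exp_less_one_iff)
  then show ?thesis unfolding V_def by blast
qed

lemma indicator_V: "(indicator V z :: ennreal) = (\<Prod>j\<in>UNIV. indicator {..<0} (L z $ j)) * indicator torus_part z"
proof -
  have "(\<Prod>j\<in>UNIV. indicator {..<0} (L z $ j) :: ennreal) = (if \<forall>j. L z $ j < 0 then 1 else 0)"
    by (auto simp: indicator_def)
  then show ?thesis by (auto simp: V_def indicator_def)
qed

lemma norm_mono_powr:
  assumes "z \<in> torus_part"
  shows "norm (mono \<alpha> z) powr p = (\<Prod>j\<in>UNIV. exp (p * row_exp (real_vec \<alpha>) $ j * L z $ j))"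
proof -
  have "norm (mono \<alpha> z) powr p = exp (p * (row_exp (real_vec \<alpha>) \<bullet> L z))"
    using assms by (simp add: norm_mono_row_exp powr_def)
  also have "\<dots> = (\<Prod>j\<in>UNIV. exp (p * row_exp (real_vec \<alpha>) $ j * L z $ j))"
    by (simp add: inner_vec_def sum_distrib_left exp_sum mult.assoc)
  finally show ?thesis .
qed

lemma nn_integral_mono_powr:
  "(\<integral>\<^sup>+z. ennreal (norm (mono \<alpha> z) powr p) * indicator V z \<partial>lborel)
    = ennreal C0 * (\<Prod>j\<in>UNIV. if 0 < beta p \<alpha> j then ennreal (1 / beta p \<alpha> j) else \<infinity>)"
proof -
  define g where "g j t = ennreal (exp (p * row_exp (real_vec \<alpha>) $ j * t)) * indicator {..<0} t" for j t
  have [measurable]: "g j \<in> borel_measurable borel" for j unfolding g_def by measurable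
  have "ennreal (norm (mono \<alpha> z) powr p) * indicator V z = (\<Prod>j\<in>UNIV. g j (L z $ j)) * indicator torus_part z" for z
  proof (cases "z \<in> torus_part")
    case True
    then show ?thesis unfolding indicator_V norm_mono_powr[OF True] g_def
      by (simp add: prod.distrib prod_ennreal mult.assoc)
  qed (simp add: V_def)
  then have "(\<integral>\<^sup>+z. ennreal (norm (mono \<alpha> z) powr p) * indicator V z \<partial>lborel)
      = ennreal C0 * (\<Prod>j\<in>UNIV. \<integral>\<^sup>+x. g j x * ennreal (exp (2 * jac_exp $ j * x)) \<partial>lborel)"
    by (simp add: radial_product)
  moreover have "(\<integral>\<^sup>+x. g j x * ennreal (exp (2 * jac_exp $ j * x)) \<partial>lborel)
      = (if 0 < beta p \<alpha> j then ennreal (1 / beta p \<alpha> j) else \<infinity>)" for j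
  proof -
    have "g j x * ennreal (exp (2 * jac_exp $ j * x)) = ennreal (exp (beta p \<alpha> j * x)) * indicator {..<0} x" for x
    proof -
      have "exp (beta p \<alpha> j * x) = exp (p * row_exp (real_vec \<alpha>) $ j * x) * exp (2 * jac_exp $ j * x)"
        by (simp add: beta_def algebra_simps flip: exp_add)
      then show ?thesis by (simp add: g_def ennreal_mult' mult_ac)
    qed
    then show ?thesis by (simp add: nn_integral_exp_negative_axis)
  qed
  ultimately show ?thesis by (simp only:)
qed

lemma nn_integral_mono_powr_pos:
  assumes "\<And>j. 0 < beta p \<alpha> j"
  shows "(\<integral>\<^sup>+z. ennreal (norm (mono \<alpha> z) powr p) * indicator V z \<partial>lborel)
    = ennreal (C0 / (\<Prod>j\<in>UNIV. beta p \<alpha> j))"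
  using C0_pos less_imp_le[OF assms]
  by (simp add: nn_integral_mono_powr assms prod_ennreal ennreal_mult'[symmetric] prod_dividef)

text \<open>In \<open>ennreal\<close> an infinite factor could be annihilated by a factor 0; here
  every factor is positive or infinite, so a single nonpositive exponent already makes the integral
  infinite.\<close>

lemma beta_pos_of_finite:
  assumes "(\<integral>\<^sup>+z. ennreal (norm (mono \<alpha> z) powr p) * indicator V z \<partial>lborel) < \<infinity>"
  shows "0 < beta p \<alpha> j"
proof (rule ccontr)
  assume n: "\<not> 0 < beta p \<alpha> j"
  let ?f = "\<lambda>j. if 0 < beta p \<alpha> j then ennreal (1 / beta p \<alpha> j) else \<infinity>"
  have "(\<Prod>j\<in>UNIV. ?f j) = ?f j * (\<Prod>i\<in>UNIV - {j}. ?f i)"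
    by (rule prod.remove) auto
  also have "\<dots> = \<infinity>" using n by (auto simp: ennreal_mult_eq_top_iff ennreal_eq_0_iff)
  finally show False using assms C0_pos unfolding nn_integral_mono_powr
    by (simp add: ennreal_mult_eq_top_iff)
qed

text \<open>Averaging over the rotations \<open>z \<mapsto> (exp (\<i> \<phi>\<^sub>k) z\<^sub>k)\<close> with \<open>\<phi> = A\<inverse>\<psi>\<close>, which multiply the
  \<open>j\<close>-th monomial by \<open>exp (\<i> \<psi>\<^sub>j)\<close>, replaces the squared kernels by Poisson integrals.\<close>
lemma nn_integral_kernel_average:
  fixes W :: "real ^ 'n \<Rightarrow> real" and b :: "'n \<Rightarrow> complex"
  assumes [measurable]: "W \<in> borel_measurable borel" and W: "\<And>t. 0 \<le> W t"
    and b: "\<And>j. norm (b j) < 1" and \<tau>: "0 < \<tau>"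
  shows "(\<integral>\<^sup>+z. ennreal (W (L z) * (\<Prod>j\<in>UNIV. 1 / (norm (1 - b j * (mono (A $ j) z
              * of_real (norm (mono (A $ j) z) powr (\<tau> - 1)))))\<^sup>2)) * indicator V z \<partial>lborel)
    = (\<integral>\<^sup>+z. ennreal (W (L z) * (\<Prod>j\<in>UNIV. 1 / (1 - (norm (b j) * exp (\<tau> * L z $ j))\<^sup>2)))
          * indicator V z \<partial>lborel)"
proof -
  define c where "c j z = b j * (mono (A $ j) z * of_real (norm (mono (A $ j) z) powr (\<tau> - 1)))" for j z
  define H where "H z = ennreal (W (L z) * (\<Prod>j\<in>UNIV. 1 / (norm (1 - c j z))\<^sup>2)) * indicator V z" for z
  define R where "R \<psi> z = (\<chi> k. cis ((Ai *v \<psi>) $ k) * z $ k)" for \<psi> :: "real ^ 'n" and z :: "complex ^ 'n"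
  define q where "q x = ennreal (1 / (2 * pi)) * indicator {0..2 * pi} x" for x :: real
  have [measurable]: "c j \<in> borel_measurable borel" for j unfolding c_def by measurable
  have [measurable]: "H \<in> borel_measurable borel" unfolding H_def by measurable
  have [measurable]: "q \<in> borel_measurable borel" unfolding q_def by measurable
  have [measurable]: "(\<lambda>x. R (fst x) (snd x)) \<in> borel_measurable (lborel \<Otimes>\<^sub>M lborel)"
    unfolding R_def matrix_vector_mult_def by measurable
  have norm_c: "norm (c j z) = norm (b j) * exp (\<tau> * L z $ j)" if "z \<in> torus_part" for j z
  proof -
    have "norm (mono (A $ j) z) * norm (mono (A $ j) z) powr (\<tau> - 1) = norm (mono (A $ j) z) powr \<tau>"
      using mono_nonzero[OF that, of "A $ j"] by (simp add: powr_diff)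
    then show ?thesis
      by (simp add: c_def norm_mult exp_L[OF that, symmetric] powr_def)
  qed
  have c_lt: "norm (c j z) < 1" if "z \<in> V" for j z
  proof -
    have z: "z \<in> torus_part" "L z $ j < 0" using that by (auto simp: V_def)
    have "exp (\<tau> * L z $ j) < 1" using z \<tau> by (simp add: mult_pos_neg)
    then have "norm (b j) * exp (\<tau> * L z $ j) \<le> norm (b j)" by (simp add: mult_left_le)
    then show ?thesis using b[of j] norm_c[OF z(1)] by simp
  qed
  have R_torus: "R \<psi> z \<in> torus_part \<longleftrightarrow> z \<in> torus_part" for \<psi> z
    by (simp add: R_def torus_part_def)
  have R_L: "L (R \<psi> z) = L z" for \<psi> z
    by (simp add: L_def log_norm_def R_def norm_mult)
  have R_V: "R \<psi> z \<in> V \<longleftrightarrow> z \<in> V" for \<psi> z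
    by (simp add: V_def R_torus R_L)
  have R_c: "c j (R \<psi> z) = c j z * cis (\<psi> $ j)" for j \<psi> z
  proof -
    \<comment> \<open>Real phases suffice although \<open>Ai\<close> need not be integral: only row
      monomials occur, and \<open>Ar ** Ai = mat 1\<close> makes the j-th one turn by exactly
      \<open>\<psi> $ j\<close>.\<close>
    have "real_vec (A $ j) \<bullet> (Ai *v \<psi>) = (Ar *v (Ai *v \<psi>)) $ j"
      by (simp add: matrix_vector_mult_def Ar_def real_vec_def inner_vec_def)
    also have "\<dots> = \<psi> $ j" by (simp add: matrix_vector_mul_assoc Ar_inverse)
    finally have "mono (A $ j) (R \<psi> z) = cis (\<psi> $ j) * mono (A $ j) z"
      unfolding R_def mono_rotate by simp
    then show ?thesis by (simp add: c_def norm_mult mult_ac)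
  qed
  have H_R: "H (R \<psi> z) = ennreal (W (L z)) * indicator V z * (\<Prod>j\<in>UNIV. ennreal (1 / (norm (1 - c j z * cis (\<psi> $ j)))\<^sup>2))" for \<psi> z
    unfolding H_def R_L R_c indicator_def R_V using W by (simp add: ennreal_mult' prod_ennreal)
  have rot: "(\<integral>\<^sup>+z. H (R \<psi> z) \<partial>lborel) = (\<integral>\<^sup>+z. H z \<partial>lborel)" for \<psi>
    unfolding R_def by (rule nn_integral_rotate_cart) measurable
  have q1: "(\<integral>\<^sup>+x. q x \<partial>lborel) = 1"
    by (simp add: q_def nn_integral_cmult ennreal_mult'[symmetric])
  \<comment> \<open>Insert a probability density on the phases, replace \<open>H\<close> by its
    rotated copies, which have the same integral, and exchange the integrations; the inner integral
    becomes a product of circle integrals.\<close>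
  have "(\<integral>\<^sup>+z. H z \<partial>lborel) = (\<integral>\<^sup>+z. H z \<partial>lborel) * (\<integral>\<^sup>+\<psi>. (\<Prod>j\<in>UNIV. q (\<psi> $ j)) \<partial>(lborel :: (real ^ 'n) measure))"
    by (subst nn_integral_lborel_cart_prod) (simp_all add: q1)
  also have "\<dots> = (\<integral>\<^sup>+\<psi>. (\<integral>\<^sup>+z. H z \<partial>lborel) * (\<Prod>j\<in>UNIV. q (\<psi> $ j)) \<partial>(lborel :: (real ^ 'n) measure))"
    by (rule nn_integral_cmult[symmetric]) measurable
  also have "\<dots> = (\<integral>\<^sup>+\<psi>. (\<integral>\<^sup>+z. H (R \<psi> z) * (\<Prod>j\<in>UNIV. q (\<psi> $ j)) \<partial>lborel) \<partial>lborel)"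
  proof (rule nn_integral_cong)
    fix \<psi> :: "real ^ 'n"
    have [measurable]: "R \<psi> \<in> borel_measurable borel" unfolding R_def by measurable
    show "(\<integral>\<^sup>+z. H z \<partial>lborel) * (\<Prod>j\<in>UNIV. q (\<psi> $ j)) = (\<integral>\<^sup>+z. H (R \<psi> z) * (\<Prod>j\<in>UNIV. q (\<psi> $ j)) \<partial>lborel)"
      by (subst nn_integral_multc) (simp_all add: rot)
  qed
  also have "\<dots> = (\<integral>\<^sup>+z. (\<integral>\<^sup>+\<psi>. H (R \<psi> z) * (\<Prod>j\<in>UNIV. q (\<psi> $ j)) \<partial>lborel) \<partial>lborel)"
    by (rule lborel_pair.Fubini'[symmetric]) (simp add: case_prod_beta)
  also have "\<dots> = (\<integral>\<^sup>+z. ennreal (W (L z) * (\<Prod>j\<in>UNIV. 1 / (1 - (norm (b j) * exp (\<tau> * L z $ j))\<^sup>2)))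
          * indicator V z \<partial>lborel)"
  proof (rule nn_integral_cong)
    fix z
    show "(\<integral>\<^sup>+\<psi>. H (R \<psi> z) * (\<Prod>j\<in>UNIV. q (\<psi> $ j)) \<partial>lborel) = ennreal (W (L z) * (\<Prod>j\<in>UNIV. 1 / (1 - (norm (b j) * exp (\<tau> * L z $ j))\<^sup>2)))
          * indicator V z"
    proof (cases "z \<in> V")
      case True
      then have zt: "z \<in> torus_part" by (simp add: V_def)
      have "(\<integral>\<^sup>+\<psi>. H (R \<psi> z) * (\<Prod>j\<in>UNIV. q (\<psi> $ j)) \<partial>lborel)
          = (\<integral>\<^sup>+\<psi>. ennreal (W (L z)) * (\<Prod>j\<in>UNIV. ennreal (1 / (norm (1 - c j z * cis (\<psi> $ j)))\<^sup>2) * q (\<psi> $ j)) \<partial>lborel)"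
        using True by (simp add: H_R prod.distrib mult.assoc)
      also have "\<dots> = ennreal (W (L z)) * (\<integral>\<^sup>+\<psi>. (\<Prod>j\<in>UNIV. ennreal (1 / (norm (1 - c j z * cis (\<psi> $ j)))\<^sup>2) * q (\<psi> $ j)) \<partial>lborel)"
        by (rule nn_integral_cmult) measurable
      also have "(\<integral>\<^sup>+\<psi>. (\<Prod>j\<in>UNIV. ennreal (1 / (norm (1 - c j z * cis (\<psi> $ j)))\<^sup>2) * q (\<psi> $ j)) \<partial>lborel)
          = (\<Prod>j\<in>UNIV. \<integral>\<^sup>+x. ennreal (1 / (norm (1 - c j z * cis x))\<^sup>2) * q x \<partial>lborel)"
        by (rule nn_integral_lborel_cart_prod) measurable
      also have "\<dots> = (\<Prod>j\<in>UNIV. ennreal (1 / (1 - (norm (c j z))\<^sup>2)))"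
      proof (rule prod.cong)
        fix j
        have "(\<integral>\<^sup>+x. ennreal (1 / (norm (1 - c j z * cis x))\<^sup>2) * q x \<partial>lborel)
           = (\<integral>\<^sup>+x. ennreal (1 / (2 * pi)) * (ennreal (1 / (norm (1 - c j z * cis x))\<^sup>2) * indicator {0..2 * pi} x) \<partial>lborel)"
          by (simp add: q_def mult_ac)
        also have "\<dots> = ennreal (1 / (2 * pi)) * (\<integral>\<^sup>+x. ennreal (1 / (norm (1 - c j z * cis x))\<^sup>2) * indicator {0..2 * pi} x \<partial>lborel)"
          by (rule nn_integral_cmult) measurable
        also have "\<dots> = ennreal (1 / (2 * pi)) * ennreal (2 * pi / (1 - (norm (c j z))\<^sup>2))"
          by (simp only: nn_integral_inverse_norm_sq_circle[OF c_lt[OF True]])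
        also have "\<dots> = ennreal (1 / (1 - (norm (c j z))\<^sup>2))"
          by (subst ennreal_mult'[symmetric]) simp_all
        finally show "(\<integral>\<^sup>+x. ennreal (1 / (norm (1 - c j z * cis x))\<^sup>2) * q x \<partial>lborel) = ennreal (1 / (1 - (norm (c j z))\<^sup>2))" .
      qed simp
      also have "\<dots> = ennreal (\<Prod>j\<in>UNIV. 1 / (1 - (norm (b j) * exp (\<tau> * L z $ j))\<^sup>2))"
      proof -
        have "0 \<le> 1 / (1 - (norm (c j z))\<^sup>2)" for j
          using c_lt[OF True, of j] by (simp add: power_le_one)
        then show ?thesis by (simp add: prod_ennreal norm_c[OF zt])
      qed
      finally show ?thesis using True W by (simp add: ennreal_mult')
    qed (simp add: H_R)
  qed
  finally show ?thesis unfolding H_def c_def .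
qed

text \<open>After averaging, the integrand depends on \<open>L z\<close> alone and splits into the
  integrals of \<open>radial_integral_bound\<close>, so \<open>C\<close> is \<open>C0\<close> times
  the product of their constants and independent of \<open>b\<close>. The case \<tau> = 1 serves
  integration over the first kernel variable, \<tau> = p - 1 over the second.\<close>

lemma kernel_integral_bound:
  assumes \<beta>: "\<And>j. 0 < beta p \<alpha> j" and \<sigma>: "0 < \<sigma>" "\<sigma> < 1" and \<tau>: "0 < \<tau>"
  obtains C :: real where "0 < C" "\<And>b :: 'n \<Rightarrow> complex. (\<And>j. norm (b j) < 1) \<Longrightarrow>
    (\<integral>\<^sup>+z. ennreal (norm (mono \<alpha> z) powr p * (\<Prod>j\<in>UNIV. (1 - norm (mono (A $ j) z)) powr (- \<sigma>))
       * (\<Prod>j\<in>UNIV. 1 / (norm (1 - b j * (mono (A $ j) z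
              * of_real (norm (mono (A $ j) z) powr (\<tau> - 1)))))\<^sup>2)) * indicator V z \<partial>lborel)
    \<le> ennreal (C * (\<Prod>j\<in>UNIV. (1 - norm (b j)) powr (- \<sigma>)))"
proof -
  define I where "I j r = (\<integral>\<^sup>+t. ennreal (exp (beta p \<alpha> j * t) * (1 - exp t) powr (- \<sigma>)
      / (1 - (r * exp (\<tau> * t))\<^sup>2)) * indicator {..<0} t \<partial>lborel)" for j r
  have "\<exists>C. 0 < C \<and> (\<forall>r. 0 \<le> r \<longrightarrow> r < 1 \<longrightarrow> I j r \<le> ennreal (C * (1 - r) powr (- \<sigma>)))" for j
  proof (rule radial_integral_bound[OF \<beta>[of j] \<sigma> \<tau>])
    fix C :: real
    assume "0 < C" and "\<And>r. 0 \<le> r \<Longrightarrow> r < 1 \<Longrightarrow>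
      (\<integral>\<^sup>+t. ennreal (exp (beta p \<alpha> j * t) * (1 - exp t) powr (- \<sigma>)
        / (1 - (r * exp (\<tau> * t))\<^sup>2)) * indicator {..<0} t \<partial>lborel) \<le> ennreal (C * (1 - r) powr (- \<sigma>))"
    then show ?thesis unfolding I_def by (intro exI conjI allI impI)
  qed
  then obtain D where D: "\<And>j. 0 < D j"
    "\<And>j r. 0 \<le> r \<Longrightarrow> r < 1 \<Longrightarrow> I j r \<le> ennreal (D j * (1 - r) powr (- \<sigma>))"
    by metis
  define C where "C = C0 * (\<Prod>j\<in>UNIV. D j)"
  have "0 < C" using C0_pos D(1) by (simp add: C_def prod_pos)
  moreover have "(\<integral>\<^sup>+z. ennreal (norm (mono \<alpha> z) powr p * (\<Prod>j\<in>UNIV. (1 - norm (mono (A $ j) z)) powr (- \<sigma>))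
       * (\<Prod>j\<in>UNIV. 1 / (norm (1 - b j * (mono (A $ j) z
              * of_real (norm (mono (A $ j) z) powr (\<tau> - 1)))))\<^sup>2)) * indicator V z \<partial>lborel)
    \<le> ennreal (C * (\<Prod>j\<in>UNIV. (1 - norm (b j)) powr (- \<sigma>)))" (is "?lhs \<le> _")
    if b: "\<And>j. norm (b j) < 1" for b :: "'n \<Rightarrow> complex"
  proof -
    define W :: "real ^ 'n \<Rightarrow> real" where
      "W t = (\<Prod>j\<in>UNIV. exp (p * row_exp (real_vec \<alpha>) $ j * t $ j)) * (\<Prod>j\<in>UNIV. (1 - exp (t $ j)) powr (- \<sigma>))" for t
    have [measurable]: "W \<in> borel_measurable borel" unfolding W_def by measurable
    have W0: "0 \<le> W t" for t by (simp add: W_def prod_nonneg)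
    define g where "g j t = ennreal (exp (p * row_exp (real_vec \<alpha>) $ j * t) * (1 - exp t) powr (- \<sigma>)
        * (1 / (1 - (norm (b j) * exp (\<tau> * t))\<^sup>2))) * indicator {..<0} t" for j t
    have [measurable]: "g j \<in> borel_measurable borel" for j unfolding g_def by measurable
    have "?lhs = (\<integral>\<^sup>+z. ennreal (W (L z) * (\<Prod>j\<in>UNIV. 1 / (norm (1 - b j * (mono (A $ j) z
              * of_real (norm (mono (A $ j) z) powr (\<tau> - 1)))))\<^sup>2)) * indicator V z \<partial>lborel)"
    proof (rule nn_integral_cong)
      fix z
      have "norm (mono \<alpha> z) powr p * (\<Prod>j\<in>UNIV. (1 - norm (mono (A $ j) z)) powr (- \<sigma>)) = W (L z)" if "z \<in> V"
      proof -
        have z: "z \<in> torus_part" using that by (simp add: V_def)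
        show ?thesis unfolding W_def norm_mono_powr[OF z] exp_L[OF z] ..
      qed
      then show "ennreal (norm (mono \<alpha> z) powr p * (\<Prod>j\<in>UNIV. (1 - norm (mono (A $ j) z)) powr (- \<sigma>))
       * (\<Prod>j\<in>UNIV. 1 / (norm (1 - b j * (mono (A $ j) z
              * of_real (norm (mono (A $ j) z) powr (\<tau> - 1)))))\<^sup>2)) * indicator V z
        = ennreal (W (L z) * (\<Prod>j\<in>UNIV. 1 / (norm (1 - b j * (mono (A $ j) z
              * of_real (norm (mono (A $ j) z) powr (\<tau> - 1)))))\<^sup>2)) * indicator V z"
        by (cases "z \<in> V") simp_all
    qed
    also have "\<dots> = (\<integral>\<^sup>+z. ennreal (W (L z) * (\<Prod>j\<in>UNIV. 1 / (1 - (norm (b j) * exp (\<tau> * L z $ j))\<^sup>2)))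
          * indicator V z \<partial>lborel)"
      by (rule nn_integral_kernel_average) (use W0 b \<tau> in auto)
    also have "\<dots> = (\<integral>\<^sup>+z. (\<Prod>j\<in>UNIV. g j (L z $ j)) * indicator torus_part z \<partial>lborel)"
    proof (rule nn_integral_cong)
      fix z
      show "ennreal (W (L z) * (\<Prod>j\<in>UNIV. 1 / (1 - (norm (b j) * exp (\<tau> * L z $ j))\<^sup>2)))
          * indicator V z = (\<Prod>j\<in>UNIV. g j (L z $ j)) * indicator torus_part z"
      proof (cases "z \<in> V")
        case True
        have p0: "0 \<le> 1 / (1 - (norm (b j) * exp (\<tau> * L z $ j))\<^sup>2)" for j
        proof -
          have "exp (\<tau> * L z $ j) \<le> 1" using True \<tau> by (simp add: V_def mult_pos_neg less_imp_le)
          then have "norm (b j) * exp (\<tau> * L z $ j) \<le> 1" using b[of j] by (simp add: mult_le_one)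
          then show ?thesis by (simp add: power_le_one)
        qed
        show ?thesis using True p0 unfolding W_def g_def
          by (simp add: V_def prod.distrib[symmetric] prod_ennreal)
      next
        case False
        then have "(\<Prod>j\<in>UNIV. g j (L z $ j)) * indicator torus_part z = 0"
          by (auto simp: V_def g_def indicator_eq_0_iff)
        then show ?thesis using False by simp
      qed
    qed
    also have "\<dots> = ennreal C0 * (\<Prod>j\<in>UNIV. \<integral>\<^sup>+x. g j x * ennreal (exp (2 * jac_exp $ j * x)) \<partial>lborel)"
      by (rule radial_product) measurable
    also have "\<dots> \<le> ennreal C0 * (\<Prod>j\<in>UNIV. ennreal (D j * (1 - norm (b j)) powr (- \<sigma>)))"
    proof (intro mult_left_mono prod_mono_ennreal)
      fix j
      have "g j x * ennreal (exp (2 * jac_exp $ j * x))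
          = ennreal (exp (beta p \<alpha> j * x) * (1 - exp x) powr (- \<sigma>) / (1 - (norm (b j) * exp (\<tau> * x))\<^sup>2)) * indicator {..<0} x" for x
      proof -
        have e: "exp (beta p \<alpha> j * x) = exp (2 * jac_exp $ j * x) * exp (p * row_exp (real_vec \<alpha>) $ j * x)"
          by (simp add: beta_def algebra_simps flip: exp_add)
        show ?thesis unfolding g_def e
          by (subst mult.commute) (simp add: mult.assoc[symmetric] ennreal_mult'[symmetric])
      qed
      then show "(\<integral>\<^sup>+x. g j x * ennreal (exp (2 * jac_exp $ j * x)) \<partial>lborel) \<le> ennreal (D j * (1 - norm (b j)) powr (- \<sigma>))"
        using D(2)[of "norm (b j)" j] b unfolding I_def by simp
    qed simp
    also have "\<dots> = ennreal (C * (\<Prod>j\<in>UNIV. (1 - norm (b j)) powr (- \<sigma>)))"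
      using less_imp_le[OF D(1)] C0_pos
      by (simp add: C_def prod_ennreal prod.distrib mult.assoc ennreal_mult' prod_nonneg)
    finally show ?thesis .
  qed
  ultimately show ?thesis by (rule that)
qed

end

subsection \<open>The exponents of integrable monomials\<close>

lemma mono_complex_differentiable:
  assumes "mono_defined \<alpha> z"
  shows "\<exists>D. (mono \<alpha> has_derivative D) (at z) \<and> (\<forall>c x. D (c *s x) = c * D x)"
proof -
  have "\<exists>d. ((\<lambda>w. (w $ k) powi (\<alpha> $ k)) has_derivative (\<lambda>h. d * h $ k)) (at z)" for k
  proof -
    have "\<alpha> $ k \<ge> 0 \<or> z $ k \<noteq> 0" using assms by (auto simp: mono_defined_def not_le)
    then have "((\<lambda>x. x powi (\<alpha> $ k)) has_field_derivative
        (of_int (\<alpha> $ k) * (z $ k) powi (\<alpha> $ k - 1) * 1)) (at (z $ k))"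
      by (intro DERIV_power_int DERIV_ident)
    then have "((\<lambda>x. x powi (\<alpha> $ k)) has_derivative
        (\<lambda>h. (of_int (\<alpha> $ k) * (z $ k) powi (\<alpha> $ k - 1)) * h)) (at (z $ k))"
      by (simp add: has_field_derivative_def)
    moreover have "((\<lambda>w. w $ k) has_derivative (\<lambda>h. h $ k)) (at z)"
      by (rule bounded_linear_imp_has_derivative) (rule bounded_linear_vec_nth)
    ultimately show ?thesis using has_derivative_compose by blast
  qed
  then obtain d where "\<And>k. ((\<lambda>w. (w $ k) powi (\<alpha> $ k)) has_derivative (\<lambda>h. d k * h $ k)) (at z)"
    by metis
  then have "((\<lambda>w. \<Prod>k\<in>UNIV. (w $ k) powi (\<alpha> $ k)) has_derivative
      (\<lambda>h. \<Sum>k\<in>UNIV. (d k * h $ k) * (\<Prod>i\<in>UNIV - {k}. (z $ i) powi (\<alpha> $ i)))) (at z)"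
    by (intro has_derivative_prod)
  moreover have "mono \<alpha> = (\<lambda>w. \<Prod>k\<in>UNIV. (w $ k) powi (\<alpha> $ k))" by (simp add: Defs.mono_def fun_eq_iff)
  ultimately show ?thesis
    by (intro exI[of _ "\<lambda>h. \<Sum>k\<in>UNIV. (d k * h $ k) * (\<Prod>i\<in>UNIV - {k}. (z $ i) powi (\<alpha> $ i))"])
      (simp add: sum_distrib_left mult_ac)
qed

lemma finite_vec_bounded: "finite {a :: int ^ 'n. \<forall>k. \<bar>a $ k\<bar> \<le> N}"
proof -
  have "{a :: int ^ 'n. \<forall>k. \<bar>a $ k\<bar> \<le> N} \<subseteq> vec_lambda ` (PiE UNIV (\<lambda>_. {- N..N}))"
  proof
    fix a :: "int ^ 'n" assume "a \<in> {a. \<forall>k. \<bar>a $ k\<bar> \<le> N}"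
    then have "(\<lambda>k. a $ k) \<in> PiE UNIV (\<lambda>_. {- N..N})" by (auto simp: abs_le_iff minus_le_iff)
    then show "a \<in> vec_lambda ` (PiE UNIV (\<lambda>_. {- N..N}))"
      by (rule rev_image_eqI) simp
  qed
  then show ?thesis by (rule finite_subset) (intro finite_imageI finite_PiE, auto)
qed

context monomial_map
begin

lemma row_exp_v_Ar: "row_exp v v* Ar = v"
  by (simp add: row_exp_def vector_matrix_mul_assoc Ar_inverse)

lemma nth_eq_sum_row_exp: "real_of_int (\<alpha> $ k) = (\<Sum>j\<in>UNIV. real_of_int (A $ j $ k) * row_exp (real_vec \<alpha>) $ j)"
proof -
  have "real_vec \<alpha> $ k = (row_exp (real_vec \<alpha>) v* Ar) $ k" by (simp add: row_exp_v_Ar)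
  then show ?thesis by (simp add: real_vec_def vector_matrix_mult_def Ar_def mult.commute)
qed

text \<open>In the coordinates \<open>row_exp\<close> this is translation by \<open>m\<close>.
  Integer coefficients make the descent from an exponent to its representative a shift as
  well.\<close>

definition shift :: "int ^ 'n \<Rightarrow> ('n \<Rightarrow> int) \<Rightarrow> int ^ 'n" where
  "shift a m = (\<chi> k. a $ k + (\<Sum>j\<in>UNIV. m j * A $ j $ k))"

lemma row_exp_shift: "row_exp (real_vec (shift a m)) $ j = row_exp (real_vec a) $ j + real_of_int (m j)"
proof -
  have "real_vec (shift a m) = real_vec a + (\<chi> j. real_of_int (m j)) v* Ar"
    by (simp add: vec_eq_iff real_vec_def shift_def vector_matrix_mult_def Ar_def mult.commute)
  then have "row_exp (real_vec (shift a m)) = row_exp (real_vec a) + ((\<chi> j. real_of_int (m j)) v* Ar) v* Ai"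
    by (simp add: row_exp_def vector_matrix_left_distrib)
  also have "((\<chi> j. real_of_int (m j)) v* Ar) v* Ai = (\<chi> j. real_of_int (m j))"
    by (simp add: vector_matrix_mul_assoc Ar_inverse)
  finally show ?thesis by simp
qed

lemma beta_shift: "beta p (shift a m) j = beta p a j + p * real_of_int (m j)"
  by (simp add: beta_def row_exp_shift algebra_simps)

lemma row_exp_inject: "row_exp (real_vec a) = row_exp (real_vec b) \<Longrightarrow> a = b"
proof -
  assume "row_exp (real_vec a) = row_exp (real_vec b)"
  then have "real_vec a = real_vec b" by (metis row_exp_v_Ar)
  then show "a = b" by (simp add: real_vec_def vec_eq_iff)
qed

lemma mono_shift:
  assumes z: "z \<in> torus_part"
  shows "mono (shift a (\<lambda>j. int (m j))) z = mono a z * (\<Prod>j\<in>UNIV. mono (A $ j) z ^ m j)"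
proof -
  have nz: "z $ k \<noteq> 0" for k using z by (simp add: torus_part_def)
  have sum: "x powi (\<Sum>j\<in>S. f j) = (\<Prod>j\<in>S. x powi f j)" if "x \<noteq> 0" "finite S"
    for x :: complex and f :: "'n \<Rightarrow> int" and S
    using that(2) by induction (simp_all add: power_int_add that(1))
  have "mono (shift a (\<lambda>j. int (m j))) z
      = (\<Prod>k\<in>UNIV. (z $ k) powi (a $ k) * (\<Prod>j\<in>UNIV. (z $ k) powi (int (m j) * A $ j $ k)))"
    unfolding Defs.mono_def shift_def by (simp add: power_int_add nz sum)
  also have "\<dots> = mono a z * (\<Prod>k\<in>UNIV. \<Prod>j\<in>UNIV. (z $ k) powi (int (m j) * A $ j $ k))"
    by (simp add: prod.distrib Defs.mono_def)
  also have "(\<Prod>k\<in>UNIV. \<Prod>j\<in>UNIV. (z $ k) powi (int (m j) * A $ j $ k))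
      = (\<Prod>j\<in>UNIV. \<Prod>k\<in>UNIV. (z $ k) powi (int (m j) * A $ j $ k))"
    by (rule prod.swap)
  also have "\<dots> = (\<Prod>j\<in>UNIV. mono (A $ j) z ^ m j)"
    unfolding Defs.mono_def prod_power_distrib
    by (intro prod.cong refl) (metis mult.commute power_int_mult power_int_of_nat)
  finally show ?thesis .
qed

end

section \<open>Bounded polyhedra: sign conditions and the exponent set\<close>

locale monomial_domain = monomial_map A for A :: "int ^ 'n ^ 'n" +
  fixes U :: "(complex ^ 'n) set" and p :: real
  assumes p_gt_1: "1 < p" and open_U: "open U" and bounded_U: "bounded U"
    and U_eq: "U = {z. \<forall>j. mono_defined (A $ j) z \<and> norm (mono (A $ j) z) < 1}"
begin

lemma U_inter_torus: "z \<in> torus_part \<Longrightarrow> z \<in> U \<longleftrightarrow> z \<in> V"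
  by (auto simp: U_eq V_alt mono_defined_def torus_part_def)

lemma V_subset_U: "V \<subseteq> U"
  using U_inter_torus by (auto simp: V_def)

lemma AE_U_V: "AE z in lebesgue_on U. z \<in> V"
proof -
  have "AE z in lebesgue. z \<in> (torus_part :: (complex ^ 'n) set)"
    using AE_cart_nonzero by (intro AE_completion) (simp add: torus_part_def)
  then have "AE z in lebesgue. z \<in> U \<longrightarrow> z \<in> V"
    by eventually_elim (simp add: U_inter_torus)
  then show ?thesis
    using open_U by (subst AE_restrict_space_iff) auto
qed

lemma nn_integral_U:
  assumes [measurable]: "F \<in> borel_measurable borel"
  shows "(\<integral>\<^sup>+z. F z \<partial>lebesgue_on U) = (\<integral>\<^sup>+z. F z * indicator V z \<partial>lborel)"
proof -
  have U: "U \<in> sets lebesgue" using open_U by simp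
  have "(\<integral>\<^sup>+z. F z \<partial>lebesgue_on U) = (\<integral>\<^sup>+z. F z * indicator U z \<partial>lborel)"
    using U by (simp add: nn_integral_restrict_space nn_integral_completion)
  also have "\<dots> = (\<integral>\<^sup>+z. F z * indicator V z \<partial>lborel)"
  proof (rule nn_integral_cong_AE)
    show "AE z in lborel. F z * indicator U z = F z * indicator V z"
      using AE_cart_nonzero
      by eventually_elim (use U_inter_torus in \<open>auto simp: torus_part_def indicator_def\<close>)
  qed
  finally show ?thesis .
qed

text \<open>Boundedness of \<open>U\<close> in logarithmic form: were the entry negative, sending
  the j-th coordinate of \<open>L z\<close> to minus infinity, with the others kept at -1, would
  stay in \<open>V\<close> and make \<open>|z $ k|\<close> arbitrarily large.\<close>

lemma Ai_nonneg: "0 \<le> Ai $ k $ j"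
proof (rule ccontr)
  assume "\<not> 0 \<le> Ai $ k $ j"
  define a where "a = - Ai $ k $ j"
  have a: "0 < a" using \<open>\<not> 0 \<le> Ai $ k $ j\<close> by (simp add: a_def)
  obtain R where R: "0 < R" "\<And>z. z \<in> U \<Longrightarrow> norm z \<le> R"
    using bounded_U by (meson bounded_pos)
  define S where "S = (\<Sum>i\<in>UNIV - {j}. Ai $ k $ i)"
  \<comment> \<open>Chosen such that \<open>a * M\<close> exceeds \<open>|S| + |ln R|\<close> by 1;
    then \<open>(Ai *v t) $ k = a * M - S\<close> exceeds \<open>ln R\<close>.\<close>
  define M where "M = (\<bar>S\<bar> + \<bar>ln R\<bar> + 1) / a"
  have M: "0 < M" using a by (simp add: M_def add_nonneg_pos)
  define t :: "real ^ 'n" where "t = (\<chi> i. if i = j then - M else - 1)"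
  define z :: "complex ^ 'n" where "z = (\<chi> i. of_real (exp ((Ai *v t) $ i)))"
  have "log_norm z = Ai *v t" by (simp add: log_norm_def z_def vec_eq_iff)
  then have "L z = t" by (simp add: L_def matrix_vector_mul_assoc Ar_inverse)
  then have "z \<in> V" using M by (simp add: V_def torus_part_def z_def t_def)
  then have "norm z \<le> R" using R V_subset_U by blast
  moreover have "norm (z $ k) \<le> norm z" by (rule Finite_Cartesian_Product.norm_nth_le)
  ultimately have le: "exp ((Ai *v t) $ k) \<le> R" by (simp add: z_def)
  have "(Ai *v t) $ k = (\<Sum>i\<in>UNIV. Ai $ k $ i * t $ i)" by (simp add: matrix_vector_mult_def)
  also have "\<dots> = Ai $ k $ j * t $ j + (\<Sum>i\<in>UNIV - {j}. Ai $ k $ i * t $ i)"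
    by (rule sum.remove) auto
  also have "(\<Sum>i\<in>UNIV - {j}. Ai $ k $ i * t $ i) = (\<Sum>i\<in>UNIV - {j}. - Ai $ k $ i)"
    by (intro sum.cong) (auto simp: t_def)
  also have "\<dots> = - S" by (simp add: S_def sum_negf)
  also have "Ai $ k $ j * t $ j = a * M" by (simp add: a_def t_def)
  also have "a * M = \<bar>S\<bar> + \<bar>ln R\<bar> + 1" using a by (simp add: M_def)
  finally have "ln R < (Ai *v t) $ k" by linarith
  then have "R < exp ((Ai *v t) $ k)" using R(1) by (metis exp_less_cancel_iff exp_ln)
  with le show False by simp
qed

text \<open>These are exactly the coordinates in which definedness on all of \<open>U\<close>
  restricts an exponent: \<open>\<alpha> $ k\<close> must be nonnegative there.\<close>

definition zero_coords :: "'n set" where "zero_coords = {k. \<exists>z\<in>U. z $ k = 0}"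

lemma zero_coords_nonneg: "k \<in> zero_coords \<Longrightarrow> 0 \<le> A $ j $ k"
proof (rule ccontr)
  assume k: "k \<in> zero_coords" and n: "\<not> 0 \<le> A $ j $ k"
  obtain z where "z \<in> U" "z $ k = 0" using k by (auto simp: zero_coords_def)
  then have "mono_defined (A $ j) z" by (simp add: U_eq)
  then show False using n \<open>z $ k = 0\<close> by (simp add: mono_defined_def not_le)
qed

lemma Ai_Ar_entry: "(\<Sum>j\<in>UNIV. Ai $ i $ j * real_of_int (A $ j $ k)) = (if i = k then 1 else 0)"
proof -
  have "(Ai ** Ar) $ i $ k = (mat 1 :: real ^ 'n ^ 'n) $ i $ k" by (simp add: Ar_inverse)
  then show ?thesis by (simp add: matrix_matrix_mult_def mat_def Ar_def)
qed

lemma Ar_Ai_entry: "(\<Sum>k\<in>UNIV. real_of_int (A $ j $ k) * Ai $ k $ i) = (if j = i then 1 else 0)"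
proof -
  have "(Ar ** Ai) $ j $ i = (mat 1 :: real ^ 'n ^ 'n) $ j $ i" by (simp add: Ar_inverse)
  then show ?thesis by (simp add: matrix_matrix_mult_def mat_def Ar_def)
qed

text \<open>Since \<open>Ai\<close> is nonnegative, a nonnegative column of \<open>A\<close> spans an extreme ray of the
  cone generated by the columns of \<open>Ai\<close>.\<close>
lemma zero_coords_unique:
  assumes k: "k \<in> zero_coords" and j: "A $ j $ k \<noteq> 0" and j': "A $ j' $ k \<noteq> 0"
  shows "j = j'"
proof (rule ccontr)
  assume ne: "j \<noteq> j'"
  \<comment> \<open>An off-diagonal entry of \<open>Ai ** Ar\<close> in column \<open>k\<close> is a
    sum of nonnegative terms equal to 0, so each term vanishes.\<close>
  have zero: "Ai $ i $ l = 0" if "i \<noteq> k" "A $ l $ k \<noteq> 0" for i l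
  proof -
    have "(\<Sum>j\<in>UNIV. Ai $ i $ j * real_of_int (A $ j $ k)) = 0" using that Ai_Ar_entry[of i k] by simp
    then have "Ai $ i $ l * real_of_int (A $ l $ k) = 0"
      by (subst (asm) sum_nonneg_eq_0_iff) (auto simp: Ai_nonneg zero_coords_nonneg[OF k])
    then show ?thesis using that by simp
  qed
  \<comment> \<open>By \<open>zero\<close>, column \<open>j'\<close> of \<open>Ai\<close> can be
    nonzero only in row \<open>k\<close>. The entry of \<open>Ar ** Ai\<close> at
    \<open>(j, j')\<close> then kills this last entry too, contradicting the diagonal entry 1 at
    \<open>(j', j')\<close>.\<close>
  have entry: "(\<Sum>i\<in>UNIV. real_of_int (A $ l $ i) * Ai $ i $ j') = real_of_int (A $ l $ k) * Ai $ k $ j'" for l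
  proof -
    have "(\<Sum>i\<in>UNIV. real_of_int (A $ l $ i) * Ai $ i $ j')
        = (\<Sum>i\<in>UNIV. if i = k then real_of_int (A $ l $ k) * Ai $ k $ j' else 0)"
      by (intro sum.cong) (auto simp: zero[OF _ j'])
    then show ?thesis by simp
  qed
  have "real_of_int (A $ j $ k) * Ai $ k $ j' = 0" using entry[of j] Ar_Ai_entry[of j j'] ne by simp
  then have "Ai $ k $ j' = 0" using j by simp
  then show False using entry[of j'] Ar_Ai_entry[of j' j'] by simp
qed

text \<open>Column \<open>k\<close> of \<open>A\<close> has a single nonzero entry, so one summand
  of \<open>nth_eq_sum_row_exp\<close> survives. As that entry is positive, the sign condition on
  \<open>\<alpha> $ k\<close> becomes one on the j-th coordinate of \<open>row_exp\<close>.\<close>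

lemma zero_coords_exponent:
  assumes k: "k \<in> zero_coords" and j: "A $ j $ k \<noteq> 0"
  shows "real_of_int (\<alpha> $ k) = real_of_int (A $ j $ k) * row_exp (real_vec \<alpha>) $ j"
proof -
  have "(\<Sum>i\<in>UNIV. real_of_int (A $ i $ k) * row_exp (real_vec \<alpha>) $ i)
      = (\<Sum>i\<in>UNIV. if i = j then real_of_int (A $ j $ k) * row_exp (real_vec \<alpha>) $ j else 0)"
    by (intro sum.cong) (use zero_coords_unique[OF k _ j] in auto)
  then show ?thesis using nth_eq_sum_row_exp[of \<alpha> k] by simp
qed

text \<open>For \<open>p < 2\<close> a negative power of \<open>z $ k\<close> can be \<open>p\<close>-integrable although it is undefined on
  \<open>z $ k = 0\<close>; the second condition excludes this. By the preceding lemmas it involves one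
  coordinate of \<open>row_exp (real_vec \<alpha>)\<close> only, so membership in \<open>Sp\<close> decouples.\<close>
definition admissible :: "'n \<Rightarrow> real \<Rightarrow> bool" where
  "admissible j c \<longleftrightarrow> 0 < p * c + 2 * jac_exp $ j \<and> (\<forall>k\<in>zero_coords. A $ j $ k \<noteq> 0 \<longrightarrow> 0 \<le> c)"

text \<open>Upward closure makes \<open>Sp\<close> stable under nonnegative shifts and gives sense
  to minimal representatives.\<close>

lemma admissible_mono: "admissible j c \<Longrightarrow> c \<le> c' \<Longrightarrow> admissible j c'"
proof -
  assume a: "admissible j c" and le: "c \<le> c'"
  have "p * c \<le> p * c'" using le p_gt_1 by (intro mult_left_mono) auto
  then have "0 < p * c' + 2 * jac_exp $ j" using a by (simp add: admissible_def)
  moreover have "\<forall>k\<in>zero_coords. A $ j $ k \<noteq> 0 \<longrightarrow> 0 \<le> c'"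
    using a le order_trans unfolding admissible_def by blast
  ultimately show ?thesis by (simp add: admissible_def)
qed

lemma Lp_normp_mono: "Lp_normp p U (mono \<alpha>) = (\<integral>\<^sup>+z. ennreal (norm (mono \<alpha> z) powr p) * indicator V z \<partial>lborel)"
  unfolding Lp_normp_def by (rule nn_integral_U) measurable

text \<open>A finite norm amounts to positivity of all \<open>beta p \<alpha> j\<close>; definedness
  on \<open>U\<close> adds the sign conditions through \<open>zero_coords_exponent\<close>.\<close>

lemma Sp_iff: "\<alpha> \<in> Sp p U \<longleftrightarrow> (\<forall>j. admissible j (row_exp (real_vec \<alpha>) $ j))"
proof
  assume \<alpha>: "\<alpha> \<in> Sp p U"
  then have "Lp_normp p U (mono \<alpha>) < \<infinity>" by (simp add: Sp_def bergman_def in_Lp_def)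
  then have b: "0 < beta p \<alpha> j" for j unfolding Lp_normp_mono by (rule beta_pos_of_finite)
  have "0 \<le> row_exp (real_vec \<alpha>) $ j" if k: "k \<in> zero_coords" "A $ j $ k \<noteq> 0" for j k
  proof -
    obtain z where z: "z \<in> U" "z $ k = 0" using k(1) by (auto simp: zero_coords_def)
    then have "mono_defined \<alpha> z" using \<alpha> by (simp add: Sp_def)
    then have "0 \<le> \<alpha> $ k" using z(2) by (meson mono_defined_def not_less)
    then have "0 \<le> real_of_int (A $ j $ k) * row_exp (real_vec \<alpha>) $ j"
      using zero_coords_exponent[OF k, of \<alpha>] by (metis of_int_0_le_iff)
    moreover have "0 < A $ j $ k" using zero_coords_nonneg[OF k(1), of j] k(2) by simp
    ultimately show ?thesis by (simp add: zero_le_mult_iff)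
  qed
  then show "\<forall>j. admissible j (row_exp (real_vec \<alpha>) $ j)"
    using b by (auto simp: admissible_def beta_def)
next
  assume adm: "\<forall>j. admissible j (row_exp (real_vec \<alpha>) $ j)"
  have b: "0 < beta p \<alpha> j" for j using adm by (auto simp: admissible_def beta_def)
  have def: "mono_defined \<alpha> z" if z: "z \<in> U" for z
  proof (rule ccontr)
    assume "\<not> mono_defined \<alpha> z"
    then obtain k where k: "\<alpha> $ k < 0" "z $ k = 0" by (auto simp: mono_defined_def)
    then have kz: "k \<in> zero_coords" using z by (auto simp: zero_coords_def)
    \<comment> \<open>Column \<open>k\<close> of \<open>A\<close> cannot vanish, because the
      diagonal entry of \<open>Ai ** Ar\<close> is 1.\<close>
    obtain j where j: "A $ j $ k \<noteq> 0"
    proof (rule ccontr)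
      assume "\<not> thesis"
      with that have "A $ j $ k = 0" for j by blast
      then show False using Ai_Ar_entry[of k k] by simp
    qed
    have "0 \<le> row_exp (real_vec \<alpha>) $ j" using adm kz j by (auto simp: admissible_def)
    then have "0 \<le> real_of_int (\<alpha> $ k)"
      using zero_coords_exponent[OF kz j, of \<alpha>] zero_coords_nonneg[OF kz, of j] by simp
    then show False using k by simp
  qed
  have "mono \<alpha> \<in> borel_measurable borel" by measurable
  then have "mono \<alpha> \<in> borel_measurable (lebesgue_on U)"
    by (intro measurable_restrict_space1 measurable_completion) simp
  moreover have "Lp_normp p U (mono \<alpha>) < \<infinity>"
    unfolding Lp_normp_mono by (simp add: nn_integral_mono_powr_pos[OF b])
  moreover have "holo_on U (mono \<alpha>)"
    unfolding holo_on_def using mono_complex_differentiable def by blast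
  ultimately show "\<alpha> \<in> Sp p U" using def by (simp add: Sp_def bergman_def in_Lp_def)
qed

text \<open>Representatives of \<open>Sp\<close> modulo the lattice generated by the rows of \<open>A\<close>, minimal in every
  row direction.\<close>
definition base_exponents :: "(int ^ 'n) set" where
  "base_exponents = {a. \<forall>j. admissible j (row_exp (real_vec a) $ j) \<and> \<not> admissible j (row_exp (real_vec a) $ j - 1)}"

lemma beta_base_pos: "a \<in> base_exponents \<Longrightarrow> 0 < beta p a j"
  by (auto simp: base_exponents_def admissible_def beta_def)

text \<open>Admissibility bounds each coordinate of \<open>row_exp\<close> from below, and its
  failure one unit lower bounds it from above; the transpose of \<open>A\<close> carries this to a
  bound on the integer vector.\<close>

lemma finite_base_exponents: "finite base_exponents"
proof -
  define K where "K j = \<bar>2 * jac_exp $ j / p\<bar> + 1" for j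
  define N where "N = (\<Sum>k\<in>UNIV. \<Sum>j\<in>UNIV. \<bar>real_of_int (A $ j $ k)\<bar> * K j)"
  have K0: "0 \<le> K j" for j by (simp add: K_def)
  have "\<bar>a $ k\<bar> \<le> \<lceil>N\<rceil>" if a: "a \<in> base_exponents" for a :: "int ^ 'n" and k
  proof -
    have c: "\<bar>row_exp (real_vec a) $ j\<bar> \<le> K j" for j
    proof -
      let ?c = "row_exp (real_vec a) $ j"
      have "admissible j ?c" "\<not> admissible j (?c - 1)" using a by (auto simp: base_exponents_def)
      then have "0 < p * ?c + 2 * jac_exp $ j" "p * (?c - 1) + 2 * jac_exp $ j \<le> 0 \<or> ?c - 1 < 0"
        by (auto simp: admissible_def not_less)
      then have "- (2 * jac_exp $ j / p) < ?c" "?c \<le> 1 - 2 * jac_exp $ j / p \<or> ?c < 1"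
        using p_gt_1 by (auto simp: field_simps)
      then show ?thesis unfolding K_def by linarith
    qed
    have "\<bar>real_of_int (a $ k)\<bar> \<le> (\<Sum>j\<in>UNIV. \<bar>real_of_int (A $ j $ k) * row_exp (real_vec a) $ j\<bar>)"
      by (subst nth_eq_sum_row_exp) (rule sum_abs)
    also have "\<dots> \<le> (\<Sum>j\<in>UNIV. \<bar>real_of_int (A $ j $ k)\<bar> * K j)"
      by (intro sum_mono) (simp add: abs_mult mult_left_mono c)
    also have "\<dots> \<le> N"
      unfolding N_def by (rule member_le_sum[of k UNIV "\<lambda>k. \<Sum>j\<in>UNIV. \<bar>real_of_int (A $ j $ k)\<bar> * K j"])
        (auto intro!: sum_nonneg simp: K0)
    finally have "real_of_int \<bar>a $ k\<bar> \<le> N" by simp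
    then show ?thesis by linarith
  qed
  then have "base_exponents \<subseteq> {a. \<forall>k. \<bar>a $ k\<bar> \<le> \<lceil>N\<rceil>}" by blast
  then show ?thesis using finite_vec_bounded by (rule finite_subset)
qed

text \<open>A shift moves the j-th coordinate of \<open>row_exp\<close> by \<open>m j\<close> alone,
  so each direction can be lowered independently until one more unit step would violate
  \<open>admissible\<close>.\<close>

lemma Sp_eq_shifts: "Sp p U = (\<Union>a\<in>base_exponents. (\<lambda>m. shift a (\<lambda>j. int (m j))) ` UNIV)"
proof (intro set_eqI iffI)
  fix \<alpha> assume "\<alpha> \<in> Sp p U"
  then have adm: "admissible j (row_exp (real_vec \<alpha>) $ j)" for j by (simp add: Sp_iff)
  have "\<exists>n::nat. admissible j (row_exp (real_vec \<alpha>) $ j - real n) \<and> \<not> admissible j (row_exp (real_vec \<alpha>) $ j - real n - 1)" for j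
  proof -
    let ?Q = "\<lambda>n::nat. \<not> admissible j (row_exp (real_vec \<alpha>) $ j - real n - 1)"
    obtain n :: nat where n: "row_exp (real_vec \<alpha>) $ j + 2 * jac_exp $ j / p \<le> real n" using real_arch_simple by blast
    have "p * (row_exp (real_vec \<alpha>) $ j - real n - 1) \<le> p * (- (2 * jac_exp $ j / p))"
      using n p_gt_1 by (intro mult_left_mono) auto
    then have "?Q n" using p_gt_1 by (auto simp: admissible_def)
    \<comment> \<open>At the least \<open>n\<close> the next step fails, while the step leading to
      \<open>n\<close> did not, so \<open>n\<close> itself is still admissible; for n = 0 this is
      the assumption on \<open>\<alpha>\<close>.\<close>
    then have Q: "?Q (LEAST n. ?Q n)" by (rule LeastI)
    have "admissible j (row_exp (real_vec \<alpha>) $ j - real (LEAST n. ?Q n))"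
    proof (cases "LEAST n. ?Q n")
      case (Suc i)
      then have "\<not> ?Q i" by (metis lessI not_less_Least)
      then show ?thesis unfolding Suc by (simp add: algebra_simps)
    qed (simp add: adm)
    with Q show ?thesis by blast
  qed
  then obtain m :: "'n \<Rightarrow> nat" where m: "\<And>j. admissible j (row_exp (real_vec \<alpha>) $ j - real (m j))"
      "\<And>j. \<not> admissible j (row_exp (real_vec \<alpha>) $ j - real (m j) - 1)" by metis
  define a where "a = shift \<alpha> (\<lambda>j. - int (m j))"
  have "a \<in> base_exponents" using m by (simp add: base_exponents_def a_def row_exp_shift)
  moreover have "\<alpha> = shift a (\<lambda>j. int (m j))"
    by (rule row_exp_inject) (simp add: vec_eq_iff row_exp_shift a_def)
  ultimately show "\<alpha> \<in> (\<Union>a\<in>base_exponents. (\<lambda>m. shift a (\<lambda>j. int (m j))) ` UNIV)" by blast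
next
  fix \<alpha> assume "\<alpha> \<in> (\<Union>a\<in>base_exponents. (\<lambda>m. shift a (\<lambda>j. int (m j))) ` UNIV)"
  then obtain a m where a: "a \<in> base_exponents" and \<alpha>: "\<alpha> = shift a (\<lambda>j. int (m j))" by blast
  have "admissible j (row_exp (real_vec \<alpha>) $ j)" for j
    using a by (auto simp: \<alpha> row_exp_shift base_exponents_def intro: admissible_mono)
  then show "\<alpha> \<in> Sp p U" by (simp add: Sp_iff)
qed

text \<open>If the multiplicities differed, the representative with the larger one would lie at
  least one unit below the other, and the latter could be lowered without losing
  admissibility.\<close>

lemma shift_unique:
  assumes a: "a \<in> base_exponents" and a': "a' \<in> base_exponents"
    and eq: "shift a (\<lambda>j. int (m j)) = shift a' (\<lambda>j. int (m' j))"
  shows "a = a'" "m = m'"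
proof -
  have e: "row_exp (real_vec a) $ j + real (m j) = row_exp (real_vec a') $ j + real (m' j)" for j
    using arg_cong[OF eq, of "\<lambda>\<alpha>. row_exp (real_vec \<alpha>) $ j"] by (simp add: row_exp_shift)
  have le: "m2 \<le> m1" if "b \<in> base_exponents" "b' \<in> base_exponents"
    "row_exp (real_vec b) $ j + real m1 = row_exp (real_vec b') $ j + real m2" for b b' m1 m2 j
  proof (rule ccontr)
    assume "\<not> m2 \<le> m1"
    then have "real m1 + 1 \<le> real m2" by linarith
    then have "row_exp (real_vec b') $ j \<le> row_exp (real_vec b) $ j - 1" using that(3) by linarith
    moreover have "admissible j (row_exp (real_vec b') $ j)" using that(2) by (simp add: base_exponents_def)
    ultimately have "admissible j (row_exp (real_vec b) $ j - 1)" by (rule admissible_mono[rotated])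
    then show False using that(1) by (simp add: base_exponents_def)
  qed
  have "m j = m' j" for j
    using le[OF a a' e] le[OF a' a e[symmetric]] by (rule antisym[rotated])
  then show m: "m = m'" by (rule ext)
  have "row_exp (real_vec a) = row_exp (real_vec a')" using e m by (simp add: vec_eq_iff)
  then show "a = a'" by (rule row_exp_inject)
qed

end

subsection \<open>Closed form of the kernel\<close>

text \<open>Summability is read off from a value: \<open>infsum\<close> is 0 on a family that is not
  summable, but the product formula for the norms gives a product of positive sums. The condition on
  \<open>g j 0\<close> ensures this positivity.\<close>

lemma has_sum_prod_UNIV:
  fixes g :: "'n::finite \<Rightarrow> nat \<Rightarrow> complex"
  assumes s: "\<And>j. (\<lambda>m. norm (g j m)) summable_on UNIV" and nz: "\<And>j. g j 0 \<noteq> 0"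
  shows "((\<lambda>m. \<Prod>j\<in>UNIV. g j (m j)) has_sum (\<Prod>j\<in>UNIV. infsum (g j) UNIV)) UNIV"
proof -
  have U: "PiE UNIV (\<lambda>_. UNIV) = (UNIV :: ('n \<Rightarrow> nat) set)" by (simp add: PiE_UNIV_domain)
  have "infsum (\<lambda>m. \<Prod>j\<in>UNIV. norm (g j (m j))) (PiE UNIV (\<lambda>_. UNIV)) = (\<Prod>j\<in>UNIV. infsum (\<lambda>m. norm (g j m)) UNIV)"
    by (rule infsum_prod_PiE_abs) (use s in simp_all)
  moreover have "0 < infsum (\<lambda>m. norm (g j m)) UNIV" for j
  proof -
    have "infsum (\<lambda>m. norm (g j m)) {0} \<le> infsum (\<lambda>m. norm (g j m)) UNIV"
      by (rule infsum_mono_neutral) (use s in auto)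
    then show ?thesis using nz[of j] by (simp add: order_less_le_trans[rotated])
  qed
  ultimately have "infsum (\<lambda>m. \<Prod>j\<in>UNIV. norm (g j (m j))) UNIV \<noteq> 0"
    unfolding U by (simp add: less_imp_neq[symmetric])
  then have "(\<lambda>m. \<Prod>j\<in>UNIV. norm (g j (m j))) summable_on UNIV" using infsum_not_exists by blast
  then have "(\<lambda>m. norm (\<Prod>j\<in>UNIV. g j (m j))) summable_on UNIV" by (simp add: prod_norm)
  then have "(\<lambda>m. \<Prod>j\<in>UNIV. g j (m j)) summable_on UNIV" by (rule abs_summable_summable)
  moreover have "infsum (\<lambda>m. \<Prod>j\<in>UNIV. g j (m j)) (PiE UNIV (\<lambda>_. UNIV)) = (\<Prod>j\<in>UNIV. infsum (g j) UNIV)"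
    by (rule infsum_prod_PiE_abs) (use s in simp_all)
  ultimately show ?thesis unfolding U by (metis has_sum_infsum)
qed

text \<open>For s \<ge> 1 because \<open>y powr s \<le> y\<close>, for s < 1 by the weighted mean
  inequality for y and 1. The column estimate uses it to compare \<open>1 - |x| powr (p - 1)\<close>
  with \<open>1 - |x|\<close>.\<close>

lemma one_minus_powr_ge:
  fixes y s :: real
  assumes y: "0 \<le> y" "y < 1" and s: "0 < s"
  shows "min 1 s * (1 - y) \<le> 1 - y powr s"
proof (cases "y = 0 \<or> s \<ge> 1")
  case True
  show ?thesis
  proof (cases "y = 0")
    case False
    then have "y powr s \<le> y powr 1" using True y by (intro powr_mono') auto
    then show ?thesis using True y False by (simp add: min_def)
  qed (use s in simp)
next
  case False
  then have "y powr s * 1 powr (1 - s) \<le> s * y + (1 - s) * 1"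
    using y s by (intro Youngs_inequality_0) auto
  then show ?thesis using False by (simp add: min_def algebra_simps)
qed

lemma borel_measurable_cnj [measurable (raw)]:
  assumes "f \<in> borel_measurable M"
  shows "(\<lambda>x. cnj (f x)) \<in> borel_measurable M"
  by (rule measurable_compose[OF assms])
    (intro borel_measurable_continuous_onI continuous_intros)

context monomial_domain
begin

lemma mono_nonzero_V: "z \<in> V \<Longrightarrow> mono \<alpha> z \<noteq> 0"
  by (rule mono_nonzero) (simp add: V_def)

text \<open>On the torus, adding the j-th row of \<open>A\<close> to an exponent multiplies the
  numerator of its kernel term by this number, the X of the one-variable series.\<close>

definition kvar :: "complex ^ 'n \<Rightarrow> complex ^ 'n \<Rightarrow> 'n \<Rightarrow> complex" where
  "kvar z w j = mono (A $ j) z * cnj (mono (A $ j) w) * of_real (norm (mono (A $ j) w) powr (p - 2))"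

text \<open>This finite expression is visibly Borel in both variables on the whole space, and it is
  shown to agree with \<open>mbk\<close> on \<open>V\<close>.\<close>

definition mbk_closed :: "complex ^ 'n \<Rightarrow> complex ^ 'n \<Rightarrow> complex" where
  "mbk_closed z w = (\<Sum>a\<in>base_exponents.
      mono a z * cnj (mono a w) * of_real (norm (mono a w) powr (p - 2)) / of_real C0
      * (\<Prod>j\<in>UNIV. (of_real (beta p a j) + of_real (p - beta p a j) * kvar z w j) / (1 - kvar z w j)\<^sup>2))"

lemma norm_kvar:
  assumes "w \<in> V"
  shows "norm (kvar z w j) = norm (mono (A $ j) z) * norm (mono (A $ j) w) powr (p - 1)"
proof -
  have "norm (mono (A $ j) w) > 0" using mono_nonzero_V[OF assms] by simp
  then have "norm (mono (A $ j) w) * norm (mono (A $ j) w) powr (p - 2) = norm (mono (A $ j) w) powr (p - 1)"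
    by (simp add: powr_mult_base)
  then show ?thesis by (simp add: kvar_def norm_mult mult.assoc)
qed

lemma norm_kvar_less_1:
  assumes "z \<in> V" "w \<in> V"
  shows "norm (kvar z w j) < 1"
proof -
  have "norm (mono (A $ j) z) < 1" "norm (mono (A $ j) w) < 1" using assms by (auto simp: V_alt)
  moreover have "norm (mono (A $ j) w) powr (p - 1) \<le> 1"
    using p_gt_1 calculation(2) by (intro powr_le1) auto
  ultimately show ?thesis unfolding norm_kvar[OF assms(2)]
    by (meson le_less_trans mult_left_le norm_ge_zero)
qed

text \<open>The norm in the denominator is \<open>C0\<close> over the product of the numbers
  \<open>beta p a j + p * m j\<close>, so its reciprocal supplies the weights of the series and the
  row monomials supply the powers of \<open>kvar\<close>.\<close>

lemma kernel_term_shift: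
  assumes z: "z \<in> V" and w: "w \<in> V" and a: "a \<in> base_exponents"
  defines "\<alpha> m \<equiv> shift a (\<lambda>j. int (m j))"
  shows "mono (\<alpha> m) z * cnj (mono (\<alpha> m) w) * of_real (norm (mono (\<alpha> m) w) powr (p - 2))
        / of_real (enn2real (Lp_normp p U (mono (\<alpha> m))))
    = mono a z * cnj (mono a w) * of_real (norm (mono a w) powr (p - 2)) / of_real C0
      * (\<Prod>j\<in>UNIV. of_real (beta p a j + p * real (m j)) * kvar z w j ^ m j)"
proof -
  have zt: "z \<in> torus_part" and wt: "w \<in> torus_part" using z w by (auto simp: V_def)
  have b: "0 < beta p (\<alpha> m) j" for j
    using beta_base_pos[OF a, of j] p_gt_1 by (simp add: \<alpha>_def beta_shift add_pos_nonneg)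
  have "enn2real (Lp_normp p U (mono (\<alpha> m))) = C0 / (\<Prod>j\<in>UNIV. beta p (\<alpha> m) j)"
    using C0_pos less_imp_le[OF b]
    by (simp add: Lp_normp_mono nn_integral_mono_powr_pos[OF b] prod_nonneg)
  then have L: "of_real (enn2real (Lp_normp p U (mono (\<alpha> m))))
      = complex_of_real C0 / (\<Prod>j\<in>UNIV. of_real (beta p a j + p * real (m j)))"
    by (simp add: \<alpha>_def beta_shift)
  have mz: "mono (\<alpha> m) z = mono a z * (\<Prod>j\<in>UNIV. mono (A $ j) z ^ m j)"
    and mw: "mono (\<alpha> m) w = mono a w * (\<Prod>j\<in>UNIV. mono (A $ j) w ^ m j)"
    unfolding \<alpha>_def by (rule mono_shift[OF zt], rule mono_shift[OF wt])
  have pw: "(x ^ n) powr e = (x powr e) ^ n" if "0 < x" for x e :: real and n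
    using that by (simp add: powr_powr powr_realpow[symmetric] mult.commute flip: powr_realpow)
  have "norm (mono (\<alpha> m) w) powr (p - 2)
      = norm (mono a w) powr (p - 2) * (\<Prod>j\<in>UNIV. (norm (mono (A $ j) w) ^ m j) powr (p - 2))"
    unfolding mw by (simp add: norm_mult powr_mult prod_nonneg norm_power prod_powr_distrib flip: prod_norm)
  also have "\<dots> = norm (mono a w) powr (p - 2) * (\<Prod>j\<in>UNIV. (norm (mono (A $ j) w) powr (p - 2)) ^ m j)"
    using mono_nonzero[OF wt] by (simp add: pw)
  finally have nw: "norm (mono (\<alpha> m) w) powr (p - 2)
      = norm (mono a w) powr (p - 2) * (\<Prod>j\<in>UNIV. (norm (mono (A $ j) w) powr (p - 2)) ^ m j)" .
  show ?thesis
    unfolding L unfolding nw unfolding mz mw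
    by (simp add: kvar_def prod.distrib power_mult_distrib mult_ac)
qed

text \<open>\<open>Sp\<close> is a finite disjoint union of translated orthants, each parametrized
  injectively by \<open>m\<close>, and over each of them the multiple series factors.\<close>

lemma mbk_eq_closed:
  assumes z: "z \<in> V" and w: "w \<in> V"
  shows "mbk p U z w = mbk_closed z w"
proof -
  define T where "T \<alpha> = mono \<alpha> z * cnj (mono \<alpha> w) * of_real (norm (mono \<alpha> w) powr (p - 2))
        / of_real (enn2real (Lp_normp p U (mono \<alpha>)))" for \<alpha>
  define S where "S a = (\<lambda>m. shift a (\<lambda>j. int (m j))) ` UNIV" for a
  define r where "r a = mono a z * cnj (mono a w) * of_real (norm (mono a w) powr (p - 2)) / of_real C0
      * (\<Prod>j\<in>UNIV. (of_real (beta p a j) + of_real (p - beta p a j) * kvar z w j) / (1 - kvar z w j)\<^sup>2)" for a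
  have sum: "(T has_sum r a) (S a)" if a: "a \<in> base_exponents" for a
  proof -
    define g where "g j m = of_real (beta p a j + p * real m) * kvar z w j ^ m" for j m
    have k: "norm (kvar z w j) < 1" for j by (rule norm_kvar_less_1[OF z w])
    have "((\<lambda>m. \<Prod>j\<in>UNIV. g j (m j)) has_sum (\<Prod>j\<in>UNIV. infsum (g j) UNIV)) UNIV"
    proof (rule has_sum_prod_UNIV)
      show "(\<lambda>m. norm (g j m)) summable_on UNIV" for j
        unfolding g_def by (rule affine_geometric_series(1)[OF k])
      show "g j 0 \<noteq> 0" for j using beta_base_pos[OF a, of j] by (simp add: g_def)
    qed
    moreover have "infsum (g j) UNIV = (of_real (beta p a j) + of_real (p - beta p a j) * kvar z w j) / (1 - kvar z w j)\<^sup>2" for j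
      unfolding g_def by (rule affine_geometric_series(2)[OF k])
    ultimately have "((\<lambda>m. mono a z * cnj (mono a w) * of_real (norm (mono a w) powr (p - 2)) / of_real C0
        * (\<Prod>j\<in>UNIV. g j (m j))) has_sum r a) UNIV"
      unfolding r_def by (intro has_sum_cmult_right) simp
    then have "((\<lambda>m. T (shift a (\<lambda>j. int (m j)))) has_sum r a) UNIV"
      unfolding T_def g_def by (simp only: kernel_term_shift[OF z w a])
    moreover have "inj (\<lambda>m. shift a (\<lambda>j. int (m j)))"
      using shift_unique(2)[OF a a] by (auto intro: injI)
    ultimately show ?thesis unfolding S_def by (subst has_sum_reindex) (simp_all add: comp_def)
  qed
  have "mbk p U z w = infsum T (\<Union>a\<in>base_exponents. S a)"
    unfolding mbk_def T_def S_def Sp_eq_shifts ..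
  also have "\<dots> = (\<Sum>a\<in>base_exponents. infsum T (S a))"
  proof (rule sum_infsum[symmetric])
    show "finite base_exponents" by (rule finite_base_exponents)
    show "T summable_on S a" if "a \<in> base_exponents" for a
      using sum[OF that] by (rule has_sum_imp_summable)
    show "S a \<inter> S a' = {}" if "a \<in> base_exponents" "a' \<in> base_exponents" "a \<noteq> a'" for a a'
      using shift_unique(1)[OF that(1,2)] that(3) unfolding S_def by blast
  qed
  also have "\<dots> = (\<Sum>a\<in>base_exponents. r a)"
    by (intro sum.cong refl infsumI sum)
  finally show ?thesis by (simp add: mbk_closed_def r_def)
qed

text \<open>Singular part of the summand of \<open>mbk_closed\<close> belonging to \<open>a\<close>:
  the factors \<open>\<beta> + (p - \<beta>) X\<close> are bounded for |X| < 1 and go into a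
  constant.\<close>

definition dom_kernel :: "int ^ 'n \<Rightarrow> complex ^ 'n \<Rightarrow> complex ^ 'n \<Rightarrow> real" where
  "dom_kernel a z w = norm (mono a z) * norm (mono a w) powr (p - 1) * (\<Prod>j\<in>UNIV. 1 / (norm (1 - kvar z w j))\<^sup>2)"

text \<open>With an exponent -e, the row estimate has \<sigma> = e and the column estimate \<sigma>
  = e (p - 1). The choice e = 1 / p puts both into (0, 1) for every p > 1.\<close>

definition test_fun :: "int ^ 'n \<Rightarrow> complex ^ 'n \<Rightarrow> real" where
  "test_fun a z = norm (mono a z) * (\<Prod>j\<in>UNIV. (1 - norm (mono (A $ j) z)) powr (- (1 / p)))"

lemma borel_measurable_kvar [measurable (raw)]:
  assumes [measurable]: "f \<in> borel_measurable M" "g \<in> borel_measurable M"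
  shows "(\<lambda>x. kvar (f x) (g x) j) \<in> borel_measurable M"
  unfolding kvar_def by measurable

lemma borel_measurable_mbk_closed [measurable (raw)]:
  assumes [measurable]: "f \<in> borel_measurable M" "g \<in> borel_measurable M"
  shows "(\<lambda>x. mbk_closed (f x) (g x)) \<in> borel_measurable M"
  unfolding mbk_closed_def by measurable

lemma borel_measurable_dom_kernel [measurable (raw)]:
  assumes [measurable]: "f \<in> borel_measurable M" "g \<in> borel_measurable M"
  shows "(\<lambda>x. dom_kernel a (f x) (g x)) \<in> borel_measurable M"
  unfolding dom_kernel_def by measurable

lemma borel_measurable_test_fun [measurable (raw)]:
  assumes [measurable]: "f \<in> borel_measurable M"
  shows "(\<lambda>x. test_fun a (f x)) \<in> borel_measurable M"
  unfolding test_fun_def by measurable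

lemma dom_kernel_nonneg: "0 \<le> dom_kernel a z w"
  unfolding dom_kernel_def by (intro mult_nonneg_nonneg prod_nonneg) auto

lemma test_fun_pos: "z \<in> V \<Longrightarrow> 0 < test_fun a z"
  unfolding test_fun_def using mono_nonzero_V[of z a]
  by (intro mult_pos_pos prod_pos) (auto simp: V_alt less_imp_neq)

lemma norm_mbk_closed_le:
  obtains D :: real where "0 < D"
    "\<And>z w. z \<in> V \<Longrightarrow> w \<in> V \<Longrightarrow> norm (mbk_closed z w) \<le> D * (\<Sum>a\<in>base_exponents. dom_kernel a z w)"
proof -
  define d where "d a = (\<Prod>j\<in>UNIV. beta p a j + \<bar>p - beta p a j\<bar>) / C0" for a
  have d: "0 \<le> d a" if "a \<in> base_exponents" for a
    unfolding d_def using C0_pos less_imp_le[OF beta_base_pos[OF that]]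
    by (intro divide_nonneg_pos prod_nonneg) auto
  \<comment> \<open>The summand 1 makes \<open>D\<close> positive even for an empty sum.\<close>
  define D where "D = (\<Sum>a\<in>base_exponents. d a) + 1"
  have "0 < D" unfolding D_def using sum_nonneg[of base_exponents d] d by simp
  moreover have "norm (mbk_closed z w) \<le> D * (\<Sum>a\<in>base_exponents. dom_kernel a z w)"
    if z: "z \<in> V" and w: "w \<in> V" for z w
  proof -
    have "norm (mbk_closed z w) \<le> (\<Sum>a\<in>base_exponents. D * dom_kernel a z w)"
      unfolding mbk_closed_def
    proof (rule sum_norm_le)
      fix a assume a: "a \<in> base_exponents"
      have b: "0 < beta p a j" for j by (rule beta_base_pos[OF a])
      have "norm (mono a w) > 0" using mono_nonzero_V[OF w] by simp
      then have pw: "norm (mono a w) * norm (mono a w) powr (p - 2) = norm (mono a w) powr (p - 1)"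
        by (simp add: powr_mult_base)
      have "(\<Prod>j\<in>UNIV. norm ((of_real (beta p a j) + of_real (p - beta p a j) * kvar z w j) / (1 - kvar z w j)\<^sup>2))
          \<le> (\<Prod>j\<in>UNIV. (beta p a j + \<bar>p - beta p a j\<bar>) * (1 / (norm (1 - kvar z w j))\<^sup>2))"
      proof (rule prod_mono, safe)
        fix j
        have "norm (of_real (beta p a j) + of_real (p - beta p a j) * kvar z w j)
            \<le> norm (complex_of_real (beta p a j)) + norm (of_real (p - beta p a j) * kvar z w j)"
          by (rule norm_triangle_ineq)
        also have "norm (of_real (p - beta p a j) * kvar z w j) \<le> \<bar>p - beta p a j\<bar>"
          unfolding norm_mult norm_of_real
          using norm_kvar_less_1[OF z w, of j] by (intro mult_left_le) auto
        finally have "norm (of_real (beta p a j) + of_real (p - beta p a j) * kvar z w j) \<le> beta p a j + \<bar>p - beta p a j\<bar>"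
          using b[of j] by simp
        then show "norm ((of_real (beta p a j) + of_real (p - beta p a j) * kvar z w j) / (1 - kvar z w j)\<^sup>2)
          \<le> (beta p a j + \<bar>p - beta p a j\<bar>) * (1 / (norm (1 - kvar z w j))\<^sup>2)"
          unfolding norm_divide norm_power by (simp add: divide_right_mono)
      qed simp
      then have "norm (mono a z * cnj (mono a w) * of_real (norm (mono a w) powr (p - 2)) / of_real C0
        * (\<Prod>j\<in>UNIV. (of_real (beta p a j) + of_real (p - beta p a j) * kvar z w j) / (1 - kvar z w j)\<^sup>2))
        \<le> norm (mono a z) * norm (mono a w) powr (p - 1) / C0
        * (\<Prod>j\<in>UNIV. (beta p a j + \<bar>p - beta p a j\<bar>) * (1 / (norm (1 - kvar z w j))\<^sup>2))"
        unfolding norm_mult norm_divide prod_norm[symmetric] pw[symmetric]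
        using C0_pos by (simp add: mult.assoc mult_left_mono divide_right_mono)
      also have "\<dots> = d a * dom_kernel a z w"
        by (simp add: d_def dom_kernel_def prod.distrib prod_dividef)
      also have "\<dots> \<le> D * dom_kernel a z w"
        using member_le_sum[OF a, of d] d finite_base_exponents
        by (intro mult_right_mono dom_kernel_nonneg) (auto simp: D_def)
      finally show "norm (mono a z * cnj (mono a w) * of_real (norm (mono a w) powr (p - 2)) / of_real C0
        * (\<Prod>j\<in>UNIV. (of_real (beta p a j) + of_real (p - beta p a j) * kvar z w j) / (1 - kvar z w j)\<^sup>2))
        \<le> D * dom_kernel a z w" .
    qed
    then show ?thesis by (simp add: sum_distrib_left)
  qed
  ultimately show ?thesis by (rule that)
qed

end

subsection \<open>Boundedness\<close>

text \<open>Completeness of Lebesgue measure, applied to the extensions by 0. It transfers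
  measurability from the closed form to \<open>mbk\<close>, for which agreement is known almost
  everywhere.\<close>

lemma borel_measurable_lebesgue_on_AE:
  fixes f g :: "'a::euclidean_space \<Rightarrow> 'b::euclidean_space"
  assumes S: "S \<in> sets lebesgue" and f: "f \<in> borel_measurable (lebesgue_on S)"
    and ae: "AE x in lebesgue_on S. f x = g x"
  shows "g \<in> borel_measurable (lebesgue_on S)"
proof -
  have "(\<lambda>x. if x \<in> S then f x else 0) \<in> borel_measurable lebesgue"
    using f S by (simp add: borel_measurable_if)
  moreover have "AE x in lebesgue. (if x \<in> S then f x else 0) = (if x \<in> S then g x else 0)"
    using ae S by (simp add: AE_restrict_space_iff)
  ultimately have "(\<lambda>x. if x \<in> S then g x else 0) \<in> borel_measurable lebesgue"
    by (rule borel_measurable_AE)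
  then show ?thesis using S by (simp add: borel_measurable_if)
qed

context monomial_domain
begin

lemma borel_measurable_lebesgue_on_U: "f \<in> borel_measurable borel \<Longrightarrow> f \<in> borel_measurable (lebesgue_on U)"
  by (intro measurable_restrict_space1 measurable_completion) simp

text \<open>In both estimates the powers of \<open>|mono a|\<close> combine to \<open>|mono a| powr p\<close>, which is integrable.\<close>
lemma dom_kernel_row:
  assumes a: "a \<in> base_exponents"
  shows "\<exists>C::real. 0 < C \<and> (\<forall>z\<in>V.
    (\<integral>\<^sup>+w. ennreal (dom_kernel a z w * test_fun a w) \<partial>lebesgue_on U) \<le> ennreal (C * test_fun a z))"
proof (rule kernel_integral_bound[OF beta_base_pos[OF a], of "1 / p" "p - 1"])
  fix C :: real
  assume C: "0 < C" and bound: "\<And>b :: 'n \<Rightarrow> complex. (\<And>j. norm (b j) < 1) \<Longrightarrow>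
    (\<integral>\<^sup>+z. ennreal (norm (mono a z) powr p * (\<Prod>j\<in>UNIV. (1 - norm (mono (A $ j) z)) powr (- (1 / p)))
       * (\<Prod>j\<in>UNIV. 1 / (norm (1 - b j * (mono (A $ j) z
              * of_real (norm (mono (A $ j) z) powr (p - 1 - 1)))))\<^sup>2)) * indicator V z \<partial>lborel)
    \<le> ennreal (C * (\<Prod>j\<in>UNIV. (1 - norm (b j)) powr (- (1 / p))))"
  show ?thesis
  proof (intro exI conjI ballI, rule C)
    fix z assume z: "z \<in> V"
    \<comment> \<open>Conjugating \<open>1 - kvar z w j\<close> frees the row monomial at
      \<open>w\<close> from its conjugation, which gives the shape of
      \<open>kernel_integral_bound\<close> with \<tau> = p - 1.\<close>
    define b where "b j = cnj (mono (A $ j) z)" for j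
    have b: "norm (b j) < 1" for j using z by (simp add: b_def V_alt)
    have k: "norm (1 - kvar z w j) = norm (1 - b j * (mono (A $ j) w * of_real (norm (mono (A $ j) w) powr (p - 1 - 1))))" for w j
    proof -
      have "cnj (1 - kvar z w j) = 1 - b j * (mono (A $ j) w * of_real (norm (mono (A $ j) w) powr (p - 1 - 1)))"
        by (simp add: kvar_def b_def mult.assoc)
      then show ?thesis by (metis complex_mod_cnj)
    qed
    have "(\<integral>\<^sup>+w. ennreal (dom_kernel a z w * test_fun a w) \<partial>lebesgue_on U)
        = (\<integral>\<^sup>+w. ennreal (dom_kernel a z w * test_fun a w) * indicator V w \<partial>lborel)"
      by (rule nn_integral_U) measurable
    also have "\<dots> = (\<integral>\<^sup>+w. ennreal (norm (mono a z)) * (ennreal (norm (mono a w) powr p * (\<Prod>j\<in>UNIV. (1 - norm (mono (A $ j) w)) powr (- (1 / p)))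
       * (\<Prod>j\<in>UNIV. 1 / (norm (1 - b j * (mono (A $ j) w
              * of_real (norm (mono (A $ j) w) powr (p - 1 - 1)))))\<^sup>2)) * indicator V w) \<partial>lborel)"
    proof (rule nn_integral_cong)
      fix w
      show "ennreal (dom_kernel a z w * test_fun a w) * indicator V w
        = ennreal (norm (mono a z)) * (ennreal (norm (mono a w) powr p * (\<Prod>j\<in>UNIV. (1 - norm (mono (A $ j) w)) powr (- (1 / p)))
       * (\<Prod>j\<in>UNIV. 1 / (norm (1 - b j * (mono (A $ j) w
              * of_real (norm (mono (A $ j) w) powr (p - 1 - 1)))))\<^sup>2)) * indicator V w)"
      proof (cases "w \<in> V")
        case True
        have e: "norm (mono a w) powr (p - 1) * norm (mono a w) = norm (mono a w) powr p"
          using mono_nonzero_V[OF True, of a] by (simp add: powr_diff)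
        have "dom_kernel a z w * test_fun a w = norm (mono a z) * (norm (mono a w) powr p * (\<Prod>j\<in>UNIV. (1 - norm (mono (A $ j) w)) powr (- (1 / p)))
           * (\<Prod>j\<in>UNIV. 1 / (norm (1 - kvar z w j))\<^sup>2))"
          unfolding dom_kernel_def test_fun_def e[symmetric] by (simp only: mult_ac)
        then show ?thesis unfolding k using True by (simp add: ennreal_mult')
      qed simp
    qed
    also have "\<dots> = ennreal (norm (mono a z)) * (\<integral>\<^sup>+w. ennreal (norm (mono a w) powr p * (\<Prod>j\<in>UNIV. (1 - norm (mono (A $ j) w)) powr (- (1 / p)))
       * (\<Prod>j\<in>UNIV. 1 / (norm (1 - b j * (mono (A $ j) w
              * of_real (norm (mono (A $ j) w) powr (p - 1 - 1)))))\<^sup>2)) * indicator V w \<partial>lborel)"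
      by (rule nn_integral_cmult) measurable
    also have "\<dots> \<le> ennreal (norm (mono a z)) * ennreal (C * (\<Prod>j\<in>UNIV. (1 - norm (b j)) powr (- (1 / p))))"
      by (intro mult_left_mono bound b) simp
    also have "\<dots> = ennreal (C * test_fun a z)"
      by (simp add: test_fun_def b_def ennreal_mult'[symmetric] mult_ac)
    finally show "(\<integral>\<^sup>+w. ennreal (dom_kernel a z w * test_fun a w) \<partial>lebesgue_on U) \<le> ennreal (C * test_fun a z)" .
  qed
qed (use p_gt_1 in auto)

lemma dom_kernel_col:
  assumes a: "a \<in> base_exponents"
  shows "\<exists>C::real. 0 < C \<and> (\<forall>w\<in>V.
    (\<integral>\<^sup>+z. ennreal (dom_kernel a z w * test_fun a z powr (p - 1)) \<partial>lebesgue_on U) \<le> ennreal (C * test_fun a w powr (p - 1)))"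
proof -
  define \<sigma> where "\<sigma> = (p - 1) / p"
  have \<sigma>: "0 < \<sigma>" "\<sigma> < 1" using p_gt_1 by (auto simp: \<sigma>_def)
  \<comment> \<open>The constant of \<open>one_minus_powr_ge\<close> for the exponent p - 1.\<close>
  define s where "s = min 1 (p - 1)"
  have s: "0 < s" using p_gt_1 by (simp add: s_def)
  have tf: "test_fun a z powr (p - 1) = norm (mono a z) powr (p - 1) * (\<Prod>j\<in>UNIV. (1 - norm (mono (A $ j) z)) powr (- \<sigma>))"
    if "z \<in> V" for z
  proof -
    have "- (1 / p) * (p - 1) = - \<sigma>" by (simp add: \<sigma>_def)
    moreover have "0 \<le> (\<Prod>j\<in>UNIV. (1 - norm (mono (A $ j) z)) powr (- (1 / p)))" by (simp add: prod_nonneg)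
    ultimately show ?thesis unfolding test_fun_def by (simp add: powr_mult prod_powr_distrib powr_powr)
  qed
  show ?thesis
  proof (rule kernel_integral_bound[OF beta_base_pos[OF a] \<sigma> zero_less_one])
    fix C :: real
    assume C: "0 < C" and bound: "\<And>b :: 'n \<Rightarrow> complex. (\<And>j. norm (b j) < 1) \<Longrightarrow>
      (\<integral>\<^sup>+z. ennreal (norm (mono a z) powr p * (\<Prod>j\<in>UNIV. (1 - norm (mono (A $ j) z)) powr (- \<sigma>))
         * (\<Prod>j\<in>UNIV. 1 / (norm (1 - b j * (mono (A $ j) z
                * of_real (norm (mono (A $ j) z) powr (1 - 1)))))\<^sup>2)) * indicator V z \<partial>lborel)
      \<le> ennreal (C * (\<Prod>j\<in>UNIV. (1 - norm (b j)) powr (- \<sigma>)))"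
    define C' where "C' = C * (s powr (- \<sigma>)) ^ CARD('n)"
    have C': "0 < C'" using C s by (simp add: C'_def)
    show ?thesis
    proof (intro exI conjI ballI, rule C')
      fix w assume w: "w \<in> V"
      \<comment> \<open>The integration variable \<open>z\<close> enters \<open>kvar\<close>
        linearly, hence \<tau> = 1. The power p - 1 now sits in \<open>|b j|\<close>, so the
        resulting weight in \<open>1 - |b j|\<close> must be converted to one in
        \<open>1 - |mono (A $ j) w|\<close>, at the cost of a factor
        \<open>s powr (- \<sigma>)\<close> per row.\<close>
      define b where "b j = cnj (mono (A $ j) w) * of_real (norm (mono (A $ j) w) powr (p - 2))" for j
      have nb: "norm (b j) = norm (mono (A $ j) w) powr (p - 1)" for j
        using mono_nonzero_V[OF w, of "A $ j"] by (simp add: b_def norm_mult powr_mult_base)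
      have w1: "norm (mono (A $ j) w) < 1" for j using w by (simp add: V_alt)
      have ge: "s * (1 - norm (mono (A $ j) w)) \<le> 1 - norm (b j)" for j
        unfolding nb s_def using w1[of j] p_gt_1 by (intro one_minus_powr_ge) auto
      have pos: "0 < s * (1 - norm (mono (A $ j) w))" for j using s w1[of j] by simp
      have b: "norm (b j) < 1" for j using ge[of j] pos[of j] by linarith
      have k: "norm (1 - kvar z w j) = norm (1 - b j * (mono (A $ j) z * of_real (norm (mono (A $ j) z) powr (1 - 1))))"
        if "z \<in> V" for z j
        using mono_nonzero_V[OF that, of "A $ j"] by (simp add: kvar_def b_def mult_ac)
      have "(\<integral>\<^sup>+z. ennreal (dom_kernel a z w * test_fun a z powr (p - 1)) \<partial>lebesgue_on U)
          = (\<integral>\<^sup>+z. ennreal (dom_kernel a z w * test_fun a z powr (p - 1)) * indicator V z \<partial>lborel)"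
        by (rule nn_integral_U) measurable
      also have "\<dots> = (\<integral>\<^sup>+z. ennreal (norm (mono a w) powr (p - 1)) * (ennreal (norm (mono a z) powr p * (\<Prod>j\<in>UNIV. (1 - norm (mono (A $ j) z)) powr (- \<sigma>))
         * (\<Prod>j\<in>UNIV. 1 / (norm (1 - b j * (mono (A $ j) z
                * of_real (norm (mono (A $ j) z) powr (1 - 1)))))\<^sup>2)) * indicator V z) \<partial>lborel)"
      proof (rule nn_integral_cong)
        fix z
        show "ennreal (dom_kernel a z w * test_fun a z powr (p - 1)) * indicator V z
          = ennreal (norm (mono a w) powr (p - 1)) * (ennreal (norm (mono a z) powr p * (\<Prod>j\<in>UNIV. (1 - norm (mono (A $ j) z)) powr (- \<sigma>))
         * (\<Prod>j\<in>UNIV. 1 / (norm (1 - b j * (mono (A $ j) z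
                * of_real (norm (mono (A $ j) z) powr (1 - 1)))))\<^sup>2)) * indicator V z)"
        proof (cases "z \<in> V")
          case True
          have e: "norm (mono a z) * norm (mono a z) powr (p - 1) = norm (mono a z) powr p"
            using mono_nonzero_V[OF True, of a] by (simp add: powr_diff)
          have "dom_kernel a z w * test_fun a z powr (p - 1) = norm (mono a w) powr (p - 1) * (norm (mono a z) powr p * (\<Prod>j\<in>UNIV. (1 - norm (mono (A $ j) z)) powr (- \<sigma>))
             * (\<Prod>j\<in>UNIV. 1 / (norm (1 - kvar z w j))\<^sup>2))"
            unfolding dom_kernel_def tf[OF True] e[symmetric] by (simp only: mult_ac)
          then show ?thesis unfolding k[OF True] using True by (simp add: ennreal_mult')
        qed simp
      qed
      also have "\<dots> = ennreal (norm (mono a w) powr (p - 1)) * (\<integral>\<^sup>+z. ennreal (norm (mono a z) powr p * (\<Prod>j\<in>UNIV. (1 - norm (mono (A $ j) z)) powr (- \<sigma>))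
         * (\<Prod>j\<in>UNIV. 1 / (norm (1 - b j * (mono (A $ j) z
                * of_real (norm (mono (A $ j) z) powr (1 - 1)))))\<^sup>2)) * indicator V z \<partial>lborel)"
        by (rule nn_integral_cmult) measurable
      also have "\<dots> \<le> ennreal (norm (mono a w) powr (p - 1)) * ennreal (C * (\<Prod>j\<in>UNIV. (1 - norm (b j)) powr (- \<sigma>)))"
        by (intro mult_left_mono bound b) simp
      also have "\<dots> \<le> ennreal (norm (mono a w) powr (p - 1)) * ennreal (C' * (\<Prod>j\<in>UNIV. (1 - norm (mono (A $ j) w)) powr (- \<sigma>)))"
      proof (intro mult_left_mono ennreal_leI)
        have "(\<Prod>j\<in>UNIV. (1 - norm (b j)) powr (- \<sigma>)) \<le> (\<Prod>j\<in>UNIV. s powr (- \<sigma>) * (1 - norm (mono (A $ j) w)) powr (- \<sigma>))"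
        proof (rule prod_mono, safe)
          fix j
          have "(1 - norm (b j)) powr (- \<sigma>) \<le> (s * (1 - norm (mono (A $ j) w))) powr (- \<sigma>)"
            using ge pos \<sigma> by (intro powr_mono2') auto
          also have "\<dots> = s powr (- \<sigma>) * (1 - norm (mono (A $ j) w)) powr (- \<sigma>)"
            using s w1[of j] by (simp add: powr_mult)
          finally show "(1 - norm (b j)) powr (- \<sigma>) \<le> s powr (- \<sigma>) * (1 - norm (mono (A $ j) w)) powr (- \<sigma>)" .
        qed simp
        then show "C * (\<Prod>j\<in>UNIV. (1 - norm (b j)) powr (- \<sigma>)) \<le> C' * (\<Prod>j\<in>UNIV. (1 - norm (mono (A $ j) w)) powr (- \<sigma>))"
          using C by (simp add: C'_def prod.distrib)
      qed simp
      also have "\<dots> = ennreal (C' * test_fun a w powr (p - 1))"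
        by (simp add: tf[OF w] ennreal_mult'[symmetric] mult_ac)
      finally show "(\<integral>\<^sup>+z. ennreal (dom_kernel a z w * test_fun a z powr (p - 1)) \<partial>lebesgue_on U) \<le> ennreal (C' * test_fun a w powr (p - 1))" .
    qed
  qed
qed

lemma sets_U: "U \<in> sets lebesgue"
  using open_U by simp

lemma finite_measure_U: "finite_measure (lebesgue_on U)"
  using bounded_U open_U by (intro finite_measure_lebesgue_on) (simp add: lmeasurable_open)

lemma dom_kernel_bounded:
  assumes a: "a \<in> base_exponents"
  obtains C :: real where "0 < C"
    "\<And>f. f \<in> borel_measurable (lebesgue_on U) \<Longrightarrow> (\<And>w. 0 \<le> f w) \<Longrightarrow>
      (\<integral>\<^sup>+w. ennreal (f w powr p) \<partial>lebesgue_on U) < \<infinity> \<Longrightarrow>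
      (AE z in lebesgue_on U. (\<integral>\<^sup>+w. ennreal (dom_kernel a z w * f w) \<partial>lebesgue_on U) < \<infinity>) \<and>
      (\<integral>\<^sup>+z. ennreal (enn2real (\<integral>\<^sup>+w. ennreal (dom_kernel a z w * f w) \<partial>lebesgue_on U) powr p) \<partial>lebesgue_on U)
       \<le> ennreal C * (\<integral>\<^sup>+w. ennreal (f w powr p) \<partial>lebesgue_on U)"
proof -
  obtain C1 where C1: "0 < C1" "\<And>z. z \<in> V \<Longrightarrow>
    (\<integral>\<^sup>+w. ennreal (dom_kernel a z w * test_fun a w) \<partial>lebesgue_on U) \<le> ennreal (C1 * test_fun a z)"
    using dom_kernel_row[OF a] by blast
  obtain C2 where C2: "0 < C2" "\<And>w. w \<in> V \<Longrightarrow>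
    (\<integral>\<^sup>+z. ennreal (dom_kernel a z w * test_fun a z powr (p - 1)) \<partial>lebesgue_on U) \<le> ennreal (C2 * test_fun a w powr (p - 1))"
    using dom_kernel_col[OF a] by blast
  define C where "C = max C1 C2"
  have C: "0 < C" using C1(1) by (simp add: C_def less_max_iff_disj)
  have id: "(\<lambda>x. x) \<in> lebesgue_on U \<rightarrow>\<^sub>M borel" by (rule borel_measurable_lebesgue_on_U) simp
  have [measurable]: "(\<lambda>(z, w). dom_kernel a z w) \<in> borel_measurable (lebesgue_on U \<Otimes>\<^sub>M lebesgue_on U)"
    unfolding case_prod_beta
    by (intro borel_measurable_dom_kernel measurable_compose[OF measurable_fst id] measurable_compose[OF measurable_snd id])
  have tf[measurable]: "test_fun a \<in> borel_measurable (lebesgue_on U)"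
    by (intro borel_measurable_lebesgue_on_U) measurable
  have pos: "AE z in lebesgue_on U. 0 < test_fun a z"
    using AE_U_V by eventually_elim (rule test_fun_pos)
  have row: "AE z in lebesgue_on U. (\<integral>\<^sup>+w. ennreal (dom_kernel a z w * test_fun a w) \<partial>lebesgue_on U) \<le> ennreal (C * test_fun a z)"
    using AE_U_V
  proof eventually_elim
    fix z assume z: "z \<in> V"
    have "C1 * test_fun a z \<le> C * test_fun a z"
      using test_fun_pos[OF z, of a] by (intro mult_right_mono) (auto simp: C_def)
    then show "(\<integral>\<^sup>+w. ennreal (dom_kernel a z w * test_fun a w) \<partial>lebesgue_on U) \<le> ennreal (C * test_fun a z)"
      using C1(2)[OF z] by (meson ennreal_leI order_trans)
  qed
  have col: "AE w in lebesgue_on U. (\<integral>\<^sup>+z. ennreal (dom_kernel a z w * test_fun a z powr (p - 1)) \<partial>lebesgue_on U) \<le> ennreal (C * test_fun a w powr (p - 1))"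
    using AE_U_V
  proof eventually_elim
    fix w assume w: "w \<in> V"
    have "C2 * test_fun a w powr (p - 1) \<le> C * test_fun a w powr (p - 1)"
      by (intro mult_right_mono) (auto simp: C_def)
    then show "(\<integral>\<^sup>+z. ennreal (dom_kernel a z w * test_fun a z powr (p - 1)) \<partial>lebesgue_on U) \<le> ennreal (C * test_fun a w powr (p - 1))"
      using C2(2)[OF w] by (meson ennreal_leI order_trans)
  qed
  interpret finite_measure "lebesgue_on U" by (rule finite_measure_U)
  have sf: "sigma_finite_measure (lebesgue_on U)" ..
  show ?thesis
  proof (rule that[of "C powr p"])
    show "0 < C powr p" using C by simp
    fix f assume f: "f \<in> borel_measurable (lebesgue_on U)" "\<And>w. 0 \<le> f w"
      "(\<integral>\<^sup>+w. ennreal (f w powr p) \<partial>lebesgue_on U) < \<infinity>"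
    show "(AE z in lebesgue_on U. (\<integral>\<^sup>+w. ennreal (dom_kernel a z w * f w) \<partial>lebesgue_on U) < \<infinity>) \<and>
      (\<integral>\<^sup>+z. ennreal (enn2real (\<integral>\<^sup>+w. ennreal (dom_kernel a z w * f w) \<partial>lebesgue_on U) powr p) \<partial>lebesgue_on U)
       \<le> ennreal (C powr p) * (\<integral>\<^sup>+w. ennreal (f w powr p) \<partial>lebesgue_on U)"
      using schur_test[OF sf p_gt_1 C _ dom_kernel_nonneg tf pos row col f] by auto
  qed
qed

end

text \<open>The sum is at most the number of terms times its largest term, whose power is one of the
  summands on the right.\<close>

lemma powr_sum_le:
  fixes x :: "'a \<Rightarrow> real"
  assumes "finite F" "\<And>a. a \<in> F \<Longrightarrow> 0 \<le> x a" "0 < p"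
  shows "(\<Sum>a\<in>F. x a) powr p \<le> real (card F) powr p * (\<Sum>a\<in>F. x a powr p)"
proof (cases "F = {}")
  case False
  define m where "m = Max (x ` F)"
  have "m \<in> x ` F" unfolding m_def using False assms(1) by (intro Max_in) auto
  then obtain b where b: "b \<in> F" "m = x b" by blast
  have le: "x a \<le> m" if "a \<in> F" for a unfolding m_def using that assms(1) by (intro Max_ge) auto
  have "(\<Sum>a\<in>F. x a) \<le> real (card F) * m" using le by (rule sum_bounded_above)
  then have "(\<Sum>a\<in>F. x a) powr p \<le> (real (card F) * m) powr p"
    using assms by (intro powr_mono2 sum_nonneg) auto
  also have "\<dots> = real (card F) powr p * x b powr p" using assms(2) b by (simp add: powr_mult)
  also have "\<dots> \<le> real (card F) powr p * (\<Sum>a\<in>F. x a powr p)"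
    using b assms(1) by (intro mult_left_mono member_le_sum) auto
  finally show ?thesis .
qed simp

context monomial_domain
begin

text \<open>Almost everywhere the kernel is dominated by finitely many \<open>dom_kernel a\<close>,
  whose bounds add up by \<open>powr_sum_le\<close>. Integrability is part of the claim because the
  Bochner integral in \<open>pos_op\<close> is 0 by convention where it fails.\<close>

lemma pos_op_bounded:
  "\<exists>C::real. \<forall>f. in_Lp p U f \<longrightarrow>
     (AE z in lebesgue_on U. integrable (lebesgue_on U) (\<lambda>w. of_real (norm (mbk p U z w)) * f w))
     \<and> in_Lp p U (pos_op p U f)
     \<and> Lp_normp p U (pos_op p U f) \<le> ennreal C * Lp_normp p U f"
proof -
  let ?M = "lebesgue_on U" and ?F = base_exponents
  interpret finite_measure ?M by (rule finite_measure_U)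
  have id: "(\<lambda>x. x) \<in> ?M \<rightarrow>\<^sub>M borel" by (rule borel_measurable_lebesgue_on_U) simp
  have fst_m: "fst \<in> ?M \<Otimes>\<^sub>M ?M \<rightarrow>\<^sub>M borel" and snd_m: "snd \<in> ?M \<Otimes>\<^sub>M ?M \<rightarrow>\<^sub>M borel"
    by (rule measurable_compose[OF measurable_fst id], rule measurable_compose[OF measurable_snd id])
  obtain D where D: "0 < D"
    "\<And>z w. z \<in> V \<Longrightarrow> w \<in> V \<Longrightarrow> norm (mbk_closed z w) \<le> D * (\<Sum>a\<in>?F. dom_kernel a z w)"
    using norm_mbk_closed_le by blast
  define I where "I f a z = (\<integral>\<^sup>+w. ennreal (dom_kernel a z w * norm (f w)) \<partial>?M)"
    for f :: "complex ^ 'n \<Rightarrow> complex" and a z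
  have "\<exists>C>0. \<forall>f. in_Lp p U f \<longrightarrow> (AE z in ?M. I f a z < \<infinity>) \<and>
      (\<integral>\<^sup>+z. ennreal (enn2real (I f a z) powr p) \<partial>?M) \<le> ennreal C * Lp_normp p U f" if "a \<in> ?F" for a
  proof (rule dom_kernel_bounded[OF that])
    fix C :: real
    assume C: "0 < C" and b: "\<And>f. f \<in> borel_measurable (lebesgue_on U) \<Longrightarrow> (\<And>w. 0 \<le> f w) \<Longrightarrow>
      (\<integral>\<^sup>+w. ennreal (f w powr p) \<partial>lebesgue_on U) < \<infinity> \<Longrightarrow>
      (AE z in lebesgue_on U. (\<integral>\<^sup>+w. ennreal (dom_kernel a z w * f w) \<partial>lebesgue_on U) < \<infinity>) \<and>
      (\<integral>\<^sup>+z. ennreal (enn2real (\<integral>\<^sup>+w. ennreal (dom_kernel a z w * f w) \<partial>lebesgue_on U) powr p) \<partial>lebesgue_on U)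
       \<le> ennreal C * (\<integral>\<^sup>+w. ennreal (f w powr p) \<partial>lebesgue_on U)"
    have "(AE z in ?M. I f a z < \<infinity>) \<and>
        (\<integral>\<^sup>+z. ennreal (enn2real (I f a z) powr p) \<partial>?M) \<le> ennreal C * Lp_normp p U f"
      if "in_Lp p U f" for f
    proof -
      from that have f: "(\<lambda>w. norm (f w)) \<in> borel_measurable ?M" "(\<integral>\<^sup>+w. ennreal (norm (f w) powr p) \<partial>?M) < \<infinity>"
        by (auto simp: in_Lp_def Lp_normp_def intro: borel_measurable_norm)
      show ?thesis unfolding I_def Lp_normp_def by (rule b[OF f(1) _ f(2)]) simp
    qed
    with C show ?thesis by blast
  qed
  then obtain c where c: "\<And>a. a \<in> ?F \<Longrightarrow> 0 < c a"
    and cfin: "\<And>a f. a \<in> ?F \<Longrightarrow> in_Lp p U f \<Longrightarrow> (AE z in ?M. I f a z < \<infinity>)"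
    and cbd: "\<And>a f. a \<in> ?F \<Longrightarrow> in_Lp p U f \<Longrightarrow>
      (\<integral>\<^sup>+z. ennreal (enn2real (I f a z) powr p) \<partial>?M) \<le> ennreal (c a) * Lp_normp p U f"
    by metis
  \<comment> \<open>Factor in \<open>(D * x) powr p \<le> E * y\<close>, where x is the finite sum
    of the integrals \<open>I f a z\<close> and y the sum of their p-th powers.\<close>
  define E where "E = (D * real (card ?F)) powr p"
  define C where "C = E * (\<Sum>a\<in>?F. c a)"
  show ?thesis
  proof (intro exI[of _ C] allI impI)
    fix f assume f: "in_Lp p U f"
    then have [measurable]: "f \<in> borel_measurable ?M" by (simp add: in_Lp_def)
    \<comment> \<open>\<open>h\<close> carries the kernel itself and \<open>k\<close> its closed
      form. Joint measurability is proved for \<open>k\<close>; for z in \<open>V\<close> both agree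
      for almost every w, which carries measurability and integrals over to
      \<open>h\<close>.\<close>
    define h where "h z w = complex_of_real (norm (mbk p U z w)) * f w" for z w
    define k where "k z w = complex_of_real (norm (mbk_closed z w)) * f w" for z w
    have pos_op_h: "pos_op p U f z = integral\<^sup>L ?M (h z)" for z
      unfolding pos_op_def by (rule Bochner_Integration.integral_cong) (simp_all add: h_def)
    have k_meas: "(\<lambda>(z, w). k z w) \<in> borel_measurable (?M \<Otimes>\<^sub>M ?M)"
    proof -
      have [measurable]: "(\<lambda>x. mbk_closed (fst x) (snd x)) \<in> borel_measurable (?M \<Otimes>\<^sub>M ?M)"
        by (rule borel_measurable_mbk_closed[OF fst_m snd_m])
      show ?thesis unfolding k_def case_prod_beta by measurable
    qed
    have dk_meas: "(\<lambda>(z, w). ennreal (dom_kernel a z w * norm (f w))) \<in> borel_measurable (?M \<Otimes>\<^sub>M ?M)" for a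
    proof -
      have [measurable]: "(\<lambda>x. dom_kernel a (fst x) (snd x)) \<in> borel_measurable (?M \<Otimes>\<^sub>M ?M)"
        by (rule borel_measurable_dom_kernel[OF fst_m snd_m])
      show ?thesis unfolding case_prod_beta by measurable
    qed
    have k1[measurable]: "k z \<in> borel_measurable ?M" for z
    proof -
      have [measurable]: "mbk_closed z \<in> borel_measurable ?M"
        by (rule borel_measurable_lebesgue_on_U) measurable
      show ?thesis unfolding k_def by measurable
    qed
    have dk1[measurable]: "(\<lambda>w. ennreal (dom_kernel a z w * norm (f w))) \<in> borel_measurable ?M" for a z
    proof -
      have [measurable]: "dom_kernel a z \<in> borel_measurable ?M"
        by (rule borel_measurable_lebesgue_on_U) measurable
      show ?thesis by measurable
    qed
    have I_meas[measurable]: "I f a \<in> borel_measurable ?M" for a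
      unfolding I_def using dk_meas[of a] by (rule borel_measurable_nn_integral)
    have hk: "AE w in ?M. k z w = h z w" if "z \<in> V" for z
      using AE_U_V by eventually_elim (simp add: h_def k_def mbk_eq_closed[OF that])
    have h1: "h z \<in> borel_measurable ?M" if "z \<in> V" for z
      using borel_measurable_lebesgue_on_AE[OF sets_U k1 hk[OF that]] .
    have "AE z in ?M. \<forall>a\<in>?F. I f a z < \<infinity>"
      using cfin[OF _ f] finite_base_exponents by (intro AE_finite_allI)
    then have ae: "AE z in ?M. integrable ?M (h z) \<and>
        norm (pos_op p U f z) \<le> D * (\<Sum>a\<in>?F. enn2real (I f a z))"
      using AE_U_V
    proof eventually_elim
      fix z assume Ifin: "\<forall>a\<in>?F. I f a z < \<infinity>" and z: "z \<in> V"
      have "(\<integral>\<^sup>+w. ennreal (norm (h z w)) \<partial>?M) \<le> (\<integral>\<^sup>+w. (\<Sum>a\<in>?F. ennreal D * ennreal (dom_kernel a z w * norm (f w))) \<partial>?M)"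
      proof (rule nn_integral_mono_AE, use AE_U_V in eventually_elim)
        fix w assume w: "w \<in> V"
        have "norm (h z w) \<le> D * (\<Sum>a\<in>?F. dom_kernel a z w) * norm (f w)"
          unfolding h_def norm_mult mbk_eq_closed[OF z w] using D(2)[OF z w] by (intro mult_right_mono) auto
        also have "\<dots> = (\<Sum>a\<in>?F. D * (dom_kernel a z w * norm (f w)))"
          by (simp add: sum_distrib_left sum_distrib_right mult.assoc)
        finally have "ennreal (norm (h z w)) \<le> ennreal (\<Sum>a\<in>?F. D * (dom_kernel a z w * norm (f w)))" by (rule ennreal_leI)
        also have "\<dots> = (\<Sum>a\<in>?F. ennreal (D * (dom_kernel a z w * norm (f w))))"
          using D(1) dom_kernel_nonneg by (intro sum_ennreal[symmetric]) auto
        also have "\<dots> = (\<Sum>a\<in>?F. ennreal D * ennreal (dom_kernel a z w * norm (f w)))"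
          using D(1) by (simp add: ennreal_mult')
        finally show "ennreal (norm (h z w)) \<le> (\<Sum>a\<in>?F. ennreal D * ennreal (dom_kernel a z w * norm (f w)))" .
      qed
      also have "\<dots> = (\<Sum>a\<in>?F. ennreal D * I f a z)"
        unfolding I_def by (subst nn_integral_sum) (simp_all add: nn_integral_cmult)
      also have "\<dots> = (\<Sum>a\<in>?F. ennreal (D * enn2real (I f a z)))"
        using Ifin D(1) by (intro sum.cong) (auto simp: ennreal_mult')
      also have "\<dots> = ennreal (D * (\<Sum>a\<in>?F. enn2real (I f a z)))"
        using D(1) by (simp add: sum_distrib_left sum_ennreal)
      finally have le: "(\<integral>\<^sup>+w. ennreal (norm (h z w)) \<partial>?M) \<le> ennreal (D * (\<Sum>a\<in>?F. enn2real (I f a z)))" .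
      have int: "integrable ?M (h z)"
        using h1[OF z] le_less_trans[OF le] by (intro integrableI_bounded) simp_all
      have "ennreal (norm (pos_op p U f z)) \<le> (\<integral>\<^sup>+w. ennreal (norm (h z w)) \<partial>?M)"
        unfolding pos_op_h by (rule integral_norm_bound_ennreal[OF int])
      with le have "ennreal (norm (pos_op p U f z)) \<le> ennreal (D * (\<Sum>a\<in>?F. enn2real (I f a z)))" by (rule order_trans[rotated])
      then have "norm (pos_op p U f z) \<le> D * (\<Sum>a\<in>?F. enn2real (I f a z))"
        using D(1) by (subst (asm) ennreal_le_iff) (auto intro!: mult_nonneg_nonneg sum_nonneg)
      with int show "integrable ?M (h z) \<and> norm (pos_op p U f z) \<le> D * (\<Sum>a\<in>?F. enn2real (I f a z))" by blast
    qed
    have meas: "pos_op p U f \<in> borel_measurable ?M"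
    proof (rule borel_measurable_lebesgue_on_AE[OF sets_U])
      show "(\<lambda>z. \<integral>w. k z w \<partial>?M) \<in> borel_measurable ?M"
        using k_meas by (rule borel_measurable_lebesgue_integral)
      show "AE z in ?M. (\<integral>w. k z w \<partial>?M) = pos_op p U f z"
        using AE_U_V
      proof eventually_elim
        fix z assume z: "z \<in> V"
        have "(\<integral>w. k z w \<partial>?M) = (\<integral>w. h z w \<partial>?M)"
          by (rule integral_cong_AE) (use h1[OF z] hk[OF z] in auto)
        then show "(\<integral>w. k z w \<partial>?M) = pos_op p U f z" by (simp add: pos_op_h)
      qed
    qed
    have "Lp_normp p U (pos_op p U f) \<le> (\<integral>\<^sup>+z. (\<Sum>a\<in>?F. ennreal E * ennreal (enn2real (I f a z) powr p)) \<partial>?M)"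
      unfolding Lp_normp_def
    proof (rule nn_integral_mono_AE, use ae in eventually_elim)
      fix z assume z: "integrable ?M (h z) \<and> norm (pos_op p U f z) \<le> D * (\<Sum>a\<in>?F. enn2real (I f a z))"
      have "norm (pos_op p U f z) powr p \<le> (D * (\<Sum>a\<in>?F. enn2real (I f a z))) powr p"
        using z p_gt_1 by (intro powr_mono2) auto
      also have "\<dots> = D powr p * (\<Sum>a\<in>?F. enn2real (I f a z)) powr p"
        using D(1) by (intro powr_mult)
      also have "\<dots> \<le> D powr p * (real (card ?F) powr p * (\<Sum>a\<in>?F. enn2real (I f a z) powr p))"
        using p_gt_1 finite_base_exponents by (intro mult_left_mono powr_sum_le) auto
      also have "\<dots> = (\<Sum>a\<in>?F. E * enn2real (I f a z) powr p)"
        using D(1) by (simp add: E_def powr_mult sum_distrib_left mult.assoc)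
      finally have "ennreal (norm (pos_op p U f z) powr p) \<le> ennreal (\<Sum>a\<in>?F. E * enn2real (I f a z) powr p)" by (rule ennreal_leI)
      also have "\<dots> = (\<Sum>a\<in>?F. ennreal E * ennreal (enn2real (I f a z) powr p))"
        by (simp add: E_def ennreal_mult' flip: sum_ennreal)
      finally show "ennreal (norm (pos_op p U f z) powr p) \<le> (\<Sum>a\<in>?F. ennreal E * ennreal (enn2real (I f a z) powr p))" .
    qed
    also have "\<dots> = (\<Sum>a\<in>?F. ennreal E * (\<integral>\<^sup>+z. ennreal (enn2real (I f a z) powr p) \<partial>?M))"
      by (subst nn_integral_sum) (simp_all add: nn_integral_cmult)
    also have "\<dots> \<le> (\<Sum>a\<in>?F. ennreal E * (ennreal (c a) * Lp_normp p U f))"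
      by (intro sum_mono mult_left_mono cbd f) auto
    also have "\<dots> = ennreal E * ((\<Sum>a\<in>?F. ennreal (c a)) * Lp_normp p U f)"
      by (simp add: sum_distrib_left sum_distrib_right)
    also have "(\<Sum>a\<in>?F. ennreal (c a)) = ennreal (\<Sum>a\<in>?F. c a)"
      using c by (intro sum_ennreal) (simp add: less_imp_le)
    also have "ennreal E * (ennreal (\<Sum>a\<in>?F. c a) * Lp_normp p U f) = ennreal C * Lp_normp p U f"
      by (simp add: C_def E_def ennreal_mult' mult.assoc)
    finally have bound: "Lp_normp p U (pos_op p U f) \<le> ennreal C * Lp_normp p U f" .
    also have "\<dots> < \<infinity>" using f by (simp add: in_Lp_def ennreal_mult_less_top)
    finally have "in_Lp p U (pos_op p U f)" using meas by (simp add: in_Lp_def)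
    moreover have "AE z in ?M. integrable ?M (\<lambda>w. of_real (norm (mbk p U z w)) * f w)"
      using ae
    proof eventually_elim
      fix z assume "integrable ?M (h z) \<and> norm (pos_op p U f z) \<le> D * (\<Sum>a\<in>?F. enn2real (I f a z))"
      moreover have "h z = (\<lambda>w. of_real (norm (mbk p U z w)) * f w)" by (simp add: h_def fun_eq_iff)
      ultimately show "integrable ?M (\<lambda>w. of_real (norm (mbk p U z w)) * f w)" by simp
    qed
    ultimately show "(AE z in ?M. integrable ?M (\<lambda>w. of_real (norm (mbk p U z w)) * f w))
      \<and> in_Lp p U (pos_op p U f) \<and> Lp_normp p U (pos_op p U f) \<le> ennreal C * Lp_normp p U f"
      using bound by blast
  qed
qed

end

theorem theorem1p2:
  fixes p :: real and U :: "(complex ^ 'n) set"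
  assumes "1 < p" and "monomial_polyhedron U"
  shows "\<exists>C::real. \<forall>f. in_Lp p U f \<longrightarrow>
           (AE z in lebesgue_on U. integrable (lebesgue_on U) (\<lambda>w. of_real (norm (mbk p U z w)) * f w))
           \<and> in_Lp p U (pos_op p U f)
           \<and> Lp_normp p U (pos_op p U f) \<le> ennreal C * Lp_normp p U f"
proof -
  obtain A :: "int ^ 'n ^ 'n" where "open U" "bounded U" "det A \<noteq> 0"
    "U = {z. \<forall>j. mono_defined (A $ j) z \<and> norm (mono (A $ j) z) < 1}"
    using assms(2) by (auto simp: monomial_polyhedron_def)
  with assms(1) interpret monomial_domain A U p
    by unfold_locales
  show ?thesis by (rule pos_op_bounded)
qed

end
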